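(* Let $X=\{x_1,\ldots,x_n\}\subset\mathbb R^d$ be a pointset with aspect ratio $\Phi$, and let $\epsilon,\delta>0$. Let $\Lambda=O(\log(d\log\Phi/(\epsilon\delta)))$ and $L=\log\Phi+\Lambda$. Then QuadSketch with parameters $L,\Lambda$ runs in time $\tilde O(ndL)$ and produces a sketch of size $O(nd\Lambda+n\log n)$ bits such that, for every $i\in[n]$, \[ \Pr\left[\forall j\in[n]:\ \|\tilde x_i-\tilde x_j\| = (1\pm\epsilon)\|x_i-x_j\| \right] \geq 1-\delta, \] where $\tilde x_1,\ldots,\tilde x_n$ are the points decompressed from the sketch. In particular, with probability at least $1-\delta$, if $\tilde x_{i^*}$ is the nearest neighbor of $\tilde x_i$ in $\tilde X=\{\tilde x_1,\ldots,\tilde x_n\}$, then $x_{i^*}$ is a $(1+\epsilon)$-approximate nearest neighbor of $x_i$ in $X$.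
   Context: Norms are Euclidean, logarithms are base 2, $[n]=\{1,\ldots,n\}$, $\tilde O$ suppresses polylogarithmic factors, and $a=(1\pm\epsilon)b$ means $(1-\epsilon)b\le a\le(1+\epsilon)b$. The aspect ratio is $\Phi=\max_{i<j}\|x_i-x_j\|/\min_{i<j}\|x_i-x_j\|$ (points assumed distinct). QuadSketch (parameters $L$, $\Lambda$): Step 1 (random shift). Let $\Delta'=\max_i\|x_1-x_i\|$ and $\Delta=2^{\lceil\log\Delta'\rceil}$. Let $H$ be the axis-parallel hypercube centered at $x_1$ of side $4\Delta$; choose $\sigma_1,\ldots,\sigma_d$ independently uniformly in $[-\Delta,\Delta]$ and shift $H$ by $\sigma_k$ in coordinate $k$. For every integer $\ell\le\log(4\Delta)$, $G_\ell$ is the axis-parallel grid of cell side $2^\ell$ aligned with $H$. Step 2 (quadtree). Build the $2^d$-ary tree whose root is $H$ (level $\log(4\Delta)$) and where a node at level $\ell$ (a cell of $G_\ell$) has as children those cells of $G_{\ell-1}$ contained in it that contain at least one point of $X$; stop after $L$ levels. The edge from a node $v$ to child $v'$ is labeled by a length-$d$ bitstring whose $k$-th bit is $0$ if $v'$ is in the lower half of $v$ along coordinate $k$ and $1$ otherwise. Call this tree $T^*$; each $x_i$ lies in exactly one leaf $v_i$. Step 3 (pruning). For every downward path $u_0,u_1,\ldots,u_k$ where $u_1,\ldots,u_{k-1}$ have exactly one child and $u_0,u_k$ do not have exactly one child, if $k>\Lambda+1$, delete $u_{\Lambda+1},\ldots,u_{k-1}$ and connect $u_k$ directly as child of $u_\Lambda$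 by a "long edge" labeled with the number $k-\Lambda$; other edges are "short". The resulting tree is $T$. The sketch stores the structure of $T$ (via a DFS encoding with the edge labels, and a bit marking short/long edges) and, for each $i$, the index of the leaf $v_i$. Decompression: for a node $u$, define $c(u)\in\mathbb R^d$ by, for each coordinate $k$, concatenating along the root-to-$u$ path the $k$-th bits of short-edge labels and $m$ zeros for each long edge labeled $m$, interpreting the result as a binary expansion whose bit positions correspond to grid levels (position of level $\ell$ having weight $2^\ell$, padding with zeros as needed). Then $\tilde x_i=c(v_i)$.
   Formalization: The logarithm in Λ is read as log(2 + d·max(1, log Φ)/(min(1,ε)·min(1,δ))), since the stated one is undefined for Φ = 1 (e.g. n = 2); n ≥ 2, log Φ in L is rounded up, and n, d, L and the scale log(4Δ) are known to the decoder. *)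

theory Defs
  imports "HOL-Probability.Probability" "HOL-Library.Time_Functions"
begin

section \<open>Points\<close>

text \<open>The dimension is a quantified number, so a point of \<open>\<real>\<^sup>d\<close> is a list of \<open>d\<close> reals and a
  pointset is a list of distinct such lists, which also fixes the numbering of its points.\<close>

definition eucl_dist :: "nat \<Rightarrow> real list \<Rightarrow> real list \<Rightarrow> real" where
  "eucl_dist d x y = L2_set (\<lambda>k. x ! k - y ! k) {..<d}"

definition pair_dists :: "nat \<Rightarrow> real list list \<Rightarrow> real set" where
  "pair_dists d X = {eucl_dist d (X ! i) (X ! j) | i j. i < j \<and> j < length X}"

definition aspect_ratio :: "nat \<Rightarrow> real list list \<Rightarrow> real" where
  "aspect_ratio d X = Max (pair_dists d X) / Min (pair_dists d X)"


section \<open>The algorithm\<close>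

text \<open>QuadSketch is given as a functional program, so that its running time can be counted below.
  The random shift is an argument of the program.\<close>

datatype 'e qtree = Leaf "nat list" | Node "('e \<times> 'e qtree) list"
  \<comment> \<open>an edge label is stored with the child it leads to; a leaf lists the points in its cell\<close>

datatype edge = Short "bool list" | Long nat


subsection \<open>Random shift\<close>

fun sq_dist :: "real list \<Rightarrow> real list \<Rightarrow> real" where
  "sq_dist (x # xs) (y # ys) = (x - y) * (x - y) + sq_dist xs ys"
| "sq_dist _ _ = 0"

fun max_dist :: "real list \<Rightarrow> real list list \<Rightarrow> real" where
  "max_dist x [] = 0"
| "max_dist x (y # ys) = max (sqrt (sq_dist x y)) (max_dist x ys)"

definition ceil_log :: "real \<Rightarrow> int" where
  "ceil_log r = \<lceil>log 2 r\<rceil>"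

definition pow2 :: "int \<Rightarrow> real" where
  "pow2 l = 2 powi l"

fun log_radius :: "real list list \<Rightarrow> int" where
  "log_radius [] = 0"
| "log_radius (x # xs) = ceil_log (max_dist x xs)"

text \<open>The least corner of the cube of side \<open>4 D\<close> centred at the shifted first point.\<close>

fun cube_corner :: "real \<Rightarrow> real list \<Rightarrow> real list \<Rightarrow> real list" where
  "cube_corner D (x # xs) (s # ss) = (x + s - 2 * D) # cube_corner D xs ss"
| "cube_corner D _ _ = []"


subsection \<open>Quadtree\<close>

text \<open>A cell is given by its least corner and its side; halving all sides of a cell of one grid
  yields its subcells in the next finer grid. Cells contain their lower faces. An upper face belongs
  to the neighbouring cell, except on the boundary of the root cube, which is closed.

  \<open>split_cell h cs ps\<close> distributes the points \<open>ps\<close> of the cell with least corner \<open>cs\<close> and side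
  \<open>2 * h\<close> over its subcells, one coordinate at a time; only nonempty subcells are returned. Each
  point is accompanied by the list of those of its coordinates that have not been inspected yet.\<close>

fun lower_half :: "real \<Rightarrow> ('a \<times> real list) list \<Rightarrow> ('a \<times> real list) list" where
  "lower_half m ((p, y # ys) # ps) =
     (if y < m then (p, ys) # lower_half m ps else lower_half m ps)"
| "lower_half m _ = []"

fun upper_half :: "real \<Rightarrow> ('a \<times> real list) list \<Rightarrow> ('a \<times> real list) list" where
  "upper_half m ((p, y # ys) # ps) =
     (if y < m then upper_half m ps else (p, ys) # upper_half m ps)"
| "upper_half m _ = []"

fun prefix_bit :: "bool \<Rightarrow> (bool list \<times> 'a) list \<Rightarrow> (bool list \<times> 'a) list" where
  "prefix_bit b [] = []"
| "prefix_bit b ((bs, ps) # gs) = (b # bs, ps) # prefix_bit b gs"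

fun firsts :: "('a \<times> 'b) list \<Rightarrow> 'a list" where
  "firsts [] = []"
| "firsts ((a, b) # ps) = a # firsts ps"

fun split_cell :: "real \<Rightarrow> real list \<Rightarrow> ('a \<times> real list) list \<Rightarrow> (bool list \<times> 'a list) list" where
  "split_cell h cs [] = []"
| "split_cell h [] (p # ps) = [([], firsts (p # ps))]"
| "split_cell h (c # cs) (p # ps) =
     prefix_bit False (split_cell h cs (lower_half (c + h) (p # ps))) @
     prefix_bit True (split_cell h cs (upper_half (c + h) (p # ps)))"

fun number :: "nat \<Rightarrow> real list list \<Rightarrow> (nat \<times> real list) list" where
  "number i [] = []"
| "number i (x # xs) = (i, x) # number (i + 1) xs"

fun attach_coords :: "(nat \<times> real list) list \<Rightarrow> ((nat \<times> real list) \<times> real list) list" where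
  "attach_coords [] = []"
| "attach_coords ((i, x) # ps) = ((i, x), x) # attach_coords ps"

fun child_corner :: "real \<Rightarrow> real list \<Rightarrow> bool list \<Rightarrow> real list" where
  "child_corner h (c # cs) (b # bs) = (if b then c + h else c) # child_corner h cs bs"
| "child_corner h _ _ = []"

text \<open>\<open>build l s cs ps\<close> is the quadtree with \<open>l\<close> levels below the cell of side \<open>s\<close> and least corner
  \<open>cs\<close>, which contains the numbered points \<open>ps\<close>.\<close>

fun build :: "nat \<Rightarrow> real \<Rightarrow> real list \<Rightarrow> (nat \<times> real list) list \<Rightarrow> bool list qtree"
  and build_children :: "nat \<Rightarrow> real \<Rightarrow> real list \<Rightarrow> (bool list \<times> (nat \<times> real list) list) list \<Rightarrow>
    (bool list \<times> bool list qtree) list" where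
  "build 0 s cs ps = Leaf (firsts ps)"
| "build (Suc l) s cs ps =
     Node (build_children l (s / 2) cs (split_cell (s / 2) cs (attach_coords ps)))"
| "build_children l h cs [] = []"
| "build_children l h cs ((bs, ps) # gs) =
     (bs, build l h (child_corner h cs bs) ps) # build_children l h cs gs"


subsection \<open>Pruning\<close>

text \<open>From a node, follow the path through nodes with exactly one child: its labels, and the first
  node on it that does not have exactly one child.\<close>

fun chain_labels :: "'e qtree \<Rightarrow> 'e list" where
  "chain_labels (Node [(e, t)]) = e # chain_labels t"
| "chain_labels t = []"

fun chain_end :: "'e qtree \<Rightarrow> 'e qtree" where
  "chain_end (Node [(e, t)]) = chain_end t"
| "chain_end t = t"

lemma size_chain_end: "size (chain_end t) \<le> size t"
  by (induction t rule: chain_end.induct) auto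

lemma size_chain_end_less [termination_simp]: "size (chain_end t) < Suc (size t + m)"
  using size_chain_end[of t] by linarith

fun short_edges :: "bool list list \<Rightarrow> edge list" where
  "short_edges [] = []"
| "short_edges (bs # ls) = Short bs # short_edges ls"

fun path_edges :: "nat \<Rightarrow> bool list list \<Rightarrow> edge list" where
  "path_edges \<Lambda> ls = (let k = length ls in
     if k > \<Lambda> + 1 then short_edges (take \<Lambda> ls) @ [Long (k - \<Lambda>)] else short_edges ls)"

fun hang :: "'e list \<Rightarrow> 'e qtree \<Rightarrow> 'e qtree" where
  "hang [] t = t"
| "hang (e # es) t = Node [(e, hang es t)]"

fun add_branch :: "'e list \<Rightarrow> 'e qtree \<Rightarrow> ('e \<times> 'e qtree) list \<Rightarrow> ('e \<times> 'e qtree) list" where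
  "add_branch [] t ts = ts"
| "add_branch (e # es) t ts = (e, hang es t) # ts"

text \<open>\<open>prune\<close> is only called on nodes that do not have exactly one child. If the root has exactly
  one child, the path from the root to the first such node does not start at a node of this kind, so
  it is not shortened.\<close>

fun prune :: "nat \<Rightarrow> bool list qtree \<Rightarrow> edge qtree"
  and prune_children :: "nat \<Rightarrow> (bool list \<times> bool list qtree) list \<Rightarrow> (edge \<times> edge qtree) list" where
  "prune \<Lambda> (Leaf js) = Leaf js"
| "prune \<Lambda> (Node ts) = Node (prune_children \<Lambda> ts)"
| "prune_children \<Lambda> [] = []"
| "prune_children \<Lambda> ((bs, t) # ts) =
     add_branch (path_edges \<Lambda> (bs # chain_labels t)) (prune \<Lambda> (chain_end t)) (prune_children \<Lambda> ts)"

fun prune_root :: "nat \<Rightarrow> bool list qtree \<Rightarrow> edge qtree" where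
  "prune_root \<Lambda> t = hang (short_edges (chain_labels t)) (prune \<Lambda> (chain_end t))"


subsection \<open>Bit encoding\<close>

fun width :: "nat \<Rightarrow> nat" where
  "width m = (if m = 0 then 0 else width (m div 2) + 1)"

declare width.simps [simp del]

fun to_bits :: "nat \<Rightarrow> nat \<Rightarrow> bool list" where
  "to_bits 0 m = []"
| "to_bits (Suc w) m = (m mod 2 = 1) # to_bits w (m div 2)"

text \<open>In the depth-first encoding, \<open>True\<close> descends along a new edge, whose encoding follows, and
  \<open>False\<close> returns to the parent. The label of a long edge takes \<open>w\<close> bits. The argument \<open>acc\<close> holds
  the bits that come afterwards.\<close>

fun encode_edge :: "nat \<Rightarrow> edge \<Rightarrow> bool list \<Rightarrow> bool list" where
  "encode_edge w (Short bs) acc = False # (bs @ acc)"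
| "encode_edge w (Long m) acc = True # (to_bits w m @ acc)"

fun encode_tree :: "nat \<Rightarrow> edge qtree \<Rightarrow> bool list \<Rightarrow> bool list"
  and encode_children :: "nat \<Rightarrow> (edge \<times> edge qtree) list \<Rightarrow> bool list \<Rightarrow> bool list" where
  "encode_tree w (Leaf js) acc = False # acc"
| "encode_tree w (Node ts) acc = encode_children w ts (False # acc)"
| "encode_children w [] acc = acc"
| "encode_children w ((e, t) # ts) acc =
     True # encode_edge w e (encode_tree w t (encode_children w ts acc))"

text \<open>Leaves are numbered in depth-first order. The pairs (point, leaf) are sorted by the number of
  the point.\<close>

fun leaf_sets :: "edge qtree \<Rightarrow> nat list list \<Rightarrow> nat list list"
  and leaf_sets_children :: "(edge \<times> edge qtree) list \<Rightarrow> nat list list \<Rightarrow> nat list list" where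
  "leaf_sets (Leaf js) acc = js # acc"
| "leaf_sets (Node ts) acc = leaf_sets_children ts acc"
| "leaf_sets_children [] acc = acc"
| "leaf_sets_children ((e, t) # ts) acc = leaf_sets t (leaf_sets_children ts acc)"

fun with_leaf :: "nat \<Rightarrow> nat list \<Rightarrow> (nat \<times> nat) list \<Rightarrow> (nat \<times> nat) list" where
  "with_leaf v [] acc = acc"
| "with_leaf v (i # js) acc = (i, v) # with_leaf v js acc"

fun leaf_indices :: "nat \<Rightarrow> nat list list \<Rightarrow> (nat \<times> nat) list" where
  "leaf_indices v [] = []"
| "leaf_indices v (js # jss) = with_leaf v js (leaf_indices (v + 1) jss)"

fun merge :: "(nat \<times> nat) list \<Rightarrow> (nat \<times> nat) list \<Rightarrow> (nat \<times> nat) list" where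
  "merge [] qs = qs"
| "merge ps [] = ps"
| "merge ((i, v) # ps) ((j, w) # qs) =
     (if i \<le> j then (i, v) # merge ps ((j, w) # qs) else (j, w) # merge ((i, v) # ps) qs)"

fun msort :: "(nat \<times> nat) list \<Rightarrow> (nat \<times> nat) list" where
  "msort ps = (let k = length ps in
     if k \<le> 1 then ps else merge (msort (take (k div 2) ps)) (msort (drop (k div 2) ps)))"

declare msort.simps [simp del]

fun encode_indices :: "nat \<Rightarrow> (nat \<times> nat) list \<Rightarrow> bool list" where
  "encode_indices w [] = []"
| "encode_indices w ((i, v) # ps) = to_bits w v @ encode_indices w ps"


subsection \<open>QuadSketch\<close>

fun sketch_tree :: "nat \<Rightarrow> nat \<Rightarrow> real list \<Rightarrow> real list list \<Rightarrow> edge qtree" where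
  "sketch_tree L \<Lambda> \<sigma> [] = Leaf []"
| "sketch_tree L \<Lambda> \<sigma> (x # xs) = (let D = pow2 (log_radius (x # xs)) in
     prune_root \<Lambda> (build L (4 * D) (cube_corner D x \<sigma>) (number 0 (x # xs))))"

fun quadsketch :: "nat \<Rightarrow> nat \<Rightarrow> real list \<Rightarrow> real list list \<Rightarrow> bool list" where
  "quadsketch L \<Lambda> \<sigma> X = (let t = sketch_tree L \<Lambda> \<sigma> X in
     encode_tree (width L) t
       (encode_indices (width (length X)) (msort (leaf_indices 0 (leaf_sets t [])))))"


section \<open>Running time\<close>

text \<open>The step-counting functions follow the scheme of \<^theory>\<open>HOL-Library.Time_Commands\<close>, with one
  step for every call, including calls of nonrecursive functions. Arithmetic on and comparison of
  numbers, square roots, \<^const>\<open>ceil_log\<close> and \<^const>\<open>pow2\<close> are the primitive operations, whose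
  constant cost is absorbed in the step of the call that performs them.\<close>

fun T_sq_dist :: "real list \<Rightarrow> real list \<Rightarrow> nat" where
  "T_sq_dist (x # xs) (y # ys) = T_sq_dist xs ys + 1"
| "T_sq_dist _ _ = 1"

fun T_max_dist :: "real list \<Rightarrow> real list list \<Rightarrow> nat" where
  "T_max_dist x [] = 1"
| "T_max_dist x (y # ys) = T_sq_dist x y + T_max_dist x ys + 1"

fun T_log_radius :: "real list list \<Rightarrow> nat" where
  "T_log_radius [] = 1"
| "T_log_radius (x # xs) = T_max_dist x xs + 1"

fun T_cube_corner :: "real \<Rightarrow> real list \<Rightarrow> real list \<Rightarrow> nat" where
  "T_cube_corner D (x # xs) (s # ss) = T_cube_corner D xs ss + 1"
| "T_cube_corner D _ _ = 1"

fun T_lower_half :: "real \<Rightarrow> ('a \<times> real list) list \<Rightarrow> nat" where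
  "T_lower_half m ((p, y # ys) # ps) = T_lower_half m ps + 1"
| "T_lower_half m _ = 1"

fun T_upper_half :: "real \<Rightarrow> ('a \<times> real list) list \<Rightarrow> nat" where
  "T_upper_half m ((p, y # ys) # ps) = T_upper_half m ps + 1"
| "T_upper_half m _ = 1"

fun T_prefix_bit :: "bool \<Rightarrow> (bool list \<times> 'a) list \<Rightarrow> nat" where
  "T_prefix_bit b [] = 1"
| "T_prefix_bit b ((bs, ps) # gs) = T_prefix_bit b gs + 1"

fun T_firsts :: "('a \<times> 'b) list \<Rightarrow> nat" where
  "T_firsts [] = 1"
| "T_firsts ((a, b) # ps) = T_firsts ps + 1"

fun T_split_cell :: "real \<Rightarrow> real list \<Rightarrow> ('a \<times> real list) list \<Rightarrow> nat" where
  "T_split_cell h cs [] = 1"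
| "T_split_cell h [] (p # ps) = T_firsts (p # ps) + 1"
| "T_split_cell h (c # cs) (p # ps) =
     T_lower_half (c + h) (p # ps) +
     T_split_cell h cs (lower_half (c + h) (p # ps)) +
     T_prefix_bit False (split_cell h cs (lower_half (c + h) (p # ps))) +
     T_upper_half (c + h) (p # ps) +
     T_split_cell h cs (upper_half (c + h) (p # ps)) +
     T_prefix_bit True (split_cell h cs (upper_half (c + h) (p # ps))) +
     T_append (prefix_bit False (split_cell h cs (lower_half (c + h) (p # ps))))
       (prefix_bit True (split_cell h cs (upper_half (c + h) (p # ps)))) + 1"

fun T_number :: "nat \<Rightarrow> real list list \<Rightarrow> nat" where
  "T_number i [] = 1"
| "T_number i (x # xs) = T_number (i + 1) xs + 1"

fun T_attach_coords :: "(nat \<times> real list) list \<Rightarrow> nat" where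
  "T_attach_coords [] = 1"
| "T_attach_coords ((i, x) # ps) = T_attach_coords ps + 1"

fun T_child_corner :: "real \<Rightarrow> real list \<Rightarrow> bool list \<Rightarrow> nat" where
  "T_child_corner h (c # cs) (b # bs) = T_child_corner h cs bs + 1"
| "T_child_corner h _ _ = 1"

fun T_build :: "nat \<Rightarrow> real \<Rightarrow> real list \<Rightarrow> (nat \<times> real list) list \<Rightarrow> nat"
  and T_build_children :: "nat \<Rightarrow> real \<Rightarrow> real list \<Rightarrow>
    (bool list \<times> (nat \<times> real list) list) list \<Rightarrow> nat" where
  "T_build 0 s cs ps = T_firsts ps + 1"
| "T_build (Suc l) s cs ps =
     T_attach_coords ps + T_split_cell (s / 2) cs (attach_coords ps) +
     T_build_children l (s / 2) cs (split_cell (s / 2) cs (attach_coords ps)) + 1"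
| "T_build_children l h cs [] = 1"
| "T_build_children l h cs ((bs, ps) # gs) =
     T_child_corner h cs bs + T_build l h (child_corner h cs bs) ps +
     T_build_children l h cs gs + 1"

fun T_chain_labels :: "'e qtree \<Rightarrow> nat" where
  "T_chain_labels (Node [(e, t)]) = T_chain_labels t + 1"
| "T_chain_labels t = 1"

fun T_chain_end :: "'e qtree \<Rightarrow> nat" where
  "T_chain_end (Node [(e, t)]) = T_chain_end t + 1"
| "T_chain_end t = 1"

fun T_short_edges :: "bool list list \<Rightarrow> nat" where
  "T_short_edges [] = 1"
| "T_short_edges (bs # ls) = T_short_edges ls + 1"

fun T_path_edges :: "nat \<Rightarrow> bool list list \<Rightarrow> nat" where
  "T_path_edges \<Lambda> ls = T_length ls + (let k = length ls in
     if k > \<Lambda> + 1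
     then T_take \<Lambda> ls + T_short_edges (take \<Lambda> ls) +
       T_append (short_edges (take \<Lambda> ls)) [Long (k - \<Lambda>)]
     else T_short_edges ls) + 1"

fun T_hang :: "'e list \<Rightarrow> 'e qtree \<Rightarrow> nat" where
  "T_hang [] t = 1"
| "T_hang (e # es) t = T_hang es t + 1"

fun T_add_branch :: "'e list \<Rightarrow> 'e qtree \<Rightarrow> ('e \<times> 'e qtree) list \<Rightarrow> nat" where
  "T_add_branch [] t ts = 1"
| "T_add_branch (e # es) t ts = T_hang es t + 1"

fun T_prune :: "nat \<Rightarrow> bool list qtree \<Rightarrow> nat"
  and T_prune_children :: "nat \<Rightarrow> (bool list \<times> bool list qtree) list \<Rightarrow> nat" where
  "T_prune \<Lambda> (Leaf js) = 1"
| "T_prune \<Lambda> (Node ts) = T_prune_children \<Lambda> ts + 1"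
| "T_prune_children \<Lambda> [] = 1"
| "T_prune_children \<Lambda> ((bs, t) # ts) =
     T_chain_labels t + T_path_edges \<Lambda> (bs # chain_labels t) +
     T_chain_end t + T_prune \<Lambda> (chain_end t) + T_prune_children \<Lambda> ts +
     T_add_branch (path_edges \<Lambda> (bs # chain_labels t)) (prune \<Lambda> (chain_end t))
       (prune_children \<Lambda> ts) + 1"

fun T_prune_root :: "nat \<Rightarrow> bool list qtree \<Rightarrow> nat" where
  "T_prune_root \<Lambda> t =
     T_chain_labels t + T_short_edges (chain_labels t) +
     T_chain_end t + T_prune \<Lambda> (chain_end t) +
     T_hang (short_edges (chain_labels t)) (prune \<Lambda> (chain_end t)) + 1"

fun T_width :: "nat \<Rightarrow> nat" where
  "T_width m = (if m = 0 then 0 else T_width (m div 2)) + 1"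

declare T_width.simps [simp del]

fun T_to_bits :: "nat \<Rightarrow> nat \<Rightarrow> nat" where
  "T_to_bits 0 m = 1"
| "T_to_bits (Suc w) m = T_to_bits w (m div 2) + 1"

fun T_encode_edge :: "nat \<Rightarrow> edge \<Rightarrow> bool list \<Rightarrow> nat" where
  "T_encode_edge w (Short bs) acc = T_append bs acc + 1"
| "T_encode_edge w (Long m) acc = T_to_bits w m + T_append (to_bits w m) acc + 1"

fun T_encode_tree :: "nat \<Rightarrow> edge qtree \<Rightarrow> bool list \<Rightarrow> nat"
  and T_encode_children :: "nat \<Rightarrow> (edge \<times> edge qtree) list \<Rightarrow> bool list \<Rightarrow> nat" where
  "T_encode_tree w (Leaf js) acc = 1"
| "T_encode_tree w (Node ts) acc = T_encode_children w ts (False # acc) + 1"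
| "T_encode_children w [] acc = 1"
| "T_encode_children w ((e, t) # ts) acc =
     T_encode_children w ts acc + T_encode_tree w t (encode_children w ts acc) +
     T_encode_edge w e (encode_tree w t (encode_children w ts acc)) + 1"

fun T_leaf_sets :: "edge qtree \<Rightarrow> nat list list \<Rightarrow> nat"
  and T_leaf_sets_children :: "(edge \<times> edge qtree) list \<Rightarrow> nat list list \<Rightarrow> nat" where
  "T_leaf_sets (Leaf js) acc = 1"
| "T_leaf_sets (Node ts) acc = T_leaf_sets_children ts acc + 1"
| "T_leaf_sets_children [] acc = 1"
| "T_leaf_sets_children ((e, t) # ts) acc =
     T_leaf_sets_children ts acc + T_leaf_sets t (leaf_sets_children ts acc) + 1"

fun T_with_leaf :: "nat \<Rightarrow> nat list \<Rightarrow> (nat \<times> nat) list \<Rightarrow> nat" where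
  "T_with_leaf v [] acc = 1"
| "T_with_leaf v (i # js) acc = T_with_leaf v js acc + 1"

fun T_leaf_indices :: "nat \<Rightarrow> nat list list \<Rightarrow> nat" where
  "T_leaf_indices v [] = 1"
| "T_leaf_indices v (js # jss) =
     T_leaf_indices (v + 1) jss + T_with_leaf v js (leaf_indices (v + 1) jss) + 1"

fun T_merge :: "(nat \<times> nat) list \<Rightarrow> (nat \<times> nat) list \<Rightarrow> nat" where
  "T_merge [] qs = 1"
| "T_merge ps [] = 1"
| "T_merge ((i, v) # ps) ((j, w) # qs) =
     (if i \<le> j then T_merge ps ((j, w) # qs) else T_merge ((i, v) # ps) qs) + 1"

fun T_msort :: "(nat \<times> nat) list \<Rightarrow> nat" where
  "T_msort ps = T_length ps + (let k = length ps in
     if k \<le> 1 then 0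
     else T_take (k div 2) ps + T_msort (take (k div 2) ps) +
       T_drop (k div 2) ps + T_msort (drop (k div 2) ps) +
       T_merge (msort (take (k div 2) ps)) (msort (drop (k div 2) ps))) + 1"

declare T_msort.simps [simp del]

fun T_encode_indices :: "nat \<Rightarrow> (nat \<times> nat) list \<Rightarrow> nat" where
  "T_encode_indices w [] = 1"
| "T_encode_indices w ((i, v) # ps) =
     T_to_bits w v + T_encode_indices w ps +
     T_append (to_bits w v) (encode_indices w ps) + 1"

fun T_sketch_tree :: "nat \<Rightarrow> nat \<Rightarrow> real list \<Rightarrow> real list list \<Rightarrow> nat" where
  "T_sketch_tree L \<Lambda> \<sigma> [] = 1"
| "T_sketch_tree L \<Lambda> \<sigma> (x # xs) = T_log_radius (x # xs) + (let D = pow2 (log_radius (x # xs)) in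
     T_cube_corner D x \<sigma> + T_number 0 (x # xs) +
     T_build L (4 * D) (cube_corner D x \<sigma>) (number 0 (x # xs)) +
     T_prune_root \<Lambda> (build L (4 * D) (cube_corner D x \<sigma>) (number 0 (x # xs)))) + 1"

fun T_quadsketch :: "nat \<Rightarrow> nat \<Rightarrow> real list \<Rightarrow> real list list \<Rightarrow> nat" where
  "T_quadsketch L \<Lambda> \<sigma> X = T_sketch_tree L \<Lambda> \<sigma> X + (let t = sketch_tree L \<Lambda> \<sigma> X in
     T_width L + T_length X + T_width (length X) +
     T_leaf_sets t [] + T_leaf_indices 0 (leaf_sets t []) +
     T_msort (leaf_indices 0 (leaf_sets t [])) +
     T_encode_indices (width (length X)) (msort (leaf_indices 0 (leaf_sets t []))) +
     T_encode_tree (width L) t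
       (encode_indices (width (length X)) (msort (leaf_indices 0 (leaf_sets t []))))) + 1"


section \<open>Decompression\<close>

text \<open>\<open>read_leaves d w p new bs\<close> reads the encoding of a tree and returns the edge sequences from
  the root to the leaves, in depth-first order, together with the remaining bits. Here \<open>p\<close> is the
  reversed edge sequence of the current node, and \<open>new\<close> tells that no child of it has been read.\<close>

fun read_leaves :: "nat \<Rightarrow> nat \<Rightarrow> edge list \<Rightarrow> bool \<Rightarrow> bool list \<Rightarrow> edge list list \<times> bool list" where
  "read_leaves d w p new (False # bs) =
     (let leaf = (if new then [rev p] else []) in
      case p of
        [] \<Rightarrow> (leaf, bs)
      | e # p' \<Rightarrow> (let (ps, bs') = read_leaves d w p' False bs in (leaf @ ps, bs')))"
| "read_leaves d w p new (True # False # bs) =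
     read_leaves d w (Short (take d bs) # p) True (drop d bs)"
| "read_leaves d w p new (True # True # bs) =
     read_leaves d w (Long (horner_sum of_bool 2 (take w bs)) # p) True (drop w bs)"
| "read_leaves d w p new _ = ([], [])"

fun expand :: "nat \<Rightarrow> edge \<Rightarrow> bool list list" where
  "expand d (Short bs) = [bs]"
| "expand d (Long m) = replicate m (replicate d False)"

text \<open>The point \<open>c(u)\<close> of the node reached from the root (at level \<open>R\<close>) along the edges \<open>es\<close>. The
  edge into a cell of side \<open>2\<^sup>l\<close> has weight \<open>2\<^sup>l\<close>.\<close>

definition node_point :: "nat \<Rightarrow> int \<Rightarrow> edge list \<Rightarrow> real list" where
  "node_point d R es = (let ls = concat (map (expand d) es) in
     map (\<lambda>k. \<Sum>t<length ls. if ls ! t ! k then 2 powi (R - 1 - int t) else 0) [0..<d])"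

text \<open>The parameters \<open>n\<close>, \<open>d\<close>, \<open>L\<close> and the root level \<open>R\<close> are known to the decoder. They are
  not part of the sketch: without the scale \<open>2 powi R\<close> no bound on the size of the sketch that
  depends only on \<open>n\<close>, \<open>d\<close> and the aspect ratio could allow the recovery of distances.\<close>

definition decompress :: "nat \<Rightarrow> nat \<Rightarrow> nat \<Rightarrow> int \<Rightarrow> bool list \<Rightarrow> real list list" where
  "decompress n d L R sk = (let (ps, bs) = read_leaves d (width L) [] True sk; w = width n in
     map (\<lambda>i. node_point d R (ps ! horner_sum of_bool 2 (take w (drop (i * w) bs)))) [0..<n])"


section \<open>Randomness\<close>

definition shift_distr :: "nat \<Rightarrow> real \<Rightarrow> (nat \<Rightarrow> real) measure" where
  "shift_distr d D = PiM {..<d} (\<lambda>_. uniform_measure lborel {-D..D})"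

definition shift_list :: "nat \<Rightarrow> (nat \<Rightarrow> real) \<Rightarrow> real list" where
  "shift_list d \<sigma> = map \<sigma> [0..<d]"

end

theory Submission
  imports Defs
begin

text \<open>Let \<open>x\<^sub>i\<close> and \<open>x\<^sub>j\<close> be separated first when a cell of side \<open>s\<close> is halved. Pruning never removes an
  edge among the \<open>\<Lambda>\<close> edges below a branching node, so both decoded points agree above that cell and
  lose at most \<open>s / 2\<^sup>\<Lambda>\<close> per coordinate below it. If \<open>x\<^sub>i\<close> keeps distance \<open>\<eta> * s / 2\<close> from the finer
  grid, then \<open>\<parallel>x\<^sub>i - x\<^sub>j\<parallel>\<close> is at least that large, and the loss is negligible once \<open>2\<^sup>\<Lambda>\<close> exceeds \<open>d / (\<epsilon> * \<eta>)\<close>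
  by a constant factor. The random shift puts \<open>x\<^sub>i\<close> too close to one of the \<open>L\<close> grids in one of the \<open>d\<close>
  coordinates with probability \<open>O(L * d * \<eta>)\<close>. Measurability holds because the sketch depends on the shift
  only through finitely many bits, namely the paths of the points in the unpruned tree.\<close>

subsection \<open>Decoding\<close>

text \<open>The failure probability must not depend on the number of points, although every point is
  compared with point i. Hence padding is demanded of point i alone: a grid plane that separates it
  from another point is far from point i, however close to the plane the other point lies. The union
  bound then runs over L levels and d coordinates only. As d enters \<Lambda> through a logarithm,
  norms may be bounded crudely by sums over coordinates. Pruning relates two trees, while the
  decoder sees a bit string. Each leaf is therefore carried along with its labels before pruning,
  its edges after pruning and its points; pairs of leaves are compared by
  \<open>agrees_until\<close>, and real numbers enter only through \<open>path_value\<close>. The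
  zeros written for a long edge keep all later labels at their grid levels, so pruning clears bits
  and does nothing else. The path from the root to the first branching node is never shortened. The
  size bound holds for every admissible shift, so the length of that path needs a deterministic
  bound, which comes from the choice of the scale (\<open>root_chain_bound\<close>).\<close>

fun leaves :: "'e qtree \<Rightarrow> ('e list \<times> nat list) list"
  and child_leaves :: "('e \<times> 'e qtree) list \<Rightarrow> ('e list \<times> nat list) list" where
  "leaves (Leaf js) = [([], js)]"
| "leaves (Node ts) = child_leaves ts"
| "child_leaves [] = []"
| "child_leaves ((e, t) # ts) = map (apfst (Cons e)) (leaves t) @ child_leaves ts"

text \<open>The decoder recognises a leaf only by the absence of children, so a childless
  \<open>Node\<close> would be read as a leaf. Nonempty point lists bound the number of leaves by
  the number of points, which makes leaf numbers fit into \<open>width n\<close> bits.\<close>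

fun full :: "('e \<Rightarrow> bool) \<Rightarrow> 'e qtree \<Rightarrow> bool"
  and full_children :: "('e \<Rightarrow> bool) \<Rightarrow> ('e \<times> 'e qtree) list \<Rightarrow> bool" where
  "full P (Leaf js) \<longleftrightarrow> js \<noteq> []"
| "full P (Node ts) \<longleftrightarrow> ts \<noteq> [] \<and> full_children P ts"
| "full_children P [] \<longleftrightarrow> True"
| "full_children P ((e, t) # ts) \<longleftrightarrow> P e \<and> full P t \<and> full_children P ts"

fun edge_fits :: "nat \<Rightarrow> nat \<Rightarrow> edge \<Rightarrow> bool" where
  "edge_fits d w (Short bs) \<longleftrightarrow> length bs = d"
| "edge_fits d w (Long m) \<longleftrightarrow> m < 2 ^ w"

lemma length_to_bits [simp]: "length (to_bits w m) = w"
  by (induction w m rule: to_bits.induct) auto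

lemma horner_sum_to_bits: "m < 2 ^ w \<Longrightarrow> horner_sum of_bool 2 (to_bits w m) = m"
proof (induction w m rule: to_bits.induct)
  case (2 w m)
  have "m div 2 < 2 ^ w" using 2(2) by auto
  then show ?case using 2(1) by (simp add: of_bool_def) presburger
qed auto

text \<open>The code of a subtree ends with the \<open>False\<close> that pops its incoming edge
  \<open>e\<close>, so reading resumes at the parent with flag \<open>False\<close>. For a list of
  children the flag \<open>new\<close> survives only if the list is empty, whence the case
  distinction.\<close>

lemma read_leaves_encode:
  "full (edge_fits d w) t \<Longrightarrow>
   read_leaves d w (e # p) True (encode_tree w t acc) =
     (let (ps, r) = read_leaves d w p False acc
      in (map (\<lambda>(q, _). rev (e # p) @ q) (leaves t) @ ps, r))"
  "full_children (edge_fits d w) ts \<Longrightarrow>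
   read_leaves d w p new (encode_children w ts acc) =
     (if ts = [] then read_leaves d w p new acc
      else let (ps, r) = read_leaves d w p False acc
      in (map (\<lambda>(q, _). rev p @ q) (child_leaves ts) @ ps, r))"
proof (induction t and ts arbitrary: e p acc and p new acc rule: leaves_child_leaves.induct)
  case (4 e t ts p new acc)
  have e: "read_leaves d w p new (True # encode_edge w e bs) = read_leaves d w (e # p) True bs" for bs
    using 4(3) by (cases e) (auto simp: horner_sum_to_bits)
  have t: "full (edge_fits d w) t" "full_children (edge_fits d w) ts" using 4(3) by auto
  \<comment> \<open>Once a child has been read the flag is \<open>False\<close>, so an empty
    remainder \<open>ts\<close> fits the formula for a nonempty one.\<close>
  have "(if ts = [] then read_leaves d w p False acc
      else let (ps, r) = read_leaves d w p False acc
      in (map (\<lambda>(q, _). rev p @ q) (child_leaves ts) @ ps, r)) =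
      (let (ps, r) = read_leaves d w p False acc
      in (map (\<lambda>(q, _). rev p @ q) (child_leaves ts) @ ps, r))"
    by (cases "read_leaves d w p False acc") auto
  then show ?case
    by (cases "read_leaves d w p False acc")
       (auto simp: e 4(1)[OF t(1)] 4(2)[OF t(2)] apfst_def map_prod_def case_prod_unfold)
qed (auto simp: Let_def case_prod_unfold)

text \<open>The root has no edge to pop: its closing \<open>False\<close> meets the empty stack and
  leaves \<open>acc\<close> unread, which in the sketch is the table of leaf numbers.\<close>

lemma read_leaves_root:
  assumes "full (edge_fits d w) t"
  shows "read_leaves d w [] True (encode_tree w t acc) = (map fst (leaves t), acc)"
proof (cases t)
  case (Node ts)
  then show ?thesis using assms read_leaves_encode(2)[of d w ts "[]" True "False # acc"]
    by (auto simp: case_prod_unfold)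
qed auto

lemma leaf_sets_eq:
  "leaf_sets t acc = map snd (leaves t) @ acc"
  "leaf_sets_children ts acc = map snd (child_leaves ts) @ acc"
  by (induction t and ts arbitrary: acc and acc rule: leaves_child_leaves.induct) auto

lemma with_leaf_eq: "with_leaf v js acc = map (\<lambda>i. (i, v)) js @ acc"
  by (induction v js acc rule: with_leaf.induct) auto

lemma map_fst_leaf_indices: "map fst (leaf_indices v jss) = concat jss"
  by (induction v jss rule: leaf_indices.induct) (auto simp: with_leaf_eq o_def)

lemma in_leaf_indicesD:
  "(i, u) \<in> set (leaf_indices v jss) \<Longrightarrow> \<exists>a<length jss. u = v + a \<and> i \<in> set (jss ! a)"
proof (induction v jss rule: leaf_indices.induct)
  case (2 v js jss)
  then consider "u = v" "i \<in> set js" | "(i, u) \<in> set (leaf_indices (v + 1) jss)"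
    by (auto simp: with_leaf_eq)
  then show ?case
  proof cases
    case 2
    then obtain a where "a < length jss" "u = v + 1 + a" "i \<in> set (jss ! a)"
      using "2.IH" by auto
    then show ?thesis by (intro exI[of _ "Suc a"]) auto
  qed (auto intro: exI[of _ 0])
qed auto

lemma mset_merge: "mset (merge ps qs) = mset ps + mset qs"
  by (induction ps qs rule: merge.induct) auto

lemma sorted_merge:
  "sorted (map fst ps) \<Longrightarrow> sorted (map fst qs) \<Longrightarrow> sorted (map fst (merge ps qs))"
proof (induction ps qs rule: merge.induct)
  case (3 i v ps j w qs)
  have s: "set (merge xs ys) = set xs \<union> set ys" for xs ys
    by (metis mset_merge set_mset_mset set_mset_union)
  show ?case using 3 by (auto simp: s)
qed auto

lemma mset_msort: "mset (msort ps) = mset ps"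
proof (induction ps rule: msort.induct)
  case (1 ps)
  show ?case
    using 1[OF refl]
    by (subst msort.simps) (auto simp: Let_def mset_merge mset_append[symmetric] simp del: mset_append)
qed

lemma sorted_msort: "sorted (map fst (msort ps))"
proof (induction ps rule: msort.induct)
  case (1 ps)
  show ?case
  proof (cases "length ps \<le> 1")
    case True
    then show ?thesis by (subst msort.simps) (cases ps, auto)
  next
    case False
    then show ?thesis using 1[OF refl False] by (subst msort.simps) (simp add: sorted_merge Let_def)
  qed
qed

lemma take_drop_encode_indices:
  "i < length ps \<Longrightarrow> take w (drop (i * w) (encode_indices w ps)) = to_bits w (snd (ps ! i))"
proof (induction w ps arbitrary: i rule: encode_indices.induct)
  case (2 w j v ps)
  show ?case using 2 by (cases i) (auto simp: drop_append)
qed auto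

lemma less_two_power_width: "m < 2 ^ width m"
proof (induction m rule: width.induct)
  case (1 m)
  then show ?case by (subst width.simps) auto
qed

lemma two_power_width_le: "m > 0 \<Longrightarrow> 2 ^ width m \<le> 2 * m"
proof (induction m rule: width.induct)
  case (1 m)
  show ?case
  proof (cases "m = 1")
    case True
    then show ?thesis by (simp add: width.simps)
  next
    case False
    then have "2 ^ width (m div 2) \<le> 2 * (m div 2)" using 1 by auto
    then show ?thesis using 1(2) by (subst width.simps) auto
  qed
qed

lemma length_le_length_concat: "\<forall>js\<in>set jss. js \<noteq> [] \<Longrightarrow> length jss \<le> length (concat jss)"
proof (induction jss)
  case (Cons js jss)
  then show ?case by (cases js) auto
qed auto

lemma full_leaves_nonempty:
  "full P t \<Longrightarrow> \<forall>js\<in>snd ` set (leaves t). js \<noteq> []"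
  "full_children P ts \<Longrightarrow> \<forall>js\<in>snd ` set (child_leaves ts). js \<noteq> []"
  by (induction t and ts rule: leaves_child_leaves.induct) auto

text \<open>The leaf sets partition the point numbers, so after sorting the pair at position
  \<open>i\<close> has key \<open>i\<close>, and block \<open>i\<close> of the table is the number
  of a leaf containing \<open>i\<close>. The decoder lists the leaves in the same depth-first order
  as \<open>leaf_sets\<close>.\<close>

lemma decompress_quadsketch_nth:
  fixes L \<Lambda> \<sigma> X
  defines "t \<equiv> sketch_tree L \<Lambda> \<sigma> X"
  defines "ls \<equiv> leaves t"
  assumes full: "full (edge_fits d (width L)) t"
    and dist: "distinct (concat (map snd ls))"
    and cover: "set (concat (map snd ls)) = {..<length X}"
    and i: "i < length X"
  shows "\<exists>(es, js) \<in> set ls. i \<in> set js \<and>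
    decompress (length X) d L R (quadsketch L \<Lambda> \<sigma> X) ! i = node_point d R es"
proof -
  define n where "n = length X"
  define ps where "ps = leaf_indices 0 (map snd ls)"
  have sk: "quadsketch L \<Lambda> \<sigma> X = encode_tree (width L) t (encode_indices (width n) (msort ps))"
    by (simp add: ps_def ls_def t_def[symmetric] n_def leaf_sets_eq)
  have fst: "map fst (msort ps) = [0..<n]"
  proof (rule sorted_distinct_set_unique)
    have "mset (map fst (msort ps)) = mset (concat (map snd ls))"
      using mset_msort[of ps] map_fst_leaf_indices[of 0 "map snd ls"] by (metis mset_map ps_def)
    then show "distinct (map fst (msort ps))" "set (map fst (msort ps)) = set [0..<n]"
      using dist cover by (metis mset_eq_imp_distinct_iff, metis n_def atLeast_upt mset_eq_setD)
  qed (auto simp: sorted_msort)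
  have len: "length (msort ps) = n" using arg_cong[OF fst, of length] by simp
  define v where "v = snd (msort ps ! i)"
  have i': "i < n" using i n_def by simp
  have "msort ps ! i = (i, v)"
    using nth_map[of i "msort ps" fst] fst len i' by (auto simp: v_def prod_eq_iff)
  then have "(i, v) \<in> set (msort ps)" using len i' by (metis nth_mem)
  then have "(i, v) \<in> set ps" using mset_msort mset_eq_setD by blast
  then have v: "v < length ls" "i \<in> set (snd (ls ! v))"
    using in_leaf_indicesD[of i v 0 "map snd ls"] by (auto simp: ps_def)
  \<comment> \<open>No leaf is empty, so there are at most \<open>n\<close> leaves and the number
    \<open>v\<close> survives the encoding in \<open>width n\<close> bits.\<close>
  have "length ls \<le> length (concat (map snd ls))"
    using length_le_length_concat[of "map snd ls"] full_leaves_nonempty(1)[OF full] by (auto simp: ls_def)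
  also have "\<dots> = n" using distinct_card[OF dist] cover n_def by simp
  finally have "v < 2 ^ width n" using v less_two_power_width[of n] by linarith
  then have "horner_sum of_bool 2 (take (width n) (drop (i * width n) (encode_indices (width n) (msort ps)))) = v"
    using take_drop_encode_indices[of i "msort ps"] len i' v_def horner_sum_to_bits by simp
  then have "decompress n d L R (quadsketch L \<Lambda> \<sigma> X) ! i = node_point d R (fst (ls ! v))"
    using i' v by (simp add: decompress_def sk read_leaves_root[OF full] ls_def Let_def del: quadsketch.simps)
  then show ?thesis using v nth_mem[OF v(1)] unfolding n_def
    by (intro bexI[of _ "ls ! v"]) auto
qed

subsection \<open>Pruned trees\<close>

text \<open>Uniform depth bounds the numbers on long edges. Distinct labels among siblings make
  leaves below different children differ in that label, which is where the comparison in
  \<open>agrees_until_pruned_leaves\<close> starts.\<close>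

fun grid_tree :: "nat \<Rightarrow> nat \<Rightarrow> bool list qtree \<Rightarrow> bool" where
  "grid_tree d 0 (Leaf js) \<longleftrightarrow> js \<noteq> []"
| "grid_tree d (Suc l) (Node ts) \<longleftrightarrow> ts \<noteq> [] \<and> distinct (map fst ts) \<and>
     (\<forall>(bs, t)\<in>set ts. length bs = d \<and> grid_tree d l t)"
| "grid_tree d _ _ \<longleftrightarrow> False"

text \<open>Each leaf with its labels before pruning, its edges after pruning, and its points.\<close>

fun pruned_leaves :: "nat \<Rightarrow> bool list qtree \<Rightarrow> (bool list list \<times> edge list \<times> nat list) list"
  and pruned_child_leaves :: "nat \<Rightarrow> (bool list \<times> bool list qtree) list \<Rightarrow>
    (bool list list \<times> edge list \<times> nat list) list" where
  "pruned_leaves \<Lambda> (Leaf js) = [([], [], js)]"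
| "pruned_leaves \<Lambda> (Node ts) = pruned_child_leaves \<Lambda> ts"
| "pruned_child_leaves \<Lambda> [] = []"
| "pruned_child_leaves \<Lambda> ((bs, t) # ts) =
     map (\<lambda>(P, E, js). ((bs # chain_labels t) @ P, path_edges \<Lambda> (bs # chain_labels t) @ E, js))
       (pruned_leaves \<Lambda> (chain_end t)) @ pruned_child_leaves \<Lambda> ts"

lemma leaves_chain: "leaves t = map (apfst ((@) (chain_labels t))) (leaves (chain_end t))"
  by (induction t rule: chain_labels.induct) (auto simp: apfst_def map_prod_def case_prod_unfold)

lemma leaves_hang: "leaves (hang es t) = map (apfst ((@) es)) (leaves t)"
  by (induction es) (auto simp: apfst_def map_prod_def case_prod_unfold)

lemma full_hang: "full P (hang es t) \<longleftrightarrow> (\<forall>e\<in>set es. P e) \<and> full P t"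
  by (induction es) auto

lemma chain_labels_chain_end: "chain_labels (chain_end t) = []"
  by (induction t rule: chain_labels.induct) auto

lemma short_edges_eq: "short_edges ls = map Short ls"
  by (induction ls) auto

lemma path_edges_eq: "path_edges \<Lambda> ls =
  (if length ls > \<Lambda> + 1 then map Short (take \<Lambda> ls) @ [Long (length ls - \<Lambda>)] else map Short ls)"
  by (simp add: short_edges_eq Let_def)

declare path_edges.simps [simp del]

lemma path_edges_nonempty: "ls \<noteq> [] \<Longrightarrow> path_edges \<Lambda> ls \<noteq> []"
  by (simp add: path_edges_eq)

text \<open>Together with \<open>leaves_eq_pruned_leaves\<close> this shows that pruning keeps the
  order of the leaves and their point lists, and that \<open>pruned_leaves\<close> pairs the two
  paths of the same leaf.\<close>

lemma leaves_prune:
  "leaves (prune \<Lambda> t) = map snd (pruned_leaves \<Lambda> t)"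
  "child_leaves (prune_children \<Lambda> ts) = map snd (pruned_child_leaves \<Lambda> ts)"
proof (induction \<Lambda> t and \<Lambda> ts rule: pruned_leaves_pruned_child_leaves.induct)
  case (4 \<Lambda> bs t ts)
  define es where "es = path_edges \<Lambda> (bs # chain_labels t)"
  \<comment> \<open>\<open>add_branch\<close> drops the subtree of an empty edge list, so
    nonemptiness is established before its equations are applied.\<close>
  have "es \<noteq> []" by (simp add: es_def path_edges_nonempty)
  then obtain e es' where es: "es = e # es'" by (cases es) auto
  show ?case using 4
    by (simp add: es_def[symmetric] es leaves_hang del: chain_labels.simps chain_end.simps)
       (auto simp: apfst_def map_prod_def case_prod_unfold)
qed auto

lemma leaves_eq_pruned_leaves:
  "leaves t = map (\<lambda>(P, E, js). (P, js)) (pruned_leaves \<Lambda> t)"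
  "child_leaves ts = map (\<lambda>(P, E, js). (P, js)) (pruned_child_leaves \<Lambda> ts)"
proof (induction \<Lambda> t and \<Lambda> ts rule: pruned_leaves_pruned_child_leaves.induct)
  case (4 \<Lambda> bs t ts)
  then show ?case
    by (simp add: leaves_chain[of t] del: chain_labels.simps chain_end.simps)
       (auto simp: apfst_def map_prod_def case_prod_unfold)
qed auto

lemma grid_tree_chain:
  "grid_tree d l t \<Longrightarrow> length (chain_labels t) \<le> l \<and>
    grid_tree d (l - length (chain_labels t)) (chain_end t) \<and> (\<forall>bs\<in>set (chain_labels t). length bs = d)"
proof (induction t arbitrary: l rule: chain_labels.induct)
  case (1 e t)
  then show ?case by (cases l) auto
qed auto

text \<open>The number on a long edge is at most the length of the path it belongs to, hence at most
  the depth below the parent. In the second part \<open>l\<close> is the depth of the children,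
  which explains the \<open>Suc\<close>.\<close>

lemma full_prune:
  "grid_tree d l t \<Longrightarrow> l < 2 ^ w \<Longrightarrow> full (edge_fits d w) (prune \<Lambda> t)"
  "(\<forall>(bs, t)\<in>set ts. length bs = d \<and> grid_tree d l t) \<Longrightarrow> Suc l < 2 ^ w \<Longrightarrow>
   full_children (edge_fits d w) (prune_children \<Lambda> ts) \<and> (ts \<noteq> [] \<longrightarrow> prune_children \<Lambda> ts \<noteq> [])"
proof (induction \<Lambda> t and \<Lambda> ts arbitrary: l and l rule: pruned_leaves_pruned_child_leaves.induct)
  case (2 \<Lambda> ts)
  then show ?case by (cases l) auto
next
  case (1 \<Lambda> js)
  then show ?case by (cases l) auto
next
  case (4 \<Lambda> bs t ts)
  define es where "es = path_edges \<Lambda> (bs # chain_labels t)"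
  have "es \<noteq> []" by (simp add: es_def path_edges_nonempty)
  then obtain e es' where es: "es = e # es'" by (cases es) auto
  have t: "grid_tree d l t" "length bs = d" using 4(3) by auto
  have "\<forall>e\<in>set es. edge_fits d w e"
    unfolding es_def path_edges_eq using grid_tree_chain[OF t(1)] t(2) 4(4)
    by (auto dest!: in_set_takeD)
  moreover have "full (edge_fits d w) (prune \<Lambda> (chain_end t))"
    by (rule 4(1)[of "l - length (chain_labels t)"]) (use grid_tree_chain[OF t(1)] 4(4) in auto)
  moreover have "full_children (edge_fits d w) (prune_children \<Lambda> ts)"
    using 4(2)[of l] 4(3,4) by auto
  ultimately show ?case
    by (simp add: es_def[symmetric] es full_hang del: chain_labels.simps chain_end.simps)
qed auto

definition expand_path :: "nat \<Rightarrow> edge list \<Rightarrow> bool list list" where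
  "expand_path d es = concat (map (expand d) es)"

lemma expand_path_append: "expand_path d (es @ fs) = expand_path d es @ expand_path d fs"
  by (simp add: expand_path_def)

lemma expand_path_Short: "expand_path d (map Short ls) = ls"
  by (induction ls) (auto simp: expand_path_def)

lemma expand_path_path_edges:
  "expand_path d (path_edges \<Lambda> ls) =
   (if length ls > \<Lambda> + 1 then take \<Lambda> ls @ replicate (length ls - \<Lambda>) (replicate d False) else ls)"
proof -
  have "expand_path d [Long m] = replicate m (replicate d False)" for m
    by (simp add: expand_path_def)
  then show ?thesis by (simp add: path_edges_eq expand_path_append expand_path_Short)
qed

text \<open>\<open>Q\<close> is what the decoder reconstructs from a path with labels
  \<open>P\<close>. The lengths agree because the number \<open>k - \<Lambda>\<close> on a long edge
  counts exactly the labels it replaces; labels are only ever cleared, and not among the first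
  \<open>\<Lambda>\<close>.\<close>

definition zeroed :: "nat \<Rightarrow> nat \<Rightarrow> bool list list \<Rightarrow> bool list list \<Rightarrow> bool" where
  "zeroed d \<Lambda> P Q \<longleftrightarrow> length Q = length P \<and>
     (\<forall>t<length P. Q ! t = P ! t \<or> \<Lambda> \<le> t \<and> Q ! t = replicate d False)"

lemma zeroed_append:
  "zeroed d \<Lambda> ls ms \<Longrightarrow> zeroed d \<Lambda> P Q \<Longrightarrow> zeroed d \<Lambda> (ls @ P) (ms @ Q)"
  unfolding zeroed_def nth_append length_append
  by (metis (mono_tags, lifting) add_diff_inverse_nat nat_add_left_cancel_less trans_le_add2)

lemma zeroed_path_edges: "zeroed d \<Lambda> ls (expand_path d (path_edges \<Lambda> ls))"
  by (auto simp: zeroed_def expand_path_path_edges nth_append)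

lemma zeroed_pruned_leaves:
  "(P, E, js) \<in> set (pruned_leaves \<Lambda> t) \<Longrightarrow> zeroed d \<Lambda> P (expand_path d E)"
  "(P, E, js) \<in> set (pruned_child_leaves \<Lambda> ts) \<Longrightarrow> zeroed d \<Lambda> P (expand_path d E)"
proof (induction \<Lambda> t and \<Lambda> ts arbitrary: P E js and P E js rule: pruned_leaves_pruned_child_leaves.induct)
  case (4 \<Lambda> bs t ts)
  show ?case
  proof (cases "(P, E, js) \<in> set (pruned_child_leaves \<Lambda> ts)")
    case False
    then obtain P' E' where *: "(P', E', js) \<in> set (pruned_leaves \<Lambda> (chain_end t))"
      "P = (bs # chain_labels t) @ P'" "E = path_edges \<Lambda> (bs # chain_labels t) @ E'"
      using 4(3) by auto
    show ?thesis unfolding *(2,3) expand_path_append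
      by (intro zeroed_append zeroed_path_edges 4(1)[OF *(1)])
  qed (use 4 in auto)
qed (auto simp: zeroed_def expand_path_def)

text \<open>\<open>P\<close> and \<open>P'\<close> are the label sequences of two leaves, \<open>Q\<close> and \<open>Q'\<close> what remains of them after
  pruning; \<open>m\<close> is a common depth, or the depth at which the leaves separate.\<close>

definition agrees_until :: "nat \<Rightarrow> bool list list \<Rightarrow> bool list list \<Rightarrow> bool list list \<Rightarrow> bool list list \<Rightarrow> bool" where
  "agrees_until \<Lambda> P Q P' Q' \<longleftrightarrow> (\<forall>m. take m P = take m P' \<longrightarrow>
     take m Q = take m Q' \<and>
     (m < length P \<and> m < length P' \<and> P ! m \<noteq> P' ! m \<longrightarrow>
        (\<forall>t. m \<le> t \<and> t < m + \<Lambda> \<and> t < length P \<longrightarrow> Q ! t = P ! t) \<and>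
        (\<forall>t. m \<le> t \<and> t < m + \<Lambda> \<and> t < length P' \<longrightarrow> Q' ! t = P' ! t)))"

text \<open>A separation inside the common prefix \<open>ls\<close> is impossible; beyond it the
  depth \<open>m\<close> is shifted by \<open>length ls\<close>.\<close>

lemma agrees_until_append:
  assumes "agrees_until \<Lambda> P Q P' Q'" "length ls = length ms"
  shows "agrees_until \<Lambda> (ls @ P) (ms @ Q) (ls @ P') (ms @ Q')"
  unfolding agrees_until_def
proof (intro allI impI)
  fix m assume eq: "take m (ls @ P) = take m (ls @ P')"
  show "take m (ms @ Q) = take m (ms @ Q') \<and>
     (m < length (ls @ P) \<and> m < length (ls @ P') \<and> (ls @ P) ! m \<noteq> (ls @ P') ! m \<longrightarrow>
        (\<forall>t. m \<le> t \<and> t < m + \<Lambda> \<and> t < length (ls @ P) \<longrightarrow> (ms @ Q) ! t = (ls @ P) ! t) \<and>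
        (\<forall>t. m \<le> t \<and> t < m + \<Lambda> \<and> t < length (ls @ P') \<longrightarrow> (ms @ Q') ! t = (ls @ P') ! t))"
  proof (cases "m < length ls")
    case True
    then show ?thesis using assms(2) by (auto simp: nth_append)
  next
    case False
    define m' where "m' = m - length ls"
    have m: "m = length ls + m'" using False by (simp add: m'_def)
    have "take m' P = take m' P'" using eq m by simp
    then have *: "take m' Q = take m' Q' \<and>
      (m' < length P \<and> m' < length P' \<and> P ! m' \<noteq> P' ! m' \<longrightarrow>
        (\<forall>t. m' \<le> t \<and> t < m' + \<Lambda> \<and> t < length P \<longrightarrow> Q ! t = P ! t) \<and>
        (\<forall>t. m' \<le> t \<and> t < m' + \<Lambda> \<and> t < length P' \<longrightarrow> Q' ! t = P' ! t))"
      using assms(1) unfolding agrees_until_def by blast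
    moreover have "(ms @ Q) ! t = (ls @ P) ! t"
      if "\<forall>t. m' \<le> t \<and> t < m' + \<Lambda> \<and> t < length P \<longrightarrow> Q ! t = P ! t"
        "m \<le> t" "t < m + \<Lambda>" "t < length (ls @ P)" for t P Q
    proof -
      have "m' \<le> t - length ls \<and> t - length ls < m' + \<Lambda> \<and> t - length ls < length P"
        using that(2-4) m by auto
      then show ?thesis using that(1,2) m assms(2) by (simp add: nth_append)
    qed
    ultimately show ?thesis using assms(2) m by (simp add: nth_append)
  qed
qed

lemma agrees_until_sym: "agrees_until \<Lambda> P Q P' Q' \<Longrightarrow> agrees_until \<Lambda> P' Q' P Q"
  unfolding agrees_until_def by metis

text \<open>A positive common depth would force equal first labels, so only \<open>m = 0\<close> is
  possible, and there \<open>zeroed\<close> protects the first \<open>\<Lambda>\<close> labels of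
  both paths.\<close>

lemma agrees_until_Cons:
  assumes "zeroed d \<Lambda> P Q" "zeroed d \<Lambda> P' Q'" "P \<noteq> []" "P' \<noteq> []" "hd P \<noteq> hd P'"
  shows "agrees_until \<Lambda> P Q P' Q'"
  unfolding agrees_until_def
proof (intro allI impI)
  fix m assume eq: "take m P = take m P'"
  have "m = 0"
  proof (rule ccontr)
    assume "m \<noteq> 0"
    then show False using eq assms(3-5) by (cases m; cases P; cases P') auto
  qed
  then show "take m Q = take m Q' \<and>
     (m < length P \<and> m < length P' \<and> P ! m \<noteq> P' ! m \<longrightarrow>
        (\<forall>t. m \<le> t \<and> t < m + \<Lambda> \<and> t < length P \<longrightarrow> Q ! t = P ! t) \<and>
        (\<forall>t. m \<le> t \<and> t < m + \<Lambda> \<and> t < length P' \<longrightarrow> Q' ! t = P' ! t))"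
    using assms(1,2) by (auto simp: zeroed_def)
qed

lemma pruned_child_leaves_hd:
  "(P, E, js) \<in> set (pruned_child_leaves \<Lambda> ts) \<Longrightarrow> P \<noteq> [] \<and> hd P \<in> fst ` set ts"
  by (induction ts) auto

text \<open>Two leaves below the same child share the pruned path to \<open>chain_end\<close>, and
  the claim is shifted along it. Two leaves below different children separate right here, where a
  new path with \<open>\<Lambda>\<close> protected labels starts for each of them.\<close>

lemma agrees_until_pruned_leaves:
  "grid_tree d l t \<Longrightarrow> (P, E, js) \<in> set (pruned_leaves \<Lambda> t) \<Longrightarrow> (P', E', js') \<in> set (pruned_leaves \<Lambda> t) \<Longrightarrow>
   agrees_until \<Lambda> P (expand_path d E) P' (expand_path d E')"
  "\<forall>(bs, t)\<in>set ts. length bs = d \<and> grid_tree d l t \<Longrightarrow> distinct (map fst ts) \<Longrightarrow>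
   (P, E, js) \<in> set (pruned_child_leaves \<Lambda> ts) \<Longrightarrow> (P', E', js') \<in> set (pruned_child_leaves \<Lambda> ts) \<Longrightarrow>
   agrees_until \<Lambda> P (expand_path d E) P' (expand_path d E')"
proof (induction \<Lambda> t and \<Lambda> ts arbitrary: l P E js P' E' js' and l P E js P' E' js'
    rule: pruned_leaves_pruned_child_leaves.induct)
  case (1 \<Lambda> js)
  then show ?case by (auto simp: agrees_until_def)
next
  case (2 \<Lambda> ts)
  then show ?case by (cases l) auto
next
  case (4 \<Lambda> bs t ts)
  define ls where "ls = bs # chain_labels t"
  have split: "(P, E, js) \<in> set (pruned_child_leaves \<Lambda> ts) \<or>
     (\<exists>Q F. (Q, F, js) \<in> set (pruned_leaves \<Lambda> (chain_end t)) \<and> P = ls @ Q \<and> E = path_edges \<Lambda> ls @ F)"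
    if "(P, E, js) \<in> set (pruned_child_leaves \<Lambda> ((bs, t) # ts))" for P E js
    using that by (auto simp: ls_def)
  have t: "grid_tree d (l - length (chain_labels t)) (chain_end t)"
    using grid_tree_chain[of d l t] 4(3) by auto
  have cross: "agrees_until \<Lambda> P (expand_path d E) P' (expand_path d E')"
    if "(P, E, js) \<in> set (pruned_child_leaves \<Lambda> ts)" "P' = ls @ Q"
      "(P', E', js') \<in> set (pruned_child_leaves \<Lambda> ((bs, t) # ts))"
    for P E js P' E' js' Q
  proof (rule agrees_until_Cons)
    show "zeroed d \<Lambda> P (expand_path d E)" "zeroed d \<Lambda> P' (expand_path d E')"
      using zeroed_pruned_leaves(2) that(1,3) by blast+
    show "P \<noteq> []" "P' \<noteq> []" "hd P \<noteq> hd P'"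
      using pruned_child_leaves_hd[OF that(1)] that(2) 4(4) by (auto simp: ls_def)
  qed
  consider (rest) "(P, E, js) \<in> set (pruned_child_leaves \<Lambda> ts)" "(P', E', js') \<in> set (pruned_child_leaves \<Lambda> ts)"
    | (l) Q where "(P, E, js) \<in> set (pruned_child_leaves \<Lambda> ts)" "P' = ls @ Q"
    | (r) Q where "(P', E', js') \<in> set (pruned_child_leaves \<Lambda> ts)" "P = ls @ Q"
    | (first) Q F Q' F' where "(Q, F, js) \<in> set (pruned_leaves \<Lambda> (chain_end t))" "P = ls @ Q"
       "E = path_edges \<Lambda> ls @ F" "(Q', F', js') \<in> set (pruned_leaves \<Lambda> (chain_end t))" "P' = ls @ Q'"
       "E' = path_edges \<Lambda> ls @ F'"
    using split[OF 4(5)] split[OF 4(6)] by blast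
  then show ?case
  proof cases
    case rest
    then show ?thesis using 4(2)[of l] 4(3,4) by auto
  next
    case l
    then show ?thesis using cross 4(6) by blast
  next
    case r
    then show ?thesis using cross 4(5) agrees_until_sym by blast
  next
    case first
    show ?thesis
      unfolding first(2,3,5,6) expand_path_append
      by (intro agrees_until_append 4(1)[OF t first(1,4)])
         (simp add: expand_path_path_edges)
  qed
qed auto

definition root_leaves :: "nat \<Rightarrow> bool list qtree \<Rightarrow> (bool list list \<times> edge list \<times> nat list) list" where
  "root_leaves \<Lambda> t = map (\<lambda>(P, E, js). (chain_labels t @ P, map Short (chain_labels t) @ E, js))
     (pruned_leaves \<Lambda> (chain_end t))"

lemma leaves_prune_root: "leaves (prune_root \<Lambda> t) = map snd (root_leaves \<Lambda> t)"
  by (simp add: leaves_hang leaves_prune root_leaves_def short_edges_eq)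
     (auto simp: apfst_def map_prod_def case_prod_unfold)

lemma leaves_eq_root_leaves: "leaves t = map (\<lambda>(P, E, js). (P, js)) (root_leaves \<Lambda> t)"
  by (subst leaves_chain) (simp add: leaves_eq_pruned_leaves(1)[of "chain_end t" \<Lambda>] root_leaves_def case_prod_unfold)

lemma zeroed_root_leaves:
  "(P, E, js) \<in> set (root_leaves \<Lambda> t) \<Longrightarrow> zeroed d 0 P (expand_path d E)"
proof -
  assume "(P, E, js) \<in> set (root_leaves \<Lambda> t)"
  then obtain P0 E0 where *: "(P0, E0, js) \<in> set (pruned_leaves \<Lambda> (chain_end t))"
    "P = chain_labels t @ P0" "E = map Short (chain_labels t) @ E0"
    by (auto simp: root_leaves_def)
  have "zeroed d 0 P0 (expand_path d E0)"
    using zeroed_pruned_leaves(1)[OF *(1), of d] by (auto simp: zeroed_def)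
  then show ?thesis unfolding *(2,3) expand_path_append expand_path_Short
    by (intro zeroed_append) (simp_all add: zeroed_def)
qed

lemma agrees_until_root_leaves:
  assumes "grid_tree d l t" "(P, E, js) \<in> set (root_leaves \<Lambda> t)" "(P', E', js') \<in> set (root_leaves \<Lambda> t)"
  shows "agrees_until \<Lambda> P (expand_path d E) P' (expand_path d E')"
proof -
  obtain P0 E0 P1 E1 where
    "(P0, E0, js) \<in> set (pruned_leaves \<Lambda> (chain_end t))" "(P1, E1, js') \<in> set (pruned_leaves \<Lambda> (chain_end t))"
    and eqs: "P = chain_labels t @ P0" "E = map Short (chain_labels t) @ E0"
      "P' = chain_labels t @ P1" "E' = map Short (chain_labels t) @ E1"
    using assms(2,3) by (auto simp: root_leaves_def)
  then have "agrees_until \<Lambda> P0 (expand_path d E0) P1 (expand_path d E1)"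
    using agrees_until_pruned_leaves(1) grid_tree_chain[OF assms(1)] by blast
  then show ?thesis unfolding eqs expand_path_append expand_path_Short
    by (rule agrees_until_append) simp
qed

lemma full_prune_root:
  assumes "grid_tree d l t" "l < 2 ^ w"
  shows "full (edge_fits d w) (prune_root \<Lambda> t)"
  using grid_tree_chain[OF assms(1)] assms(2)
  by (auto simp: full_hang short_edges_eq intro!: full_prune(1)[where l = "l - length (chain_labels t)"])

subsection \<open>The leaves of the quadtree\<close>

fun cell_bits :: "real \<Rightarrow> real list \<Rightarrow> real list \<Rightarrow> bool list" where
  "cell_bits h (c # cs) (y # ys) = (\<not> y < c + h) # cell_bits h cs ys"
| "cell_bits h _ _ = []"

text \<open>The labels met by a single point, computed without reference to the other points. They
  determine the leaves (\<open>leaves_build\<close>) and even the whole tree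
  (\<open>build_cong\<close>).\<close>

fun cell_path :: "nat \<Rightarrow> real \<Rightarrow> real list \<Rightarrow> real list \<Rightarrow> bool list list" where
  "cell_path 0 s cs x = []"
| "cell_path (Suc l) s cs x = cell_bits (s / 2) cs x #
     cell_path l (s / 2) (child_corner (s / 2) cs (cell_bits (s / 2) cs x)) x"

lemma length_cell_bits: "length y = length cs \<Longrightarrow> length (cell_bits h cs y) = length cs"
  by (induction h cs y rule: cell_bits.induct) auto

lemma length_child_corner: "length bs = length cs \<Longrightarrow> length (child_corner h cs bs) = length cs"
  by (induction h cs bs rule: child_corner.induct) auto

lemma length_cell_path [simp]: "length (cell_path l s cs x) = l"
  by (induction l arbitrary: s cs) auto

lemma prefix_bit_eq: "prefix_bit b gs = map (apfst (Cons b)) gs"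
  by (induction b gs rule: prefix_bit.induct) auto

lemma firsts_eq: "firsts ps = map fst ps"
  by (induction ps rule: firsts.induct) auto

lemma attach_coords_eq: "attach_coords ps = map (\<lambda>(i, x). ((i, x), x)) ps"
  by (induction ps rule: attach_coords.induct) auto

lemma number_eq: "number i xs = List.enumerate i xs"
  by (induction i xs rule: number.induct) auto

lemma build_children_eq:
  "build_children l h cs gs = map (\<lambda>(bs, ps). (bs, build l h (child_corner h cs bs) ps)) gs"
  by (induction gs) auto

lemma child_leaves_eq: "child_leaves ts = concat (map (\<lambda>(e, t). map (apfst (Cons e)) (leaves t)) ts)"
  by (induction ts) auto

lemma set_lower_half: "\<forall>r\<in>set rs. snd r \<noteq> [] \<Longrightarrow>
    set (lower_half m rs) = {(p, ys) | p y ys. (p, y # ys) \<in> set rs \<and> y < m}"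
  by (induction m rs rule: lower_half.induct) auto

lemma set_upper_half: "\<forall>r\<in>set rs. snd r \<noteq> [] \<Longrightarrow>
    set (upper_half m rs) = {(p, ys) | p y ys. (p, y # ys) \<in> set rs \<and> \<not> y < m}"
  by (induction m rs rule: upper_half.induct) auto

lemma filter_lower_half: "\<forall>r\<in>set rs. snd r \<noteq> [] \<Longrightarrow>
    map fst (filter (\<lambda>r. cell_bits h cs (snd r) = bs) (lower_half (c + h) rs)) =
    map fst (filter (\<lambda>r. cell_bits h (c # cs) (snd r) = False # bs) rs)"
  by (induction "c + h" rs rule: lower_half.induct) auto

lemma filter_upper_half: "\<forall>r\<in>set rs. snd r \<noteq> [] \<Longrightarrow>
    map fst (filter (\<lambda>r. cell_bits h cs (snd r) = bs) (upper_half (c + h) rs)) =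
    map fst (filter (\<lambda>r. cell_bits h (c # cs) (snd r) = True # bs) rs)"
  by (induction "c + h" rs rule: upper_half.induct) auto

text \<open>Splitting one coordinate at a time amounts to a stable grouping by the whole bit vector.
  The description of a group as a filter of the input is what lets \<open>leaves_build\<close>
  identify a leaf by its path.\<close>

lemma split_cell_properties:
  "\<forall>r\<in>set rs. length (snd r) = length cs \<Longrightarrow>
    (\<forall>(bs, qs)\<in>set (split_cell h cs rs). qs = map fst (filter (\<lambda>r. cell_bits h cs (snd r) = bs) rs)) \<and>
    distinct (map fst (split_cell h cs rs)) \<and>
    fst ` set (split_cell h cs rs) = (\<lambda>r. cell_bits h cs (snd r)) ` set rs"
proof (induction h cs rs rule: split_cell.induct)
  case (2 h p ps)
  then show ?case by (auto simp: firsts_eq filter_id_conv)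
next
  case (3 h c cs p ps)
  define rs where "rs = p # ps"
  have ne: "\<forall>r\<in>set rs. snd r \<noteq> []" using 3(3) by (auto simp: rs_def)
  have len: "\<forall>r\<in>set (lower_half (c + h) rs). length (snd r) = length cs"
     "\<forall>r\<in>set (upper_half (c + h) rs). length (snd r) = length cs"
    using 3(3) by (auto simp: set_lower_half[OF ne] set_upper_half[OF ne] simp flip: rs_def)
  note IH1 = 3(1)[folded rs_def, OF len(1)]
  note IH2 = 3(2)[folded rs_def, OF len(2)]
  define A where "A = split_cell h cs (lower_half (c + h) rs)"
  define B where "B = split_cell h cs (upper_half (c + h) rs)"
  have eq: "split_cell h (c # cs) rs = map (apfst (Cons False)) A @ map (apfst (Cons True)) B"
    by (simp add: rs_def A_def B_def prefix_bit_eq)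
  note IH = IH1[folded A_def] IH2[folded B_def]
  have 1: "qs = map fst (filter (\<lambda>r. cell_bits h (c # cs) (snd r) = bs) rs)"
    if "(bs, qs) \<in> set (split_cell h (c # cs) rs)" for bs qs
    using that IH filter_lower_half[OF ne, of h cs _ c] filter_upper_half[OF ne, of h cs _ c]
    unfolding eq by fastforce
  have 2: "distinct (map fst (split_cell h (c # cs) rs))"
    using IH unfolding eq by (auto simp: distinct_map inj_on_def)
  have "fst ` set (split_cell h (c # cs) rs) = Cons False ` fst ` set A \<union> Cons True ` fst ` set B"
    unfolding eq by (force simp: image_iff)
  also have "\<dots> = Cons False ` (\<lambda>r. cell_bits h cs (snd r)) ` set (lower_half (c + h) rs) \<union>
      Cons True ` (\<lambda>r. cell_bits h cs (snd r)) ` set (upper_half (c + h) rs)"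
    using IH by simp
  also have "\<dots> = (\<lambda>r. cell_bits h (c # cs) (snd r)) ` set rs" (is "?l = ?r")
  proof
    show "?l \<subseteq> ?r"
      unfolding set_lower_half[OF ne] set_upper_half[OF ne] by (force simp: image_iff)
    show "?r \<subseteq> ?l"
    proof
      fix b assume "b \<in> ?r"
      then obtain p y ys where r: "(p, y # ys) \<in> set rs" "b = cell_bits h (c # cs) (y # ys)"
        using ne by (force simp: neq_Nil_conv)
      show "b \<in> ?l"
      proof (cases "y < c + h")
        case True
        then have "(p, ys) \<in> set (lower_half (c + h) rs)" using r by (auto simp: set_lower_half[OF ne])
        then show ?thesis using True r(2) by (force simp: image_iff)
      next
        case False
        then have "(p, ys) \<in> set (upper_half (c + h) rs)" using r by (auto simp: set_upper_half[OF ne])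
        then show ?thesis using False r(2) by (force simp: image_iff)
      qed
    qed
  qed
  finally show ?case using 1 2 by (auto simp flip: rs_def)
qed auto

lemma split_cell_attach:
  fixes h :: real
  assumes "\<forall>q\<in>set ps. length (snd q) = length cs"
  defines "gs \<equiv> split_cell h cs (attach_coords ps)"
  shows "(bs, qs) \<in> set gs \<Longrightarrow> qs = filter (\<lambda>q. cell_bits h cs (snd q) = bs) ps"
    and "distinct (map fst gs)"
    and "fst ` set gs = (\<lambda>q. cell_bits h cs (snd q)) ` set ps"
proof -
  have *: "\<forall>r\<in>set (attach_coords ps). length (snd r) = length cs"
    using assms(1) by (auto simp: attach_coords_eq)
  note sp = split_cell_properties[OF *, of h, folded gs_def]
  show "distinct (map fst gs)" using sp by blast
  show "fst ` set gs = (\<lambda>q. cell_bits h cs (snd q)) ` set ps"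
    using sp by (auto simp: attach_coords_eq image_image case_prod_unfold)
  assume "(bs, qs) \<in> set gs"
  then have "qs = map fst (filter (\<lambda>r. cell_bits h cs (snd r) = bs) (attach_coords ps))" using sp by auto
  then show "qs = filter (\<lambda>q. cell_bits h cs (snd q) = bs) ps"
    by (simp add: attach_coords_eq filter_map o_def case_prod_unfold)
qed

text \<open>Grouping by the first label and recursing in the subcell is grouping by the whole
  \<open>cell_path\<close>, since all points of a group share the corner of their subcell. The
  second half excludes the empty list, which at depth 0 still yields one leaf.\<close>

lemma leaves_build:
  assumes "\<forall>q\<in>set ps. length (snd q) = length cs"
  shows "(\<forall>(P, js)\<in>set (leaves (build l s cs ps)).
      js = map fst (filter (\<lambda>q. cell_path l s cs (snd q) = P) ps)) \<and>
    (ps \<noteq> [] \<longrightarrow> distinct (map fst (leaves (build l s cs ps))) \<and>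
      fst ` set (leaves (build l s cs ps)) = (\<lambda>q. cell_path l s cs (snd q)) ` set ps \<and>
      grid_tree (length cs) l (build l s cs ps))"
  using assms
proof (induction l arbitrary: s cs ps)
  case 0
  then show ?case by (cases ps) (auto simp: firsts_eq)
next
  case (Suc l)
  define h where "h = s / 2"
  define gs where "gs = split_cell h cs (attach_coords ps)"
  note sp = split_cell_attach[OF Suc.prems, where h = h, folded gs_def]
  have g: "qs = filter (\<lambda>q. cell_bits h cs (snd q) = bs) ps" "qs \<noteq> []" "length bs = length cs"
    "\<forall>q\<in>set qs. length (snd q) = length (child_corner h cs bs)"
    if "(bs, qs) \<in> set gs" for bs qs
  proof -
    show qs: "qs = filter (\<lambda>q. cell_bits h cs (snd q) = bs) ps" by (rule sp(1)[OF that])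
    have "bs \<in> (\<lambda>q. cell_bits h cs (snd q)) ` set ps" using that sp(3) by (metis fst_conv image_eqI)
    then show "qs \<noteq> []" and bs: "length bs = length cs"
      using Suc.prems by (auto simp: qs filter_empty_conv length_cell_bits)
    show "\<forall>q\<in>set qs. length (snd q) = length (child_corner h cs bs)"
      using Suc.prems by (auto simp: qs length_child_corner[OF bs])
  qed
  define T where "T = (\<lambda>(bs, qs). (bs, build l h (child_corner h cs bs) qs))"
  have bld: "build (Suc l) s cs ps = Node (map T gs)"
    by (simp add: build_children_eq gs_def h_def T_def)
  have lvs: "leaves (build (Suc l) s cs ps) =
     concat (map (\<lambda>(bs, qs). map (apfst (Cons bs)) (leaves (build l h (child_corner h cs bs) qs))) gs)"
    unfolding bld by (simp add: child_leaves_eq T_def o_def case_prod_unfold)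
  have IH: "\<forall>(P, js)\<in>set (leaves (build l h (child_corner h cs bs) qs)).
      js = map fst (filter (\<lambda>q. cell_path l h (child_corner h cs bs) (snd q) = P) qs)"
     "distinct (map fst (leaves (build l h (child_corner h cs bs) qs)))"
     "fst ` set (leaves (build l h (child_corner h cs bs) qs)) =
        (\<lambda>q. cell_path l h (child_corner h cs bs) (snd q)) ` set qs"
     "grid_tree (length cs) l (build l h (child_corner h cs bs) qs)"
    if "(bs, qs) \<in> set gs" for bs qs
    using Suc.IH[OF g(4)[OF that], of h] g(2)[OF that] length_child_corner[OF g(3)[OF that], of h] by auto
  have 1: "js = map fst (filter (\<lambda>q. cell_path (Suc l) s cs (snd q) = P) ps)"
    if Pjs: "(P, js) \<in> set (leaves (build (Suc l) s cs ps))" for P js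
  proof -
    obtain bs qs P' where P: "(bs, qs) \<in> set gs" "P = bs # P'"
      "(P', js) \<in> set (leaves (build l h (child_corner h cs bs) qs))"
      using Pjs unfolding lvs by auto
    have "js = map fst (filter (\<lambda>q. cell_path l h (child_corner h cs bs) (snd q) = P') qs)"
      using IH(1)[OF P(1)] P(3) by auto
    also have "\<dots> = map fst (filter (\<lambda>q. cell_path (Suc l) s cs (snd q) = P) ps)"
      unfolding g(1)[OF P(1)] filter_filter P(2)
      by (rule arg_cong[where f = "map fst"], rule filter_cong) (auto simp: h_def)
    finally show ?thesis .
  qed
  have 2: "fst ` set (leaves (build (Suc l) s cs ps)) = (\<lambda>q. cell_path (Suc l) s cs (snd q)) ` set ps"
  proof -
    have "fst ` set (leaves (build (Suc l) s cs ps)) =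
      (\<Union>(bs, qs)\<in>set gs. Cons bs ` fst ` set (leaves (build l h (child_corner h cs bs) qs)))"
      unfolding lvs by (force simp: image_iff)
    also have "\<dots> = (\<Union>(bs, qs)\<in>set gs. Cons bs ` (\<lambda>q. cell_path l h (child_corner h cs bs) (snd q)) ` set qs)"
    proof (rule SUP_cong[OF refl])
      fix g assume "g \<in> set gs"
      then show "(case g of (bs, qs) \<Rightarrow> Cons bs ` fst ` set (leaves (build l h (child_corner h cs bs) qs))) =
          (case g of (bs, qs) \<Rightarrow> Cons bs ` (\<lambda>q. cell_path l h (child_corner h cs bs) (snd q)) ` set qs)"
        using IH(3)[of "fst g" "snd g"] by (simp only: case_prod_unfold prod.collapse)
    qed
    also have "\<dots> = (\<Union>(bs, qs)\<in>set gs. (\<lambda>q. cell_path (Suc l) s cs (snd q)) ` set qs)"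
    proof (rule SUP_cong[OF refl])
      fix gq assume gq: "gq \<in> set gs"
      obtain bs qs where [simp]: "gq = (bs, qs)" by (cases gq)
      have "\<forall>q\<in>set qs. cell_bits h cs (snd q) = bs" using g(1)[of bs qs] gq by auto
      then show "(case gq of (bs, qs) \<Rightarrow> Cons bs ` (\<lambda>q. cell_path l h (child_corner h cs bs) (snd q)) ` set qs) =
          (case gq of (bs, qs) \<Rightarrow> (\<lambda>q. cell_path (Suc l) s cs (snd q)) ` set qs)"
        by (auto simp: image_image simp flip: h_def)
    qed
    also have "\<dots> = (\<lambda>q. cell_path (Suc l) s cs (snd q)) ` (\<Union>(bs, qs)\<in>set gs. set qs)"
      by auto
    also have "(\<Union>(bs, qs)\<in>set gs. set qs) = set ps"
    proof
      show "(\<Union>(bs, qs)\<in>set gs. set qs) \<subseteq> set ps" by (auto dest!: g(1))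
      show "set ps \<subseteq> (\<Union>(bs, qs)\<in>set gs. set qs)"
      proof
        fix q assume q: "q \<in> set ps"
        then obtain qs where qs: "(cell_bits h cs (snd q), qs) \<in> set gs" using sp(3) by force
        then have "q \<in> set qs" using g(1)[OF qs] q by auto
        then show "q \<in> (\<Union>(bs, qs)\<in>set gs. set qs)" using qs by auto
      qed
    qed
    finally show ?thesis .
  qed
  have 3: "distinct (map fst (leaves (build (Suc l) s cs ps)))"
  proof -
    \<comment> \<open>Induction over parts \<open>hs\<close> of the groups: the distinct labels in
      front keep the paths of different groups apart.\<close>
    have "distinct (map fst (concat (map (\<lambda>(bs, qs).
        map (apfst (Cons bs)) (leaves (build l h (child_corner h cs bs) qs))) hs)))"
      if "set hs \<subseteq> set gs" "distinct (map fst hs)" for hs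
      using that
    proof (induction hs)
      case (Cons gq hs)
      obtain bs qs where [simp]: "gq = (bs, qs)" by (cases gq)
      have "distinct (map fst (leaves (build l h (child_corner h cs bs) qs)))"
        using IH(2)[of bs qs] Cons.prems by auto
      then have "distinct (map (Cons bs \<circ> fst) (leaves (build l h (child_corner h cs bs) qs)))"
        by (simp add: distinct_map inj_on_def flip: map_map)
      then show ?case using Cons by (auto simp: o_def image_iff)
    qed auto
    then show ?thesis unfolding lvs using sp(2) by blast
  qed
  have 4: "grid_tree (length cs) (Suc l) (build (Suc l) s cs ps)" if "ps \<noteq> []"
  proof -
    have "gs \<noteq> []" using that sp(3) by auto
    moreover have "distinct (map fst (map T gs))"
      using sp(2) by (simp add: T_def o_def case_prod_unfold)
    moreover have "\<forall>(bs, t)\<in>set (map T gs). length bs = length cs \<and> grid_tree (length cs) l t"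
      using g(3) IH(4) by (auto simp: T_def)
    ultimately show ?thesis unfolding bld grid_tree.simps by simp
  qed
  show ?case using 1 2 3 4 by blast
qed

section \<open>Dependence of the tree on the corner of the root cell\<close>

lemma split_cell_cong:
  "\<forall>r\<in>set rs. length (snd r) = length cs \<and> cell_bits h cs (snd r) = cell_bits h cs' (snd r) \<Longrightarrow>
   length cs' = length cs \<Longrightarrow> split_cell h cs rs = split_cell h cs' rs"
proof (induction h cs rs arbitrary: cs' rule: split_cell.induct)
  case (3 h c cs p ps)
  obtain c' cs'' where cs': "cs' = c' # cs''" using 3(4) by (cases cs') auto
  define rs where "rs = p # ps"
  have b: "\<forall>r\<in>set rs. \<exists>y ys. snd r = y # ys \<and> (y < c + h \<longleftrightarrow> y < c' + h) \<and> length ys = length cs \<and>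
     cell_bits h cs ys = cell_bits h cs'' ys"
  proof
    fix r assume "r \<in> set rs"
    then show "\<exists>y ys. snd r = y # ys \<and> (y < c + h \<longleftrightarrow> y < c' + h) \<and> length ys = length cs \<and>
     cell_bits h cs ys = cell_bits h cs'' ys"
      using 3(3) cs' unfolding rs_def[symmetric] by (cases "snd r") force+
  qed
  have ne: "\<forall>r\<in>set rs. snd r \<noteq> []" using b by auto
  have "lower_half (c + h) rs = lower_half (c' + h) rs"
    using b by (induction "c + h" rs rule: lower_half.induct) auto
  moreover have "upper_half (c + h) rs = upper_half (c' + h) rs"
    using b by (induction "c + h" rs rule: upper_half.induct) auto
  moreover have "split_cell h cs (lower_half (c + h) rs) = split_cell h cs'' (lower_half (c + h) rs)"
    using b 3(4) cs' unfolding rs_def[symmetric]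
    by (intro 3(1)[folded rs_def]) (fastforce simp: set_lower_half[OF ne])+
  moreover have "split_cell h cs (upper_half (c + h) rs) = split_cell h cs'' (upper_half (c + h) rs)"
    using b 3(4) cs' unfolding rs_def[symmetric]
    by (intro 3(2)[folded rs_def]) (fastforce simp: set_upper_half[OF ne])+
  ultimately show ?case unfolding cs' rs_def by simp
qed auto

text \<open>The real corner enters \<open>build\<close> only through comparisons, whose outcomes are
  the bits of \<open>cell_path\<close>. The subcell corners of the two trees still differ, so the
  induction is over arbitrary pairs of corners.\<close>

lemma build_cong:
  "\<forall>q\<in>set ps. length (snd q) = length cs \<and> cell_path l s cs (snd q) = cell_path l s cs' (snd q) \<Longrightarrow>
   length cs' = length cs \<Longrightarrow> build l s cs ps = build l s cs' ps"
proof (induction l arbitrary: s cs cs' ps)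
  case (Suc l)
  define gs where "gs = split_cell (s / 2) cs (attach_coords ps)"
  have gs': "gs = split_cell (s / 2) cs' (attach_coords ps)"
    unfolding gs_def using Suc.prems by (intro split_cell_cong) (auto simp: attach_coords_eq)
  have l: "\<forall>q\<in>set ps. length (snd q) = length cs" using Suc.prems by auto
  have "build l (s / 2) (child_corner (s / 2) cs bs) qs = build l (s / 2) (child_corner (s / 2) cs' bs) qs"
    if "(bs, qs) \<in> set gs" for bs qs
  proof (rule Suc.IH)
    have qs: "qs = filter (\<lambda>q. cell_bits (s / 2) cs (snd q) = bs) ps"
      using split_cell_attach(1)[OF l] that gs_def by blast
    have "bs \<in> (\<lambda>q. cell_bits (s / 2) cs (snd q)) ` set ps"
      using that split_cell_attach(3)[OF l, where h = "s / 2"] by (metis fst_conv gs_def image_eqI)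
    then have bs: "length bs = length cs" using l by (auto simp: length_cell_bits)
    show "\<forall>q\<in>set qs. length (snd q) = length (child_corner (s / 2) cs bs) \<and>
       cell_path l (s / 2) (child_corner (s / 2) cs bs) (snd q) =
       cell_path l (s / 2) (child_corner (s / 2) cs' bs) (snd q)"
      using Suc.prems(1) by (auto simp: qs length_child_corner[OF bs])
    show "length (child_corner (s / 2) cs' bs) = length (child_corner (s / 2) cs bs)"
      using bs Suc.prems(2) by (simp add: length_child_corner)
  qed
  then show ?case
    by (auto simp: build_children_eq gs_def[symmetric] gs'[symmetric])
qed auto

subsection \<open>Distortion\<close>

text \<open>For labels of an unpruned path this is the offset, in coordinate \<open>k\<close>, of
  the reached cell from the least corner of a root cell of side \<open>s\<close>. Decoded points are
  thus positions relative to that corner, which cancels in differences.\<close>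

definition path_value :: "real \<Rightarrow> bool list list \<Rightarrow> nat \<Rightarrow> real" where
  "path_value s P k = (\<Sum>t<length P. if P ! t ! k then s / 2 ^ Suc t else 0)"

lemma path_value_Nil [simp]: "path_value s [] k = 0"
  by (simp add: path_value_def)

lemma path_value_Cons: "path_value s (b # P) k = (if b ! k then s / 2 else 0) + path_value (s / 2) P k"
proof -
  have "path_value s (b # P) k = (\<Sum>t<Suc (length P). if (b # P) ! t ! k then s / 2 ^ Suc t else 0)"
    by (simp add: path_value_def)
  also have "\<dots> = (if b ! k then s / 2 else 0) + (\<Sum>t<length P. if P ! t ! k then s / 2 ^ Suc (Suc t) else 0)"
    by (subst sum.lessThan_Suc_shift) simp
  also have "(\<Sum>t<length P. if P ! t ! k then s / 2 ^ Suc (Suc t) else 0) = path_value (s / 2) P k"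
    unfolding path_value_def by (intro sum.cong) auto
  finally show ?thesis .
qed

lemma node_point_nth:
  "k < d \<Longrightarrow> node_point d R es ! k = path_value (2 powi R) (expand_path d es) k"
proof -
  have "(2::real) powi (R - 1 - int t) = 2 powi R / 2 ^ Suc t" for t
    by (simp add: power_int_diff power_int_of_nat)
  then show "k < d \<Longrightarrow> node_point d R es ! k = path_value (2 powi R) (expand_path d es) k"
    by (simp add: node_point_def Let_def path_value_def expand_path_def del: power_Suc cong: if_cong)
qed

lemma cell_bits_nth:
  "k < length cs \<Longrightarrow> length x = length cs \<Longrightarrow> cell_bits h cs x ! k \<longleftrightarrow> \<not> x ! k < cs ! k + h"
proof (induction h cs x arbitrary: k rule: cell_bits.induct)
  case (1 h c cs y ys)
  then show ?case by (cases k) auto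
qed auto

lemma child_corner_nth:
  "k < length cs \<Longrightarrow> length bs = length cs \<Longrightarrow>
    child_corner h cs bs ! k = (if bs ! k then cs ! k + h else cs ! k)"
proof (induction h cs bs arbitrary: k rule: child_corner.induct)
  case (1 h c cs b bs)
  then show ?case by (cases k) auto
qed auto

text \<open>Invariant: the point stays in its closed cell. Both inequalities are non-strict because
  the root cube is closed and a point on its upper face stays in the last cell.\<close>

lemma cell_path_bounds:
  assumes "length x = length cs" "k < length cs" "cs ! k \<le> x ! k" "x ! k \<le> cs ! k + s"
  shows "cs ! k + path_value s (cell_path l s cs x) k \<le> x ! k"
    and "x ! k \<le> cs ! k + path_value s (cell_path l s cs x) k + s / 2 ^ l"
proof -
  have "cs ! k + path_value s (cell_path l s cs x) k \<le> x ! k \<and>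
    x ! k \<le> cs ! k + path_value s (cell_path l s cs x) k + s / 2 ^ l"
    using assms
  proof (induction l arbitrary: s cs)
    case (Suc l)
    define bs where "bs = cell_bits (s / 2) cs x"
    have len: "length bs = length cs" using Suc.prems by (simp add: bs_def length_cell_bits)
    have bsk: "bs ! k \<longleftrightarrow> \<not> x ! k < cs ! k + s / 2"
      using Suc.prems by (simp add: bs_def cell_bits_nth)
    have "child_corner (s / 2) cs bs ! k + path_value (s / 2) (cell_path l (s / 2) (child_corner (s / 2) cs bs) x) k \<le> x ! k \<and>
      x ! k \<le> child_corner (s / 2) cs bs ! k + path_value (s / 2) (cell_path l (s / 2) (child_corner (s / 2) cs bs) x) k + s / 2 / 2 ^ l"
      using Suc.prems len bsk by (intro Suc.IH) (auto simp: length_child_corner child_corner_nth)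
    then show ?case using bsk Suc.prems(2) len
      by (auto simp: path_value_Cons child_corner_nth bs_def[symmetric])
  qed auto
  then show "cs ! k + path_value s (cell_path l s cs x) k \<le> x ! k"
    "x ! k \<le> cs ! k + path_value s (cell_path l s cs x) k + s / 2 ^ l" by auto
qed

text \<open>The plane that halves a cell at depth \<open>m\<close> belongs to the grid of side
  \<open>s / 2 ^ Suc m\<close> anchored at the root corner. Naming it by an integer \<open>z\<close>
  lets the padding condition speak of whole grids rather than of cells.\<close>

lemma cell_path_separation:
  assumes "length x = length cs" "length y = length cs" "m < l"
    and "take m (cell_path l s cs x) = take m (cell_path l s cs y)"
    and "cell_path l s cs x ! m \<noteq> cell_path l s cs y ! m"
  shows "\<exists>k<length cs. \<exists>z::int.
    (x ! k < cs ! k + of_int z * (s / 2 ^ Suc m) \<and> cs ! k + of_int z * (s / 2 ^ Suc m) \<le> y ! k) \<or>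
    (y ! k < cs ! k + of_int z * (s / 2 ^ Suc m) \<and> cs ! k + of_int z * (s / 2 ^ Suc m) \<le> x ! k)"
  using assms
proof (induction l arbitrary: s cs m)
  case (Suc l)
  show ?case
  proof (cases m)
    case 0
    then have "cell_bits (s / 2) cs x \<noteq> cell_bits (s / 2) cs y" using Suc.prems by simp
    then obtain k where "k < length cs" "cell_bits (s / 2) cs x ! k \<noteq> cell_bits (s / 2) cs y ! k"
      using Suc.prems(1,2) by (auto simp: list_eq_iff_nth_eq length_cell_bits)
    then show ?thesis using Suc.prems(1,2) 0
      by (intro exI[of _ k] conjI exI[of _ 1]) (auto simp: cell_bits_nth)
  next
    case (Suc m')
    define bs where "bs = cell_bits (s / 2) cs x"
    have bs: "bs = cell_bits (s / 2) cs y" using Suc.prems(4) Suc by (simp add: bs_def)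
    have len: "length bs = length cs" using Suc.prems by (simp add: bs_def length_cell_bits)
    define cs' where "cs' = child_corner (s / 2) cs bs"
    have len': "length cs' = length cs" using len by (simp add: cs'_def length_child_corner)
    have "\<exists>k<length cs'. \<exists>z::int.
      (x ! k < cs' ! k + of_int z * (s / 2 / 2 ^ Suc m') \<and> cs' ! k + of_int z * (s / 2 / 2 ^ Suc m') \<le> y ! k) \<or>
      (y ! k < cs' ! k + of_int z * (s / 2 / 2 ^ Suc m') \<and> cs' ! k + of_int z * (s / 2 / 2 ^ Suc m') \<le> x ! k)"
      using Suc.prems Suc len' bs by (intro Suc.IH) (auto simp: bs_def cs'_def)
    then obtain k and z :: int where k: "k < length cs" and
      kz: "(x ! k < cs' ! k + of_int z * (s / 2 / 2 ^ Suc m') \<and> cs' ! k + of_int z * (s / 2 / 2 ^ Suc m') \<le> y ! k) \<or>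
      (y ! k < cs' ! k + of_int z * (s / 2 / 2 ^ Suc m') \<and> cs' ! k + of_int z * (s / 2 / 2 ^ Suc m') \<le> x ! k)"
      using len' by auto
    \<comment> \<open>Passing to the upper half moves the corner by \<open>s / 2\<close>, which is
      \<open>2 ^ m\<close> sides of the grid at depth \<open>m\<close>.\<close>
    define z' where "z' = (if bs ! k then z + 2 ^ m else z)"
    have "cs' ! k + of_int z * (s / 2 / 2 ^ Suc m') = cs ! k + of_int z' * (s / 2 ^ Suc m)"
      using k len by (simp add: cs'_def child_corner_nth z'_def Suc field_simps)
    then show ?thesis using kz k by auto
  qed
qed auto

lemma sum_inverse_two_powers:
  "a \<le> b \<Longrightarrow> (\<Sum>t\<in>{a..<b}. s / 2 ^ Suc t) = s / 2 ^ a - s / (2 ^ b :: real)"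
proof (induction b rule: dec_induct)
  case (step n)
  have "s / 2 ^ n = s / 2 ^ Suc n + s / 2 ^ Suc n" by simp
  then show ?case unfolding sum.atLeastLessThan_Suc[OF step(1)] step(3) by linarith
qed simp

text \<open>The loss splits at depth \<open>m\<close>: \<open>A\<close> is the part above, the next
  \<open>\<Lambda>\<close> levels lose nothing, and the rest is a geometric tail, nonnegative
  because bits are only cleared. For two points separating at depth \<open>m\<close> the part
  \<open>A\<close> is the same, so it will cancel.\<close>

lemma path_value_minus_bounds:
  assumes z: "zeroed d 0 P Q" and k: "k < d" and s: "0 \<le> s"
    and eq: "\<And>t. m \<le> t \<Longrightarrow> t < m + \<Lambda> \<Longrightarrow> t < length P \<Longrightarrow> Q ! t = P ! t"
    and m: "m \<le> length P"
  defines "A \<equiv> path_value s (take m P) k - path_value s (take m Q) k"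
  shows "path_value s P k - path_value s Q k - A \<in> {0..s / 2 ^ (m + \<Lambda>)}"
proof -
  define f where "f P t = (if P ! t ! k then s / 2 ^ Suc t else 0)" for P :: "bool list list" and t
  have len: "length Q = length P" using z by (simp add: zeroed_def)
  have split: "path_value s R k = path_value s (take m R) k + (\<Sum>t\<in>{m..<length P}. f R t)"
    if "length R = length P" for R
  proof -
    have "path_value s R k = (\<Sum>t\<in>{..<m} \<union> {m..<length P}. f R t)"
      unfolding path_value_def f_def that using m by (intro sum.cong) auto
    also have "\<dots> = (\<Sum>t\<in>{..<m}. f R t) + (\<Sum>t\<in>{m..<length P}. f R t)"
      by (rule sum.union_disjoint) auto
    also have "(\<Sum>t\<in>{..<m}. f R t) = path_value s (take m R) k"
      unfolding path_value_def f_def using m that by (intro sum.cong) auto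
    finally show ?thesis .
  qed
  have "path_value s P k - path_value s Q k - A = (\<Sum>t\<in>{m..<length P}. f P t - f Q t)"
    using split[of P] split[of Q] len by (simp add: A_def sum_subtractf)
  also have "\<dots> = (\<Sum>t\<in>{m+\<Lambda>..<length P}. f P t - f Q t)"
    by (rule sum.mono_neutral_right) (auto simp: f_def eq)
  finally have D: "path_value s P k - path_value s Q k - A = (\<Sum>t\<in>{m+\<Lambda>..<length P}. f P t - f Q t)" .
  have 0: "0 \<le> f P t - f Q t \<and> f P t - f Q t \<le> s / 2 ^ Suc t" if "t < length P" for t
    using z that k s by (auto simp: zeroed_def f_def)
  have "(\<Sum>t\<in>{m+\<Lambda>..<length P}. f P t - f Q t) \<le> s / 2 ^ (m + \<Lambda>)"
  proof (cases "m + \<Lambda> \<le> length P")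
    case True
    have "(\<Sum>t\<in>{m+\<Lambda>..<length P}. f P t - f Q t) \<le> (\<Sum>t\<in>{m+\<Lambda>..<length P}. s / 2 ^ Suc t)"
      using 0 by (intro sum_mono) auto
    also have "\<dots> \<le> s / 2 ^ (m + \<Lambda>)"
      unfolding sum_inverse_two_powers[OF True] using s by simp
    finally show ?thesis .
  qed (use s in auto)
  moreover have "0 \<le> (\<Sum>t\<in>{m+\<Lambda>..<length P}. f P t - f Q t)" using 0 by (intro sum_nonneg) auto
  ultimately show ?thesis unfolding D by simp
qed

text \<open>Bounding by the sum of coordinates costs a factor \<open>d\<close> where its square root
  would do; the factor ends up inside the logarithm of \<Lambda>.\<close>

lemma eucl_dist_le_sum:
  assumes "\<And>k. k < d \<Longrightarrow> \<bar>x ! k - y ! k\<bar> \<le> e"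
  shows "eucl_dist d x y \<le> real d * e"
proof -
  have "eucl_dist d x y \<le> (\<Sum>k<d. \<bar>x ! k - y ! k\<bar>)" unfolding eucl_dist_def by (rule L2_set_le_sum_abs)
  also have "\<dots> \<le> (\<Sum>k<d. e)" using assms by (intro sum_mono) auto
  finally show ?thesis by simp
qed

lemma eucl_dist_perturbation:
  assumes "\<And>k. k < d \<Longrightarrow> \<bar>(x ! k - y ! k) - (x' ! k - y' ! k)\<bar> \<le> e"
  shows "\<bar>eucl_dist d x y - eucl_dist d x' y'\<bar> \<le> real d * e"
proof -
  have *: "L2_set f {..<d} \<le> L2_set g {..<d} + real d * e"
    if "\<And>k. k < d \<Longrightarrow> \<bar>f k - g k\<bar> \<le> e" for f g :: "nat \<Rightarrow> real"
  proof -
    have "L2_set f {..<d} = L2_set (\<lambda>k. g k + (f k - g k)) {..<d}" by simp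
    also have "\<dots> \<le> L2_set g {..<d} + L2_set (\<lambda>k. f k - g k) {..<d}" by (rule L2_set_triangle_ineq)
    also have "L2_set (\<lambda>k. f k - g k) {..<d} \<le> (\<Sum>k<d. \<bar>f k - g k\<bar>)" by (rule L2_set_le_sum_abs)
    also have "\<dots> \<le> (\<Sum>k<d. e)" using that by (intro sum_mono) auto
    finally show ?thesis by simp
  qed
  have "\<bar>(x' ! k - y' ! k) - (x ! k - y ! k)\<bar> \<le> e" if "k < d" for k using assms[OF that] by linarith
  then show ?thesis using *[of "\<lambda>k. x ! k - y ! k" "\<lambda>k. x' ! k - y' ! k"]
      *[of "\<lambda>k. x' ! k - y' ! k" "\<lambda>k. x ! k - y ! k"] assms
    unfolding eucl_dist_def by fastforce
qed

lemma abs_diff_le_eucl_dist: "k < d \<Longrightarrow> \<bar>x ! k - y ! k\<bar> \<le> eucl_dist d x y"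
  unfolding eucl_dist_def L2_set_def
  by (rule real_le_rsqrt) (auto intro!: member_le_sum[of k "{..<d}" "\<lambda>k. (x ! k - y ! k)\<^sup>2", simplified])

text \<open>The deterministic core. Only \<open>x\<close> is padded; \<open>y\<close> may lie
  arbitrarily close to a grid plane. \<open>Q\<close> and \<open>Q'\<close> stand for the expanded
  edge sequences of the two leaves.\<close>

lemma distortion:
  fixes x y cs :: "real list" and s \<eta> \<mu> \<epsilon> :: real and L \<Lambda> d :: nat
  defines "P \<equiv> cell_path L s cs x" and "P' \<equiv> cell_path L s cs y"
  assumes len: "length cs = d" "length x = d" "length y = d"
    and box: "\<And>k. k < d \<Longrightarrow> cs ! k \<le> x ! k \<and> x ! k \<le> cs ! k + s \<and> cs ! k \<le> y ! k \<and> y ! k \<le> cs ! k + s"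
    and s: "0 < s" and \<eta>: "0 < \<eta>" "\<eta> \<le> 1" and d: "d \<ge> 1"
    and leaf: "s / 2 ^ L \<le> 8 * eucl_dist d x y / 2 ^ \<Lambda>"
    and pos: "eucl_dist d x y > 0" and \<Lambda>: "8 * real d < 2 ^ \<Lambda>"
    and bound: "10 * real d \<le> \<epsilon> * \<eta> * 2 ^ \<Lambda>"
    and padded: "\<And>m k (z::int). m < L \<Longrightarrow> k < d \<Longrightarrow>
       \<bar>x ! k - (cs ! k + of_int z * (s / 2 ^ Suc m))\<bar> \<ge> \<eta> * (s / 2 ^ Suc m)"
    and agr: "agrees_until \<Lambda> P Q P' Q'" and z: "zeroed d 0 P Q" "zeroed d 0 P' Q'"
    and x': "\<And>k. k < d \<Longrightarrow> x' ! k = path_value s Q k" and y': "\<And>k. k < d \<Longrightarrow> y' ! k = path_value s Q' k"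
  shows "\<bar>eucl_dist d x y - eucl_dist d x' y'\<bar> \<le> \<epsilon> * eucl_dist d x y"
proof -
  define D where "D = eucl_dist d x y"
  have xb: "cs ! k + path_value s P k \<le> x ! k" "x ! k \<le> cs ! k + path_value s P k + s / 2 ^ L"
    and yb: "cs ! k + path_value s P' k \<le> y ! k" "y ! k \<le> cs ! k + path_value s P' k + s / 2 ^ L" if "k < d" for k
    using cell_path_bounds[of x cs k s L] cell_path_bounds[of y cs k s L] box[OF that] len that
    by (auto simp: P_def P'_def)
  \<comment> \<open>Points in a common leaf cell would be at distance at most
    \<open>real d * (8 * D / 2 ^ \<Lambda>)\<close>, which is less than \<open>D\<close>. So leaf
    cells are fine enough to separate the two points.\<close>
  have "P \<noteq> P'"
  proof
    assume "P = P'"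
    then have "\<bar>x ! k - y ! k\<bar> \<le> s / 2 ^ L" if "k < d" for k
      using xb[OF that] yb[OF that] unfolding \<open>P = P'\<close> by linarith
    then have "D \<le> real d * (s / 2 ^ L)" unfolding D_def by (rule eucl_dist_le_sum)
    also have "\<dots> \<le> real d * (8 * D / 2 ^ \<Lambda>)" using leaf unfolding D_def by (intro mult_left_mono) auto
    also have "\<dots> = D * (8 * real d / 2 ^ \<Lambda>)" by simp
    also have "\<dots> < D * 1" using pos \<Lambda> unfolding D_def by (intro mult_strict_left_mono) auto
    finally show False by simp
  qed
  then have ex: "\<exists>m. m < L \<and> P ! m \<noteq> P' ! m"
    unfolding P_def P'_def by (metis length_cell_path nth_equalityI)
  define m where "m = (LEAST m. m < L \<and> P ! m \<noteq> P' ! m)"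
  have m: "m < L" "P ! m \<noteq> P' ! m" using LeastI_ex[OF ex] unfolding m_def by auto
  have tk: "take m P = take m P'"
  proof (rule nth_equalityI)
    fix t assume "t < length (take m P)"
    then have "t < m" by simp
    then have "P ! t = P' ! t" using not_less_Least[of t "\<lambda>m. m < L \<and> P ! m \<noteq> P' ! m"] m(1)
      unfolding m_def[symmetric] by auto
    then show "take m P ! t = take m P' ! t" using \<open>t < m\<close> by simp
  qed (simp add: P_def P'_def)
  have lens: "length P = L" "length P' = L" by (auto simp: P_def P'_def)
  note ag = agr[unfolded agrees_until_def, THEN spec, THEN mp, OF tk]
  have Q: "take m Q = take m Q'"
    "\<And>t. m \<le> t \<Longrightarrow> t < m + \<Lambda> \<Longrightarrow> t < length P \<Longrightarrow> Q ! t = P ! t"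
    "\<And>t. m \<le> t \<Longrightarrow> t < m + \<Lambda> \<Longrightarrow> t < length P' \<Longrightarrow> Q' ! t = P' ! t"
    using ag m lens by simp_all
  have "\<eta> * (s / 2 ^ Suc m) \<le> D"
  proof -
    obtain k and z :: int where k: "k < d" and
      "(x ! k < cs ! k + of_int z * (s / 2 ^ Suc m) \<and> cs ! k + of_int z * (s / 2 ^ Suc m) \<le> y ! k) \<or>
       (y ! k < cs ! k + of_int z * (s / 2 ^ Suc m) \<and> cs ! k + of_int z * (s / 2 ^ Suc m) \<le> x ! k)"
      using cell_path_separation[of x cs y m L s] tk m len unfolding P_def P'_def by auto
    then have "\<eta> * (s / 2 ^ Suc m) \<le> \<bar>x ! k - y ! k\<bar>" using padded[OF m(1) k, of z] by argo
    then show ?thesis using abs_diff_le_eucl_dist[OF k, of x y] unfolding D_def by linarith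
  qed
  then have sm: "s / 2 ^ m \<le> 2 * D / \<eta>" using \<eta> by (simp add: field_simps)
  \<comment> \<open>The two tail losses lie in the same interval starting at 0, as do the two
    positions inside the leaf cells, so each pair contributes one interval length and not two. The
    losses above depth \<open>m\<close> coincide and cancel.\<close>
  have "\<bar>(x ! k - y ! k) - (x' ! k - y' ! k)\<bar> \<le> s / 2 ^ (m + \<Lambda>) + s / 2 ^ L" if k: "k < d" for k
  proof -
    have "path_value s P k - path_value s Q k - (path_value s (take m P) k - path_value s (take m Q) k) \<in> {0..s / 2 ^ (m + \<Lambda>)}"
      by (rule path_value_minus_bounds[OF z(1) k]) (use s Q m lens in auto)
    moreover have "path_value s P' k - path_value s Q' k - (path_value s (take m P') k - path_value s (take m Q') k) \<in> {0..s / 2 ^ (m + \<Lambda>)}"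
      by (rule path_value_minus_bounds[OF z(2) k]) (use s Q m lens in auto)
    ultimately show ?thesis using xb[OF k] yb[OF k] x'[OF k] y'[OF k] tk Q(1) unfolding atLeastAtMost_iff
      by (smt (verit))
  qed
  then have "\<bar>eucl_dist d x y - eucl_dist d x' y'\<bar> \<le> real d * (s / 2 ^ (m + \<Lambda>) + s / 2 ^ L)"
    by (rule eucl_dist_perturbation)
  \<comment> \<open>The 10 is 2 + 8: the factor 2 from \<open>sm\<close> for the pruning loss, the 8
    from \<open>leaf\<close> for the leaf cells, with \<open>\<eta> \<le> 1\<close> used to bring
    both over \<open>\<eta>\<close>.\<close>
  also have "\<dots> \<le> real d * (10 * D / \<eta> / 2 ^ \<Lambda>)"
  proof (intro mult_left_mono)
    have "s / 2 ^ (m + \<Lambda>) = s / 2 ^ m / 2 ^ \<Lambda>" by (simp add: power_add)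
    also have "\<dots> \<le> 2 * D / \<eta> / 2 ^ \<Lambda>" using sm by (intro divide_right_mono) auto
    finally have 1: "s / 2 ^ (m + \<Lambda>) \<le> 2 * D / \<eta> / 2 ^ \<Lambda>" .
    have "8 * D / 1 / 2 ^ \<Lambda> \<le> 8 * D / \<eta> / 2 ^ \<Lambda>"
      using \<eta> pos unfolding D_def by (intro divide_right_mono divide_left_mono) auto
    then have "s / 2 ^ L \<le> 8 * D / \<eta> / 2 ^ \<Lambda>" using leaf unfolding D_def by simp
    then show "s / 2 ^ (m + \<Lambda>) + s / 2 ^ L \<le> 10 * D / \<eta> / 2 ^ \<Lambda>"
      using 1 by (simp add: add_divide_distrib[symmetric])
  qed simp
  also have "\<dots> = D * (10 * real d / (\<eta> * 2 ^ \<Lambda>))" by simp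
  also have "\<dots> \<le> D * \<epsilon>" using bound \<eta> pos unfolding D_def
    by (intro mult_left_mono) (auto simp: field_simps)
  finally show ?thesis unfolding D_def by (simp add: mult.commute)
qed

subsection \<open>Measurability\<close>

lemma cube_corner_shift_list:
  "length x = d \<Longrightarrow> cube_corner D x (shift_list d \<sigma>) = map (\<lambda>k. x ! k + \<sigma> k - 2 * D) [0..<d]"
proof -
  have "cube_corner D x ss = map (\<lambda>k. x ! k + ss ! k - 2 * D) [0..<length x]"
    if "length ss = length x" for ss
    using that by (induction D x ss rule: cube_corner.induct) (auto simp: upt_conv_Cons map_Suc_upt[symmetric] simp del: upt_Suc)
  from this[of "shift_list d \<sigma>"] show "length x = d \<Longrightarrow> ?thesis"
    by (auto simp: shift_list_def)
qed

text \<open>The corner consists of arbitrary measurable functions, so that the induction hypothesis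
  also covers the corners of subcells.\<close>

lemma sets_cell_path_eq:
  assumes "\<And>k. k < d \<Longrightarrow> f k \<in> borel_measurable M" "length x = d"
  shows "{\<sigma> \<in> space M. cell_path l s (map (\<lambda>k. f k \<sigma>) [0..<d]) x = P} \<in> sets M"
  using assms
proof (induction l arbitrary: s f P)
  case 0
  then show ?case by (cases "P = []") auto
next
  case (Suc l)
  note [measurable] = Suc.prems(1)
  show ?case
  proof (cases "P \<noteq> [] \<and> length (hd P) = d")
    case True
    then obtain b P' where P: "P = b # P'" "length b = d" by (cases P) auto
    \<comment> \<open>on the event that the first bits are \<open>b\<close>, the corner of the subcell is measurable in \<open>\<sigma>\<close>\<close>
    define g where "g k \<sigma> = (if b ! k then f k \<sigma> + s / 2 else f k \<sigma>)" for k \<sigma>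
    have g: "g k \<in> borel_measurable M" if "k < d" for k
      using that unfolding g_def by measurable
    have corner: "child_corner (s / 2) (map (\<lambda>k. f k \<sigma>) [0..<d]) b = map (\<lambda>k. g k \<sigma>) [0..<d]" for \<sigma>
      by (rule nth_equalityI) (auto simp: length_child_corner P child_corner_nth g_def)
    have bits: "cell_bits (s / 2) (map (\<lambda>k. f k \<sigma>) [0..<d]) x = b \<longleftrightarrow>
       (\<forall>k\<in>{..<d}. b ! k \<longleftrightarrow> \<not> x ! k < f k \<sigma> + s / 2)" for \<sigma>
      using P Suc.prems(2) by (auto simp: list_eq_iff_nth_eq length_cell_bits cell_bits_nth)
    have "{\<sigma> \<in> space M. cell_path (Suc l) s (map (\<lambda>k. f k \<sigma>) [0..<d]) x = P} =
       {\<sigma> \<in> space M. \<forall>k\<in>{..<d}. b ! k \<longleftrightarrow> \<not> x ! k < f k \<sigma> + s / 2} \<inter>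
       {\<sigma> \<in> space M. cell_path l (s / 2) (map (\<lambda>k. g k \<sigma>) [0..<d]) x = P'}"
      unfolding bits[symmetric] corner[symmetric] by (auto simp: P cong: conj_cong)
    moreover have "{\<sigma> \<in> space M. \<forall>k\<in>{..<d}. b ! k \<longleftrightarrow> \<not> x ! k < f k \<sigma> + s / 2} \<in> sets M"
      by (intro sets.sets_Collect_finite_All) (auto simp: Collect_conj_eq[symmetric])
    ultimately show ?thesis using Suc.IH[of g "s / 2" P'] g Suc.prems(2) by (simp del: cell_path.simps)
  next
    case False
    then have "cell_path (Suc l) s (map (\<lambda>k. f k \<sigma>) [0..<d]) x \<noteq> P" for \<sigma>
      using length_cell_bits[of x "map (\<lambda>k. f k \<sigma>) [0..<d]" "s / 2"] Suc.prems(2) by auto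
    then show ?thesis by (simp del: cell_path.simps)
  qed
qed

text \<open>An event determined by a countably valued function is a countable union of its level
  sets, so nothing has to be known about how \<open>Q\<close> is defined, not even if it speaks of
  real distances.\<close>

lemma sets_Collect_factor:
  fixes \<tau> :: "'a \<Rightarrow> 'b :: countable"
  assumes "\<And>T. {\<sigma> \<in> space M. \<tau> \<sigma> = T} \<in> sets M"
    and "\<And>\<sigma> \<sigma>'. \<tau> \<sigma> = \<tau> \<sigma>' \<Longrightarrow> Q \<sigma> \<Longrightarrow> Q \<sigma>'"
  shows "{\<sigma> \<in> space M. Q \<sigma>} \<in> sets M"
proof -
  have "{\<sigma> \<in> space M. Q \<sigma>} = (\<Union>T\<in>\<tau> ` {\<sigma>. Q \<sigma>}. {\<sigma> \<in> space M. \<tau> \<sigma> = T})"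
  proof (intro equalityI subsetI)
    fix \<sigma> assume "\<sigma> \<in> (\<Union>T\<in>\<tau> ` {\<sigma>. Q \<sigma>}. {\<sigma> \<in> space M. \<tau> \<sigma> = T})"
    then obtain \<sigma>' where "Q \<sigma>'" "\<tau> \<sigma>' = \<tau> \<sigma>" "\<sigma> \<in> space M" by force
    then show "\<sigma> \<in> {\<sigma> \<in> space M. Q \<sigma>}" using assms(2)[of \<sigma>' \<sigma>] by simp
  qed auto
  also have "\<dots> \<in> sets M"
    by (intro sets.countable_UN'' assms(1) countableI_type)
  finally show ?thesis .
qed

lemma sets_shift_distr: "sets (shift_distr d D) = sets (PiM {..<d} (\<lambda>_. borel))"
  unfolding shift_distr_def by (rule sets_PiM_cong) auto

text \<open>\<open>Q\<close> is an arbitrary predicate on bit strings. The function of the shift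
  with countably many values is the list of cell paths of all points.\<close>

lemma sets_sketch_event:
  assumes X: "\<forall>x\<in>set X. length x = d"
  shows "{\<sigma> \<in> space (shift_distr d D). Q (quadsketch L \<Lambda> (shift_list d \<sigma>) X)} \<in> sets (shift_distr d D)"
proof (cases X)
  case (Cons x xs)
  define s where "s = 4 * pow2 (log_radius X)"
  define cs where "cs \<sigma> = map (\<lambda>k. x ! k + \<sigma> k - 2 * pow2 (log_radius X)) [0..<d]" for \<sigma>
  define \<tau> where "\<tau> \<sigma> = map (cell_path L s (cs \<sigma>)) X" for \<sigma>
  show ?thesis
  proof (rule sets_Collect_factor[of _ \<tau>])
    fix T
    have [measurable]: "(\<lambda>\<sigma>. \<sigma> k) \<in> borel_measurable (shift_distr d D)" if "k < d" for k
    proof -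
      have "(\<lambda>\<sigma>. \<sigma> k) \<in> borel_measurable (PiM {..<d} (\<lambda>_. borel))"
        using that by (intro measurable_component_singleton) auto
      then show ?thesis using measurable_cong_sets[OF sets_shift_distr refl] by blast
    qed
    show "{\<sigma> \<in> space (shift_distr d D). \<tau> \<sigma> = T} \<in> sets (shift_distr d D)"
    proof (cases "length T = length X")
      case True
      have "{\<sigma> \<in> space (shift_distr d D). \<tau> \<sigma> = T} =
         {\<sigma> \<in> space (shift_distr d D). \<forall>i\<in>{..<length X}. cell_path L s (cs \<sigma>) (X ! i) = T ! i}"
        using True by (auto simp: \<tau>_def list_eq_iff_nth_eq)
      moreover have "{\<sigma> \<in> space (shift_distr d D). cell_path L s (cs \<sigma>) (X ! i) = T ! i}
          \<in> sets (shift_distr d D)" if "i < length X" for i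
        unfolding cs_def using X that by (intro sets_cell_path_eq) auto
      ultimately show ?thesis by (auto intro: sets.sets_Collect_finite_All)
    next
      case False
      then have "{\<sigma> \<in> space (shift_distr d D). \<tau> \<sigma> = T} = {}" by (auto simp: \<tau>_def)
      then show ?thesis by (metis sets.empty_sets)
    qed
  next
    fix \<sigma> \<sigma>' assume eq: "\<tau> \<sigma> = \<tau> \<sigma>'" and Q: "Q (quadsketch L \<Lambda> (shift_list d \<sigma>) X)"
    have "build L s (cs \<sigma>) (number 0 X) = build L s (cs \<sigma>') (number 0 X)"
    proof (rule build_cong)
      show "\<forall>q\<in>set (number 0 X). length (snd q) = length (cs \<sigma>) \<and>
          cell_path L s (cs \<sigma>) (snd q) = cell_path L s (cs \<sigma>') (snd q)"
      proof
        fix q assume "q \<in> set (number 0 X)"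
        then have "snd q \<in> set X" by (auto simp: number_eq in_set_enumerate_eq dest: nth_mem)
        then show "length (snd q) = length (cs \<sigma>) \<and>
          cell_path L s (cs \<sigma>) (snd q) = cell_path L s (cs \<sigma>') (snd q)"
          using eq X unfolding \<tau>_def map_eq_conv by (auto simp: cs_def)
      qed
    qed (simp add: cs_def)
    moreover have "cs \<sigma> = cube_corner (pow2 (log_radius X)) x (shift_list d \<sigma>)" for \<sigma>
      unfolding cs_def using X Cons by (intro cube_corner_shift_list[symmetric]) auto
    ultimately have "sketch_tree L \<Lambda> (shift_list d \<sigma>) X = sketch_tree L \<Lambda> (shift_list d \<sigma>') X"
      unfolding Cons sketch_tree.simps s_def Let_def by simp
    then have "quadsketch L \<Lambda> (shift_list d \<sigma>) X = quadsketch L \<Lambda> (shift_list d \<sigma>') X" by simp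
    then show "Q (quadsketch L \<Lambda> (shift_list d \<sigma>') X)" using Q by simp
  qed
qed simp

subsection \<open>The random shift\<close>

text \<open>At most \<open>2 ^ m + 2 * \<eta> + 1\<close> grid points matter for the interval, hence
  at most \<open>3 * 2 ^ m\<close>. Each has a neighbourhood of length
  \<open>2 * \<eta> * h\<close>, which together is \<open>6 * \<eta>\<close> times the interval
  length \<open>2 * D\<close>.\<close>

lemma measure_near_grid_le:
  fixes a D h \<eta> :: real
  assumes h: "0 < h" and D: "2 * D = 2 ^ m * h" and \<eta>: "0 < \<eta>" "\<eta> \<le> 1 / 2"
  shows "measure (uniform_measure lborel {-D..D}) {t. \<exists>z::int. \<bar>a - t - of_int z * h\<bar> < \<eta> * h} \<le> 6 * \<eta>"
proof -
  define B where "B = {t. \<exists>z::int. \<bar>a - t - of_int z * h\<bar> < \<eta> * h}"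
  define Z where "Z = {\<lceil>(a - D) / h - \<eta>\<rceil>..\<lfloor>(a + D) / h + \<eta>\<rfloor>}"
  have D0: "0 < D" using h D by (metis mult_pos_pos zero_less_mult_pos zero_less_numeral zero_less_power)
  have Bm: "B \<in> sets borel" unfolding B_def by measurable
  have cover: "{-D..D} \<inter> B \<subseteq> (\<Union>z\<in>Z. {a - of_int z * h - \<eta> * h..a - of_int z * h + \<eta> * h})"
  proof
    fix t assume t: "t \<in> {-D..D} \<inter> B"
    then obtain z :: int where z: "\<bar>a - t - of_int z * h\<bar> < \<eta> * h" by (auto simp: B_def)
    have "(a - D) / h - \<eta> \<le> of_int z" "of_int z \<le> (a + D) / h + \<eta>"
      using t z h by (auto simp: field_simps abs_less_iff)
    then have "z \<in> Z" by (auto simp: Z_def ceiling_le_iff le_floor_iff)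
    then show "t \<in> (\<Union>z\<in>Z. {a - of_int z * h - \<eta> * h..a - of_int z * h + \<eta> * h})"
      using z by (intro UN_I[of z]) auto
  qed
  have "real (card Z) \<le> 2 * D / h + 2 * \<eta> + 1"
  proof -
    have "of_int (\<lfloor>(a + D) / h + \<eta>\<rfloor> - \<lceil>(a - D) / h - \<eta>\<rceil> + 1) \<le> ((a + D) / h + \<eta>) - ((a - D) / h - \<eta>) + 1"
      by linarith
    also have "\<dots> = 2 * D / h + 2 * \<eta> + 1" by (simp add: add_divide_distrib diff_divide_distrib)
    finally have *: "of_int (\<lfloor>(a + D) / h + \<eta>\<rfloor> - \<lceil>(a - D) / h - \<eta>\<rceil> + 1) \<le> 2 * D / h + 2 * \<eta> + 1" .
    have "0 \<le> 2 * D / h + 2 * \<eta> + 1" using D0 h \<eta> by auto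
    then show ?thesis using * unfolding Z_def by (simp add: of_nat_nat)
  qed
  also have "2 * D / h = 2 ^ m" using D h by simp
  also have "2 ^ m + 2 * \<eta> + 1 \<le> 3 * (2 ^ m :: real)"
    using \<eta> one_le_power[of "2::real" m] by linarith
  finally have card: "real (card Z) \<le> 3 * 2 ^ m" .
  have "measure lborel ({-D..D} \<inter> B) \<le> measure lborel (\<Union>z\<in>Z. {a - of_int z * h - \<eta> * h..a - of_int z * h + \<eta> * h})"
  proof (rule measure_mono_fmeasurable[OF cover])
    show "{-D..D} \<inter> B \<in> sets lborel" using Bm by auto
    show "(\<Union>z\<in>Z. {a - of_int z * h - \<eta> * h..a - of_int z * h + \<eta> * h}) \<in> fmeasurable lborel"
      by (intro fmeasurable.finite_UN) (auto simp: Z_def fmeasurable_def ennreal_less_top emeasure_lborel_Icc_eq)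
  qed
  also have "\<dots> \<le> (\<Sum>z\<in>Z. measure lborel {a - of_int z * h - \<eta> * h..a - of_int z * h + \<eta> * h})"
    by (rule measure_UNION_le) (auto simp: Z_def)
  also have "\<dots> = real (card Z) * (2 * \<eta> * h)" using \<eta> h by simp
  also have "\<dots> \<le> (3 * 2 ^ m) * (2 * \<eta> * h)" using card \<eta> h by (intro mult_right_mono) auto
  also have "\<dots> = 6 * \<eta> * (2 * D)" unfolding D by simp
  finally have "measure lborel ({-D..D} \<inter> B) / (2 * D) \<le> 6 * \<eta>" using D0 by (simp add: field_simps)
  moreover have "measure (uniform_measure lborel {-D..D}) B = measure lborel ({-D..D} \<inter> B) / measure lborel {-D..D}"
    using D0 Bm by (intro measure_uniform_measure) auto
  ultimately show ?thesis unfolding B_def[symmetric] using D0 by simp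
qed

lemma prob_space_uniform_interval: "D > 0 \<Longrightarrow> prob_space (uniform_measure lborel {-D..D::real})"
  by (rule prob_space_uniform_measure) auto

lemma measure_shift_distr_component:
  assumes "D > 0" "k < d" "B \<in> sets borel"
  shows "{\<sigma> \<in> space (shift_distr d D). \<sigma> k \<in> B} \<in> sets (shift_distr d D)"
    and "measure (shift_distr d D) {\<sigma> \<in> space (shift_distr d D). \<sigma> k \<in> B} = measure (uniform_measure lborel {-D..D}) B"
proof -
  have m: "(\<lambda>\<sigma>. \<sigma> k) \<in> measurable (shift_distr d D) (uniform_measure lborel {-D..D})"
    unfolding shift_distr_def using assms by (intro measurable_component_singleton) auto
  have "measure (uniform_measure lborel {-D..D}) B =
     measure (distr (shift_distr d D) (uniform_measure lborel {-D..D}) (\<lambda>\<sigma>. \<sigma> k)) B"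
    unfolding shift_distr_def using assms prob_space_uniform_interval
    by (subst distr_PiM_component) auto
  also have "\<dots> = measure (shift_distr d D) ((\<lambda>\<sigma>. \<sigma> k) -` B \<inter> space (shift_distr d D))"
    using assms(3) by (intro measure_distr[OF m]) auto
  also have "(\<lambda>\<sigma>. \<sigma> k) -` B \<inter> space (shift_distr d D) = {\<sigma> \<in> space (shift_distr d D). \<sigma> k \<in> B}" by auto
  finally show "measure (shift_distr d D) {\<sigma> \<in> space (shift_distr d D). \<sigma> k \<in> B} = measure (uniform_measure lborel {-D..D}) B" by simp
  have "(\<lambda>\<sigma>. \<sigma> k) -` B \<inter> space (shift_distr d D) \<in> sets (shift_distr d D)"
    by (rule measurable_sets[OF m]) (use assms(3) in auto)
  then show "{\<sigma> \<in> space (shift_distr d D). \<sigma> k \<in> B} \<in> sets (shift_distr d D)"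
    by (simp add: vimage_def Int_def conj_commute)
qed

lemma prob_space_shift_distr: "D > 0 \<Longrightarrow> prob_space (shift_distr d D)"
  unfolding shift_distr_def by (intro prob_space_PiM prob_space_uniform_interval)

lemma AE_shift_distr: "D > 0 \<Longrightarrow> AE \<sigma> in shift_distr d D. \<forall>k\<in>{..<d}. \<sigma> k \<in> {-D..D}"
proof (rule AE_finite_allI)
  fix k assume "D > 0" "k \<in> {..<d}"
  then show "AE \<sigma> in shift_distr d D. \<sigma> k \<in> {-D..D}"
    unfolding shift_distr_def
    by (intro AE_PiM_component[where P = "\<lambda>t. t \<in> {-D..D}"] prob_space_uniform_interval AE_uniform_measureI) auto
qed simp

text \<open>Union bound over all pairs of a level and a coordinate. The event \<open>E\<close> is
  abstract so that one bound serves both guarantees of the theorem.\<close>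

lemma prob_padded:
  assumes D: "D > 0" and \<eta>: "0 < \<eta>" "\<eta> \<le> 1 / 2"
    and E: "E \<in> sets (shift_distr d D)"
    and sub: "\<And>\<sigma>. \<sigma> \<in> space (shift_distr d D) \<Longrightarrow> (\<And>k. k < d \<Longrightarrow> \<sigma> k \<in> {-D..D}) \<Longrightarrow>
      (\<And>m k (z::int). m < L \<Longrightarrow> k < d \<Longrightarrow>
         \<bar>a k - \<sigma> k - of_int z * (4 * D / 2 ^ Suc m)\<bar> \<ge> \<eta> * (4 * D / 2 ^ Suc m)) \<Longrightarrow> \<sigma> \<in> E"
  shows "measure (shift_distr d D) E \<ge> 1 - 6 * real L * real d * \<eta>"
proof -
  define M where "M = shift_distr d D"
  interpret prob_space M unfolding M_def by (rule prob_space_shift_distr[OF D])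
  define h where "h m = 4 * D / 2 ^ Suc m" for m :: nat
  define B where "B m k = {t. \<exists>z::int. \<bar>a k - t - of_int z * h m\<bar> < \<eta> * h m}" for m k
  define F where "F = (\<lambda>(m, k). {\<sigma> \<in> space M. \<sigma> k \<in> B m k})"
  define I where "I = {..<L} \<times> {..<d}"
  have B: "B m k \<in> sets borel" for m k unfolding B_def by measurable
  have F: "F i \<in> sets M" "measure M (F i) \<le> 6 * \<eta>" if iI: "i \<in> I" for i
  proof -
    obtain m k where i: "i = (m, k)" "k < d" using iI by (auto simp: I_def)
    show "F i \<in> sets M" unfolding F_def i M_def
      using measure_shift_distr_component(1)[OF D i(2) B] by simp
    have "measure M (F i) = measure (uniform_measure lborel {-D..D}) (B m k)"
      unfolding F_def i M_def using measure_shift_distr_component(2)[OF D i(2) B] by simp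
    \<comment> \<open>Below depth \<open>m\<close> the grid side is
      \<open>4 * D / 2 ^ Suc m\<close>, so the range of the shift has length exactly
      \<open>2 ^ m\<close> sides.\<close>
    also have "\<dots> \<le> 6 * \<eta>"
      unfolding B_def by (rule measure_near_grid_le[where m = m]) (use D \<eta> in \<open>auto simp: h_def\<close>)
    finally show "measure M (F i) \<le> 6 * \<eta>" .
  qed
  have "measure M (space M - E) \<le> measure M (\<Union>i\<in>I. F i)"
  \<comment> \<open>The product space contains all real vectors; the shift lies in the cube only
    almost surely.\<close>
  proof (rule finite_measure_mono_AE)
    show "(\<Union>i\<in>I. F i) \<in> sets M" using F by (intro sets.finite_UN) (auto simp: I_def)
    have "AE \<sigma> in M. \<forall>k\<in>{..<d}. \<sigma> k \<in> {-D..D}" unfolding M_def by (rule AE_shift_distr[OF D])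
    then show "AE \<sigma> in M. \<sigma> \<in> space M - E \<longrightarrow> \<sigma> \<in> (\<Union>i\<in>I. F i)"
    proof (rule AE_mp, intro AE_I2 impI)
      fix \<sigma> assume \<sigma>: "\<sigma> \<in> space M" "\<forall>k\<in>{..<d}. \<sigma> k \<in> {-D..D}" "\<sigma> \<in> space M - E"
      show "\<sigma> \<in> (\<Union>i\<in>I. F i)"
      proof (rule ccontr)
        assume no: "\<sigma> \<notin> (\<Union>i\<in>I. F i)"
        have "\<bar>a k - \<sigma> k - of_int z * h m\<bar> \<ge> \<eta> * h m" if "m < L" "k < d" for m k and z :: int
        proof -
          have "\<sigma> \<notin> F (m, k)" using no that by (auto simp: I_def)
          then show ?thesis using \<sigma>(1) by (force simp: F_def B_def not_less)
        qed
        then have "\<sigma> \<in> E" using \<sigma> unfolding h_def M_def by (intro sub) auto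
        then show False using \<sigma>(3) by simp
      qed
    qed
  qed
  also have "\<dots> \<le> (\<Sum>i\<in>I. measure M (F i))"
    using F by (intro measure_UNION_le) (auto simp: I_def)
  also have "\<dots> \<le> (\<Sum>i\<in>I. 6 * \<eta>)" using F by (intro sum_mono) auto
  also have "\<dots> = 6 * real L * real d * \<eta>" by (simp add: I_def)
  finally have "1 - measure M E \<le> 6 * real L * real d * \<eta>"
    using prob_compl[of E] E unfolding M_def by simp
  then show ?thesis unfolding M_def by simp
qed

subsection \<open>Scale and distances\<close>

lemma sqrt_sq_dist:
  "length x = d \<Longrightarrow> length y = d \<Longrightarrow> sqrt (sq_dist x y) = eucl_dist d x y"
proof -
  have "sq_dist x y = (\<Sum>k<length x. (x ! k - y ! k)\<^sup>2)" if "length x = length y"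
    using that
    by (induction x y rule: list_induct2)
       (auto simp: sum.lessThan_Suc_shift power2_eq_square simp del: sum.lessThan_Suc)
  then show "length x = d \<Longrightarrow> length y = d \<Longrightarrow> ?thesis"
    by (simp add: eucl_dist_def L2_set_def)
qed

lemma max_dist_ge:
  assumes "length x = d" "\<forall>y\<in>set ys. length y = d" "y \<in> set ys"
  shows "eucl_dist d x y \<le> max_dist x ys"
  using assms by (induction ys) (auto simp: sqrt_sq_dist max_def)

lemma max_dist_attained:
  assumes "length x = d" "\<forall>y\<in>set ys. length y = d" "max_dist x ys > 0"
  shows "\<exists>y\<in>set ys. max_dist x ys = eucl_dist d x y"
  using assms by (induction ys) (auto simp: sqrt_sq_dist max_def)

lemma eucl_dist_pos:
  assumes "length x = d" "length y = d" "x \<noteq> y"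
  shows "eucl_dist d x y > 0"
proof -
  obtain k where "k < d" "x ! k \<noteq> y ! k" using assms by (auto simp: list_eq_iff_nth_eq)
  then show ?thesis using abs_diff_le_eucl_dist[of k d x y] by simp
qed

lemma eucl_dist_commute: "eucl_dist d x y = eucl_dist d y x"
  unfolding eucl_dist_def L2_set_def by (simp add: power2_commute)

lemma eucl_dist_refl [simp]: "eucl_dist d x x = 0"
  by (simp add: eucl_dist_def L2_set_def)

locale pointset =
  fixes d :: nat and X :: "real list list"
  assumes two_points: "length X \<ge> 2" and distinct_points: "distinct X"
    and dim: "\<forall>x\<in>set X. length x = d"
begin

definition "radius = pow2 (log_radius X)"

definition "min_dist = Min (pair_dists d X)"

lemma nontrivial [simp]: "X \<noteq> []" "Suc 0 < length X"
  using two_points by auto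

lemma length_point [simp]: "i < length X \<Longrightarrow> length (X ! i) = d"
  using dim by simp

lemma dist_pos: "i < length X \<Longrightarrow> j < length X \<Longrightarrow> i \<noteq> j \<Longrightarrow> eucl_dist d (X ! i) (X ! j) > 0"
  using distinct_points by (intro eucl_dist_pos) (auto simp: nth_eq_iff_index_eq)

lemma d_pos: "d \<ge> 1"
proof (rule ccontr)
  assume "\<not> d \<ge> 1"
  then have "d = 0" by simp
  then have "X ! 0 = X ! 1" using length_point[of 0] length_point[of 1] by (simp del: length_point)
  then show False using distinct_points two_points nth_eq_iff_index_eq[of X 0 1] by auto
qed

lemma finite_pair_dists: "finite (pair_dists d X)"
proof -
  have "pair_dists d X \<subseteq> (\<lambda>(i, j). eucl_dist d (X ! i) (X ! j)) ` ({..<length X} \<times> {..<length X})"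
    unfolding pair_dists_def by force
  then show ?thesis by (rule finite_subset) auto
qed

lemma dist_in_pair_dists:
  assumes "i < length X" "j < length X" "i \<noteq> j"
  shows "eucl_dist d (X ! i) (X ! j) \<in> pair_dists d X"
proof (cases "i < j")
  case False
  then have "j < i" using assms(3) by simp
  then show ?thesis using assms(1) eucl_dist_commute[of d "X ! i" "X ! j"] unfolding pair_dists_def by blast
qed (use assms(2) in \<open>auto simp: pair_dists_def\<close>)

lemma min_dist_le: "i < length X \<Longrightarrow> j < length X \<Longrightarrow> i \<noteq> j \<Longrightarrow> min_dist \<le> eucl_dist d (X ! i) (X ! j)"
  unfolding min_dist_def using finite_pair_dists dist_in_pair_dists by (intro Min_le)

lemma dist_le_Max: "i < length X \<Longrightarrow> j < length X \<Longrightarrow> i \<noteq> j \<Longrightarrow> eucl_dist d (X ! i) (X ! j) \<le> Max (pair_dists d X)"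
  using finite_pair_dists dist_in_pair_dists by (intro Max_ge)

lemma pair_dists_nonempty: "pair_dists d X \<noteq> {}"
  using dist_in_pair_dists[of 0 1] two_points by auto

lemma min_dist_pos: "min_dist > 0"
proof -
  have "\<forall>r\<in>pair_dists d X. r > 0" unfolding pair_dists_def using dist_pos by force
  then show ?thesis unfolding min_dist_def using Min_in[OF finite_pair_dists pair_dists_nonempty] by blast
qed

lemma aspect_ratio_ge_1: "aspect_ratio d X \<ge> 1"
proof -
  have "min_dist \<le> Max (pair_dists d X)"
    using min_dist_le[of 0 1] dist_le_Max[of 0 1] two_points by simp
  then show ?thesis using min_dist_pos unfolding aspect_ratio_def min_dist_def by (simp add: field_simps)
qed

lemma X_eq: "X = X ! 0 # tl X"
  using two_points by (cases X) auto

lemma max_dist_pos: "max_dist (X ! 0) (tl X) > 0"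
proof -
  have "X ! 1 \<in> set (tl X)" using nth_mem[of 0 "tl X"] nth_tl[of 0 X] two_points by simp
  moreover have "length (X ! 0) = d" using two_points by (intro length_point) auto
  moreover have "\<forall>y\<in>set (tl X). length y = d" using dim X_eq by (metis list.set_intros(2))
  ultimately have "eucl_dist d (X ! 0) (X ! 1) \<le> max_dist (X ! 0) (tl X)"
    by (intro max_dist_ge) auto
  then show ?thesis using dist_pos[of 0 1] two_points by simp
qed

lemma radius_eq: "radius = 2 powr \<lceil>log 2 (max_dist (X ! 0) (tl X))\<rceil>"
  unfolding radius_def pow2_def by (subst X_eq) (simp add: ceil_log_def powr_real_of_int')

lemma radius_pos: "radius > 0"
  unfolding radius_eq by simp

lemma max_dist_le_radius: "max_dist (X ! 0) (tl X) \<le> radius"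
proof -
  have "max_dist (X ! 0) (tl X) = 2 powr (log 2 (max_dist (X ! 0) (tl X)))" using max_dist_pos by simp
  also have "\<dots> \<le> radius" unfolding radius_eq by (intro powr_mono) auto
  finally show ?thesis .
qed

lemma radius_less: "radius < 2 * max_dist (X ! 0) (tl X)"
proof -
  have "radius < 2 powr (log 2 (max_dist (X ! 0) (tl X)) + 1)"
    unfolding radius_eq by (intro powr_less_mono) (auto, linarith)
  then show ?thesis using max_dist_pos by (simp add: powr_add)
qed

lemma dist_le_radius: "i < length X \<Longrightarrow> eucl_dist d (X ! 0) (X ! i) \<le> radius"
proof (cases "i = 0")
  case False
  assume i: "i < length X"
  have "X ! i \<in> set (tl X)" using i False by (cases X) (auto simp: nth_Cons')
  moreover have "\<forall>y\<in>set (tl X). length y = d" using dim X_eq by (metis list.set_intros(2))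
  moreover have "length (X ! 0) = d" using two_points by (intro length_point) auto
  ultimately have "eucl_dist d (X ! 0) (X ! i) \<le> max_dist (X ! 0) (tl X)" by (intro max_dist_ge) auto
  then show ?thesis using max_dist_le_radius by simp
qed (use radius_pos in auto)

text \<open>Rounding the largest distance from the first point up to a power of two less than
  doubles it. This witness bounds the radius by a pair distance, and it shows that a cell holding
  all points cannot be small.\<close>

lemma far_point: "\<exists>i<length X. i \<noteq> 0 \<and> radius < 2 * eucl_dist d (X ! 0) (X ! i)"
proof -
  have "\<forall>y\<in>set (tl X). length y = d" using dim X_eq by (metis list.set_intros(2))
  moreover have "length (X ! 0) = d" using two_points by (intro length_point) auto
  ultimately obtain y where y: "y \<in> set (tl X)" "max_dist (X ! 0) (tl X) = eucl_dist d (X ! 0) y"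
    using max_dist_attained max_dist_pos by blast
  then obtain j where "j < length (tl X)" "tl X ! j = y" by (auto simp: in_set_conv_nth)
  then have "Suc j < length X" "X ! Suc j = y" using nth_tl[of j X] by auto
  then show ?thesis using y(2) radius_less by (intro exI[of _ "Suc j"]) auto
qed

lemma radius_le_Max: "radius \<le> 2 * Max (pair_dists d X)"
proof -
  obtain i where "i < length X" "i \<noteq> 0" "radius < 2 * eucl_dist d (X ! 0) (X ! i)" using far_point by blast
  then show ?thesis using dist_le_Max[of 0 i] by auto
qed

text \<open>The root side \<open>4 * radius\<close> is at most 8 times the largest distance, which
  is the aspect ratio times \<open>min_dist\<close>; the levels beyond \<Lambda> divide the aspect
  ratio out.\<close>

lemma leaf_side_le:
  assumes L: "L = nat \<lceil>log 2 (aspect_ratio d X)\<rceil> + \<Lambda>"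
  shows "4 * radius / 2 ^ L \<le> 8 * min_dist / 2 ^ \<Lambda>"
proof -
  have "aspect_ratio d X = 2 powr log 2 (aspect_ratio d X)" using aspect_ratio_ge_1 by simp
  also have "\<dots> \<le> 2 powr real (nat \<lceil>log 2 (aspect_ratio d X)\<rceil>)" by (intro powr_mono) linarith+
  also have "\<dots> = 2 ^ nat \<lceil>log 2 (aspect_ratio d X)\<rceil>" by (simp add: powr_realpow)
  finally have *: "aspect_ratio d X * 2 ^ \<Lambda> \<le> 2 ^ L" unfolding L power_add by (intro mult_right_mono) auto
  have M: "Max (pair_dists d X) = aspect_ratio d X * min_dist"
    using min_dist_pos unfolding aspect_ratio_def min_dist_def by simp
  have "4 * radius * 2 ^ \<Lambda> \<le> 8 * (aspect_ratio d X * min_dist) * 2 ^ \<Lambda>"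
    using radius_le_Max unfolding M by (intro mult_right_mono) auto
  also have "\<dots> = 8 * min_dist * (aspect_ratio d X * 2 ^ \<Lambda>)" by simp
  also have "\<dots> \<le> 8 * min_dist * 2 ^ L" using * min_dist_pos by (intro mult_left_mono) auto
  finally show ?thesis by (simp add: field_simps)
qed

section \<open>The decoded points and their distortion\<close>

definition corner :: "(nat \<Rightarrow> real) \<Rightarrow> real list" where
  "corner \<sigma> = map (\<lambda>k. X ! 0 ! k + \<sigma> k - 2 * radius) [0..<d]"

lemma length_corner [simp]: "length (corner \<sigma>) = d"
  by (simp add: corner_def)

text \<open>The cube reaches \<open>2 * radius\<close> from its centre in each coordinate: one
  radius is for the spread of the points around the first one, the other for the shift.\<close>

lemma in_root_cell:
  assumes "i < length X" "k < d" "\<sigma> k \<in> {-radius..radius}"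
  shows "corner \<sigma> ! k \<le> X ! i ! k" "X ! i ! k \<le> corner \<sigma> ! k + 4 * radius"
proof -
  have "\<bar>X ! 0 ! k - X ! i ! k\<bar> \<le> radius"
    using abs_diff_le_eucl_dist[OF assms(2), of "X ! 0" "X ! i"] dist_le_radius[OF assms(1)] by linarith
  then show "corner \<sigma> ! k \<le> X ! i ! k" "X ! i ! k \<le> corner \<sigma> ! k + 4 * radius"
    using assms(2,3) by (auto simp: corner_def abs_le_iff)
qed

definition full_tree :: "nat \<Rightarrow> (nat \<Rightarrow> real) \<Rightarrow> bool list qtree" where
  "full_tree L \<sigma> = build L (4 * radius) (corner \<sigma>) (number 0 X)"

lemma sketch_tree_eq: "sketch_tree L \<Lambda> (shift_list d \<sigma>) X = prune_root \<Lambda> (full_tree L \<sigma>)"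
proof -
  have "cube_corner radius (X ! 0) (shift_list d \<sigma>) = corner \<sigma>"
    unfolding corner_def using two_points by (intro cube_corner_shift_list) auto
  then show ?thesis
    using sketch_tree.simps(2)[of L \<Lambda> "shift_list d \<sigma>" "X ! 0" "tl X"]
    unfolding X_eq[symmetric] radius_def[symmetric] Let_def full_tree_def by simp
qed

lemma leaves_full_tree:
  shows "\<And>P js. (P, js) \<in> set (leaves (full_tree L \<sigma>)) \<Longrightarrow>
      js = map fst (filter (\<lambda>q. cell_path L (4 * radius) (corner \<sigma>) (snd q) = P) (number 0 X))"
    and "distinct (map fst (leaves (full_tree L \<sigma>)))"
    and "fst ` set (leaves (full_tree L \<sigma>)) = (\<lambda>q. cell_path L (4 * radius) (corner \<sigma>) (snd q)) ` set (number 0 X)"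
    and "grid_tree d L (full_tree L \<sigma>)"
proof -
  have *: "\<forall>q\<in>set (number 0 X). length (snd q) = length (corner \<sigma>)"
    using dim by (auto simp: number_eq in_set_enumerate_eq)
  have "number 0 X \<noteq> []" by (subst X_eq) simp
  then show "\<And>P js. (P, js) \<in> set (leaves (full_tree L \<sigma>)) \<Longrightarrow>
      js = map fst (filter (\<lambda>q. cell_path L (4 * radius) (corner \<sigma>) (snd q) = P) (number 0 X))"
    "distinct (map fst (leaves (full_tree L \<sigma>)))"
    "fst ` set (leaves (full_tree L \<sigma>)) = (\<lambda>q. cell_path L (4 * radius) (corner \<sigma>) (snd q)) ` set (number 0 X)"
    "grid_tree d L (full_tree L \<sigma>)"
    using leaves_build[OF *, of L "4 * radius"] unfolding full_tree_def length_corner by auto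
qed

text \<open>A number in two classes would come from a single element of \<open>ps\<close>, whose
  value under \<open>f\<close> would be two different class labels.\<close>

lemma distinct_concat_classes:
  assumes "\<forall>(P, js)\<in>set ls. js = map fst (filter (\<lambda>q. f q = P) ps)"
    and "distinct (map fst ls)" "distinct (map fst ps)"
  shows "distinct (concat (map snd ls))"
  using assms(1,2)
proof (induction ls)
  case (Cons l ls)
  have "distinct (snd l)"
    using Cons.prems assms(3) distinct_map_filter by (cases l) auto
  moreover have "set (snd l) \<inter> (\<Union>x\<in>set ls. set (snd x)) = {}"
  proof (rule ccontr)
    assume "set (snd l) \<inter> (\<Union>x\<in>set ls. set (snd x)) \<noteq> {}"
    then obtain i l' where i: "i \<in> set (snd l)" "l' \<in> set ls" "i \<in> set (snd l')" by auto
    obtain q where q: "q \<in> set ps" "f q = fst l" "fst q = i" using Cons.prems(1) i(1) by (cases l) auto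
    obtain q' where q': "q' \<in> set ps" "f q' = fst l'" "fst q' = i"
      using Cons.prems(1) i(2,3) by (cases l') fastforce
    have "q = q'" using q(1,3) q'(1,3) assms(3) by (metis eq_key_imp_eq_value prod.collapse)
    then have "fst l \<in> fst ` set ls" using q(2) q'(2) i(2) by (metis image_eqI)
    then show False using Cons.prems(2) by simp
  qed
  ultimately show ?case using Cons by auto
qed simp

lemma leaf_numbers:
  shows "distinct (concat (map snd (leaves (full_tree L \<sigma>))))"
    and "set (concat (map snd (leaves (full_tree L \<sigma>)))) = {..<length X}"
proof -
  note lv = leaves_full_tree[where L = L and \<sigma> = \<sigma>]
  show "distinct (concat (map snd (leaves (full_tree L \<sigma>))))"
    by (rule distinct_concat_classes[where ps = "number 0 X"]) (use lv in \<open>auto simp: number_eq\<close>)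
  have "set (concat (map snd (leaves (full_tree L \<sigma>)))) = fst ` set (number 0 X)"
  proof
    show "set (concat (map snd (leaves (full_tree L \<sigma>)))) \<subseteq> fst ` set (number 0 X)"
      using lv(1) by fastforce
    show "fst ` set (number 0 X) \<subseteq> set (concat (map snd (leaves (full_tree L \<sigma>))))"
    proof
      fix i assume "i \<in> fst ` set (number 0 X)"
      then obtain q where q: "q \<in> set (number 0 X)" "i = fst q" by auto
      then have "cell_path L (4 * radius) (corner \<sigma>) (snd q) \<in> fst ` set (leaves (full_tree L \<sigma>))"
        using lv(3) by auto
      then obtain js where js: "(cell_path L (4 * radius) (corner \<sigma>) (snd q), js) \<in> set (leaves (full_tree L \<sigma>))"
        by auto
      then have "i \<in> set js" using lv(1)[OF js] q by auto
      then show "i \<in> set (concat (map snd (leaves (full_tree L \<sigma>))))" using js by force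
    qed
  qed
  also have "\<dots> = {..<length X}" by (simp add: number_eq atLeast0LessThan flip: set_map)
  finally show "set (concat (map snd (leaves (full_tree L \<sigma>)))) = {..<length X}" .
qed

definition decoded :: "nat \<Rightarrow> nat \<Rightarrow> (nat \<Rightarrow> real) \<Rightarrow> real list list" where
  "decoded L \<Lambda> \<sigma> = decompress (length X) d L (log_radius X + 2) (quadsketch L \<Lambda> (shift_list d \<sigma>) X)"

lemma snd_leaves_prune_root: "map snd (leaves (prune_root \<Lambda> t)) = map snd (leaves t)"
  by (simp add: leaves_prune_root leaves_eq_root_leaves[of t \<Lambda>] o_def case_prod_unfold del: prune_root.simps)

text \<open>The leaf found by the decoder contains \<open>i\<close>, and by
  \<open>leaves_full_tree\<close> a leaf containing \<open>i\<close> has the cell path of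
  \<open>X ! i\<close> as its labels before pruning.\<close>

lemma decoded_nth:
  assumes i: "i < length X"
  shows "\<exists>P E js. (P, E, js) \<in> set (root_leaves \<Lambda> (full_tree L \<sigma>)) \<and>
    P = cell_path L (4 * radius) (corner \<sigma>) (X ! i) \<and>
    (\<forall>k<d. decoded L \<Lambda> \<sigma> ! i ! k = path_value (4 * radius) (expand_path d E) k)"
proof -
  note lv = leaves_full_tree[where L = L and \<sigma> = \<sigma>]
  have "full (edge_fits d (width L)) (prune_root \<Lambda> (full_tree L \<sigma>))"
    using full_prune_root lv(4) less_two_power_width by blast
  then obtain E js where E: "(E, js) \<in> set (leaves (prune_root \<Lambda> (full_tree L \<sigma>)))" "i \<in> set js"
    "decoded L \<Lambda> \<sigma> ! i = node_point d (log_radius X + 2) E"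
    using decompress_quadsketch_nth[of d L \<Lambda> "shift_list d \<sigma>" X i "log_radius X + 2"] i leaf_numbers[of L \<sigma>]
    unfolding sketch_tree_eq snd_leaves_prune_root decoded_def by fastforce
  then obtain P where P: "(P, E, js) \<in> set (root_leaves \<Lambda> (full_tree L \<sigma>))"
    unfolding leaves_prune_root by auto
  then have Pjs: "(P, js) \<in> set (leaves (full_tree L \<sigma>))"
    unfolding leaves_eq_root_leaves[of _ \<Lambda>] by force
  have "P = cell_path L (4 * radius) (corner \<sigma>) (X ! i)"
    using lv(1)[OF Pjs] E(2) by (auto simp: number_eq in_set_enumerate_eq)
  \<comment> \<open>The decoder's root level is two above \<open>log_radius X\<close> because the
    root cell has side \<open>4 * radius\<close>.\<close>
  moreover have "(2::real) powi (log_radius X + 2) = 4 * radius"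
    by (simp add: radius_def pow2_def power_int_add)
  ultimately show ?thesis using P E(3) node_point_nth by metis
qed

text \<open>The padding hypothesis of \<open>distortion\<close> reappears as a condition on
  \<open>\<sigma> k\<close> relative to a fixed number, the form controlled by
  \<open>prob_padded\<close>.\<close>

lemma decoded_distortion:
  fixes \<eta> \<epsilon> :: real
  assumes L: "L = nat \<lceil>log 2 (aspect_ratio d X)\<rceil> + \<Lambda>" and i: "i < length X" and j: "j < length X"
    and \<sigma>: "\<And>k. k < d \<Longrightarrow> \<sigma> k \<in> {-radius..radius}"
    and \<eta>: "0 < \<eta>" "\<eta> \<le> 1" and \<epsilon>: "0 \<le> \<epsilon>"
    and \<Lambda>: "8 * real d < 2 ^ \<Lambda>" and bound: "10 * real d \<le> \<epsilon> * \<eta> * 2 ^ \<Lambda>"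
    and padded: "\<And>m k (z::int). m < L \<Longrightarrow> k < d \<Longrightarrow>
       \<bar>(X ! i ! k - X ! 0 ! k + 2 * radius) - \<sigma> k - of_int z * (4 * radius / 2 ^ Suc m)\<bar> \<ge> \<eta> * (4 * radius / 2 ^ Suc m)"
  shows "\<bar>eucl_dist d (X ! i) (X ! j) - eucl_dist d (decoded L \<Lambda> \<sigma> ! i) (decoded L \<Lambda> \<sigma> ! j)\<bar>
     \<le> \<epsilon> * eucl_dist d (X ! i) (X ! j)"
proof (cases "i = j")
  case False
  obtain P E js where P: "(P, E, js) \<in> set (root_leaves \<Lambda> (full_tree L \<sigma>))"
    "P = cell_path L (4 * radius) (corner \<sigma>) (X ! i)"
    "\<forall>k<d. decoded L \<Lambda> \<sigma> ! i ! k = path_value (4 * radius) (expand_path d E) k"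
    using decoded_nth[OF i] by blast
  obtain P' E' js' where P': "(P', E', js') \<in> set (root_leaves \<Lambda> (full_tree L \<sigma>))"
    "P' = cell_path L (4 * radius) (corner \<sigma>) (X ! j)"
    "\<forall>k<d. decoded L \<Lambda> \<sigma> ! j ! k = path_value (4 * radius) (expand_path d E') k"
    using decoded_nth[OF j] by blast
  show ?thesis
  proof (rule distortion[where cs = "corner \<sigma>" and s = "4 * radius" and L = L and \<eta> = \<eta> and \<Lambda> = \<Lambda> and
        Q = "expand_path d E" and Q' = "expand_path d E'"])
    show "4 * radius / 2 ^ L \<le> 8 * eucl_dist d (X ! i) (X ! j) / 2 ^ \<Lambda>"
      by (rule order_trans[OF leaf_side_le[OF L]], intro divide_right_mono mult_left_mono min_dist_le)
         (use False i j in auto)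
    show "agrees_until \<Lambda> (cell_path L (4 * radius) (corner \<sigma>) (X ! i)) (expand_path d E)
      (cell_path L (4 * radius) (corner \<sigma>) (X ! j)) (expand_path d E')"
      using agrees_until_root_leaves[OF leaves_full_tree(4) P(1) P'(1)] P(2) P'(2) by simp
    show "zeroed d 0 (cell_path L (4 * radius) (corner \<sigma>) (X ! i)) (expand_path d E)"
      "zeroed d 0 (cell_path L (4 * radius) (corner \<sigma>) (X ! j)) (expand_path d E')"
      using zeroed_root_leaves P(1,2) P'(1,2) by blast+
    show "eucl_dist d (X ! i) (X ! j) > 0" using False i j by (intro dist_pos)
    show "\<eta> * (4 * radius / 2 ^ Suc m) \<le> \<bar>X ! i ! k - (corner \<sigma> ! k + of_int z * (4 * radius / 2 ^ Suc m))\<bar>"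
      if "m < L" "k < d" for m k and z :: int
      using padded[OF that, of z] that by (simp add: corner_def algebra_simps)
  qed (use i j \<eta> d_pos \<Lambda> bound radius_pos in_root_cell \<sigma> P(3) P'(3) in auto)
qed simp

end

section \<open>Choice of the parameters and probability of the guarantees\<close>

lemma two_powr_ge: "2 powr x \<ge> x / (2 :: real)"
proof (cases "x \<le> 0")
  case True
  then have "x / 2 \<le> 0" by simp
  also have "0 \<le> 2 powr x" by simp
  finally show ?thesis .
next
  case False
  then have "x / 2 \<le> x * ln 2" using ln2_ge_two_thirds mult_left_mono[of "1 / 2" "ln 2" x] by simp
  also have "\<dots> \<le> exp (x * ln 2)" using exp_ge_add_one_self[of "x * ln 2"] by linarith
  finally show ?thesis by (simp add: powr_def)
qed

text \<open>The constant is \<open>240 * 3\<close>: the failure probability is at most \<open>240 * L * d\<^sup>2 / (\<epsilon> * 2\<^sup>\<Lambda>)\<close>, and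
  \<open>L\<close> is at most \<open>3 * max 1 (log \<Phi>) * \<Lambda>\<close>.\<close>

lemma two_power_ge_of_log_le:
  fixes Y :: real and \<Lambda> :: nat
  assumes Y: "Y \<ge> 2" and \<Lambda>: "real \<Lambda> \<ge> 64 * log 2 Y"
  shows "\<Lambda> \<ge> 64" and "720 * real \<Lambda> * Y\<^sup>2 \<le> 2 ^ \<Lambda>"
proof -
  have "log 2 Y \<ge> 1" using Y by (simp add: le_log_iff)
  then have "real \<Lambda> \<ge> 64" using \<Lambda> by linarith
  then show \<Lambda>64: "\<Lambda> \<ge> 64" by simp
  \<comment> \<open>\<open>2 ^ \<Lambda>\<close> is the product of four factors \<open>u\<close>:
    two of them exceed \<open>real \<Lambda>\<close>, one exceeds 720 and one exceeds the square of
    \<open>Y\<close>.\<close>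
  define u where "u = 2 powr (real \<Lambda> / 4)"
  have u: "u > 0" "real \<Lambda> / 8 \<le> u" unfolding u_def using two_powr_ge[of "real \<Lambda> / 4"] by auto
  have "(real \<Lambda> / 8)\<^sup>2 \<le> u\<^sup>2" using u by (intro power_mono) auto
  moreover have "64 * real \<Lambda> \<le> real \<Lambda> * real \<Lambda>" using \<Lambda>64 by (intro mult_right_mono) auto
  ultimately have 1: "real \<Lambda> \<le> u\<^sup>2" by (simp add: power2_eq_square)
  have "(2::real) powr 10 \<le> u" unfolding u_def using \<Lambda>64 by (intro powr_mono) auto
  then have 2: "720 \<le> u" by simp
  have "Y\<^sup>2 = 2 powr (2 * log 2 Y)"
    using Y by (simp add: powr_mult[symmetric] powr_powr[symmetric] mult.commute[of 2])
  also have "\<dots> \<le> u" unfolding u_def using \<Lambda> \<open>log 2 Y \<ge> 1\<close> by (intro powr_mono) auto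
  finally have 3: "Y\<^sup>2 \<le> u" .
  have "720 * real \<Lambda> * Y\<^sup>2 \<le> (u * u\<^sup>2) * u" using 1 2 3 u by (intro mult_mono) auto
  also have "\<dots> = u ^ 4" by (simp add: power2_eq_square power4_eq_xxxx)
  also have "\<dots> = 2 powr (4 * (real \<Lambda> / 4))" unfolding u_def by (simp add: powr_powr flip: powr_realpow)
  also have "\<dots> = 2 ^ \<Lambda>" by (simp add: powr_realpow)
  finally show "720 * real \<Lambda> * Y\<^sup>2 \<le> 2 ^ \<Lambda>" .
qed

context pointset
begin

text \<open>The aspect ratio may be 1, for instance with two points; the maximum keeps this factor
  from vanishing in the bounds on \<open>L\<close> and \<Lambda>.\<close>

definition "log_aspect = max 1 (log 2 (aspect_ratio d X))"

lemma num_levels_le: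
  assumes "L = nat \<lceil>log 2 (aspect_ratio d X)\<rceil> + \<Lambda>"
  shows "real L \<le> log_aspect + 1 + real \<Lambda>"
proof -
  have "log 2 (aspect_ratio d X) \<ge> 0" using aspect_ratio_ge_1 by simp
  then have "real (nat \<lceil>log 2 (aspect_ratio d X)\<rceil>) \<le> log 2 (aspect_ratio d X) + 1" by linarith
  then show ?thesis unfolding log_aspect_def assms by simp
qed

text \<open>Let \<open>Y\<close> be the argument of the logarithm. As \<epsilon> and \<delta> are at
  most 1, \<open>Y\<close> also dominates \<open>real d\<close>, so the two powers of
  \<open>d\<close> in the failure probability are covered by the square of \<open>Y\<close>.\<close>

lemma parameter_bounds:
  fixes \<epsilon> \<delta> :: real
  assumes \<epsilon>: "\<epsilon> > 0" "\<epsilon> \<le> 1" and \<delta>: "\<delta> > 0" "\<delta> \<le> 1"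
    and \<Lambda>: "real \<Lambda> \<ge> 64 * log 2 (2 + real d * log_aspect / (\<epsilon> * \<delta>))"
    and L: "L = nat \<lceil>log 2 (aspect_ratio d X)\<rceil> + \<Lambda>"
  shows "\<Lambda> \<ge> 64" and "real L \<le> 3 * (log_aspect * real \<Lambda>)"
    and "720 * real \<Lambda> * (real d * (real d * log_aspect / (\<epsilon> * \<delta>))) \<le> 2 ^ \<Lambda>"
proof -
  define m where "m = log_aspect"
  define Y where "Y = 2 + real d * m / (\<epsilon> * \<delta>)"
  have m: "m \<ge> 1" by (simp add: m_def log_aspect_def)
  have d: "real d \<ge> 1" using d_pos by simp
  have ed: "0 < \<epsilon> * \<delta>" "\<epsilon> * \<delta> \<le> 1" using \<epsilon> \<delta> by (auto simp: mult_le_one)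
  have t: "real d * m \<le> real d * m / (\<epsilon> * \<delta>)"
    using ed d m by (simp add: le_divide_eq mult_left_le)
  have "real d * 1 \<le> real d * m" using d m by (intro mult_left_mono) auto
  with t have dY: "real d \<le> Y" unfolding Y_def by linarith
  have Y2: "Y \<ge> 2" unfolding Y_def using d m ed by auto
  note LY = two_power_ge_of_log_le[OF Y2, of \<Lambda>, unfolded Y_def m_def, OF \<Lambda>, folded m_def, folded Y_def]
  show "\<Lambda> \<ge> 64" by (rule LY(1))
  then have \<Lambda>1: "real \<Lambda> \<ge> 64" by simp
  have "real d * (real d * m / (\<epsilon> * \<delta>)) \<le> Y * Y"
    using dY d m ed unfolding Y_def by (intro mult_mono) auto
  then show "720 * real \<Lambda> * (real d * (real d * log_aspect / (\<epsilon> * \<delta>))) \<le> 2 ^ \<Lambda>"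
    using LY(2) \<Lambda>1 unfolding m_def by (smt (verit, best) mult_left_mono power2_eq_square)
  have "m * 1 \<le> m * real \<Lambda>" "1 * 1 \<le> m * real \<Lambda>" "1 * real \<Lambda> \<le> m * real \<Lambda>"
    using m \<Lambda>1 by (intro mult_mono; simp)+
  then show "real L \<le> 3 * (log_aspect * real \<Lambda>)"
    using num_levels_le[OF L] unfolding m_def by simp
qed

text \<open>\<open>Q\<close> ranges over all consequences of relative error
  \<open>\<epsilon> / 4\<close>. Measurability of its event comes from
  \<open>sets_sketch_event\<close>, so nothing is required of \<open>Q\<close> itself.\<close>

lemma prob_decoded:
  fixes \<epsilon> \<delta> :: real
  assumes \<epsilon>: "\<epsilon> > 0" "\<epsilon> \<le> 1" and \<delta>: "\<delta> > 0" "\<delta> \<le> 1"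
    and \<Lambda>: "real \<Lambda> \<ge> 64 * log 2 (2 + real d * log_aspect / (\<epsilon> * \<delta>))"
    and L: "L = nat \<lceil>log 2 (aspect_ratio d X)\<rceil> + \<Lambda>" and i: "i < length X"
    and Q: "\<And>X'. (\<And>j. j < length X \<Longrightarrow> \<bar>eucl_dist d (X ! i) (X ! j) - eucl_dist d (X' ! i) (X' ! j)\<bar>
       \<le> \<epsilon> / 4 * eucl_dist d (X ! i) (X ! j)) \<Longrightarrow> Q X'"
  shows "measure (shift_distr d radius) {\<sigma> \<in> space (shift_distr d radius). Q (decoded L \<Lambda> \<sigma>)} \<ge> 1 - \<delta>"
proof -
  define m where "m = log_aspect"
  \<comment> \<open>The smallest padding that suffices for \<open>decoded_distortion\<close> with
    error \<open>\<epsilon> / 4\<close>: it gives equality in \<open>bound\<close> below.\<close>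
  define \<eta> where "\<eta> = 40 * real d / (\<epsilon> * 2 ^ \<Lambda>)"
  have m: "m \<ge> 1" by (simp add: m_def log_aspect_def)
  have d: "real d \<ge> 1" using d_pos by simp
  note bounds = parameter_bounds[OF \<epsilon> \<delta> \<Lambda> L, folded m_def]
  have \<Lambda>1: "real \<Lambda> \<ge> 64" using bounds(1) by simp
  have L1: "real L \<ge> 1" using \<Lambda>1 L by simp
  have fail: "6 * real L * real d * \<eta> \<le> \<delta>"
  proof -
    have "6 * real L * real d * \<eta> = real L * (240 * real d * real d / (\<epsilon> * 2 ^ \<Lambda>))"
      by (simp add: \<eta>_def)
    also have "\<dots> \<le> (3 * (m * real \<Lambda>)) * (240 * real d * real d / (\<epsilon> * 2 ^ \<Lambda>))"
      using bounds(2) \<epsilon> by (intro mult_right_mono) auto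
    also have "\<dots> = \<delta> * ((720 * real \<Lambda> * (real d * (real d * m / (\<epsilon> * \<delta>)))) / 2 ^ \<Lambda>)"
      using \<epsilon> \<delta> by (simp add: field_simps)
    also have "\<dots> \<le> \<delta> * 1" using \<delta> by (intro mult_left_mono divide_le_eq_1_pos[THEN iffD2] bounds(3)) auto
    finally show ?thesis by simp
  qed
  have \<eta>0: "\<eta> > 0" unfolding \<eta>_def using d \<epsilon> by simp
  \<comment> \<open>The upper bound on \<eta> is a by-product of the failure bound:
    \<open>6 * \<eta>\<close> times a factor that is at least 1 is at most \<delta>, hence at most
    1.\<close>
  have "\<eta> * 1 \<le> \<eta> * (real L * real d)"
    using \<eta>0 mult_mono[of 1 "real L" 1 "real d"] L1 d by (intro mult_left_mono) auto
  then have \<eta>1: "\<eta> \<le> 1 / 2" using fail \<delta> by (simp add: algebra_simps)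
  have "8 * real d < 40 * real d / \<epsilon>" using d \<epsilon> by (simp add: less_divide_eq)
  also have "\<dots> = \<eta> * 2 ^ \<Lambda>" by (simp add: \<eta>_def)
  also have "\<dots> \<le> 1 * 2 ^ \<Lambda>" using \<eta>1 by (intro mult_right_mono) auto
  finally have big: "8 * real d < 2 ^ \<Lambda>" by simp
  have bound: "10 * real d \<le> \<epsilon> / 4 * \<eta> * 2 ^ \<Lambda>" using \<epsilon> by (simp add: \<eta>_def)
  have "measure (shift_distr d radius) {\<sigma> \<in> space (shift_distr d radius). Q (decoded L \<Lambda> \<sigma>)} \<ge>
      1 - 6 * real L * real d * \<eta>"
  proof (rule prob_padded[OF radius_pos \<eta>0 \<eta>1, where a = "\<lambda>k. X ! i ! k - X ! 0 ! k + 2 * radius"])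
    show "{\<sigma> \<in> space (shift_distr d radius). Q (decoded L \<Lambda> \<sigma>)} \<in> sets (shift_distr d radius)"
      unfolding decoded_def by (rule sets_sketch_event[OF dim])
    fix \<sigma> assume "\<sigma> \<in> space (shift_distr d radius)"
      and "\<And>k. k < d \<Longrightarrow> \<sigma> k \<in> {-radius..radius}"
      and "\<And>m k (z::int). m < L \<Longrightarrow> k < d \<Longrightarrow>
         \<bar>(X ! i ! k - X ! 0 ! k + 2 * radius) - \<sigma> k - of_int z * (4 * radius / 2 ^ Suc m)\<bar> \<ge> \<eta> * (4 * radius / 2 ^ Suc m)"
    then show "\<sigma> \<in> {\<sigma> \<in> space (shift_distr d radius). Q (decoded L \<Lambda> \<sigma>)}"
      using Q decoded_distortion[OF L i, of _ \<sigma> \<eta> "\<epsilon> / 4"] \<eta>0 \<eta>1 \<epsilon> big bound by simp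
  qed
  then show ?thesis using fail by linarith
qed

text \<open>For \<epsilon> at most 1 the quotient of \<open>1 + \<epsilon> / 4\<close> by
  \<open>1 - \<epsilon> / 4\<close> is at most \<open>1 + \<epsilon>\<close>. This is why distances
  are decoded with a quarter of the error.\<close>

lemma nearest_neighbor_transfer:
  fixes \<epsilon> :: real
  assumes \<epsilon>: "0 < \<epsilon>" "\<epsilon> \<le> 1" and k: "k < length X" and j: "j < length X"
    and close: "\<And>j. j < length X \<Longrightarrow> \<bar>eucl_dist d (X ! i) (X ! j) - eucl_dist d (X' ! i) (X' ! j)\<bar>
       \<le> \<epsilon> / 4 * eucl_dist d (X ! i) (X ! j)"
    and le: "eucl_dist d (X' ! i) (X' ! k) \<le> eucl_dist d (X' ! i) (X' ! j)"
  shows "eucl_dist d (X ! i) (X ! k) \<le> (1 + \<epsilon>) * eucl_dist d (X ! i) (X ! j)"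
proof -
  define a b where "a = eucl_dist d (X ! i) (X ! k)" and "b = eucl_dist d (X ! i) (X ! j)"
  have b: "b \<ge> 0" by (simp add: b_def eucl_dist_def)
  have "(1 - \<epsilon> / 4) * a \<le> (1 + \<epsilon> / 4) * b"
    using close[OF k] close[OF j] le unfolding a_def b_def left_diff_distrib distrib_right mult_1 by linarith
  also have "\<dots> \<le> ((1 - \<epsilon> / 4) * (1 + \<epsilon>)) * b"
  proof (rule mult_right_mono[OF _ b])
    have "\<epsilon> * \<epsilon> \<le> \<epsilon>" using \<epsilon> by (simp add: mult_left_le)
    moreover have "(1 - \<epsilon> / 4) * (1 + \<epsilon>) = 1 + 3 / 4 * \<epsilon> - \<epsilon> * \<epsilon> / 4"
      by (simp add: field_simps)
    ultimately show "1 + \<epsilon> / 4 \<le> (1 - \<epsilon> / 4) * (1 + \<epsilon>)" using \<epsilon> by linarith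
  qed
  finally have "(1 - \<epsilon> / 4) * a \<le> (1 - \<epsilon> / 4) * ((1 + \<epsilon>) * b)" by (simp only: mult.assoc)
  then show ?thesis using \<epsilon> unfolding a_def b_def by (subst (asm) mult_le_cancel_left_pos) auto
qed

text \<open>Both events contain the event that all distances from point \<open>i\<close> have
  relative error \<open>min 1 \<epsilon> / 4\<close>; capping \<epsilon> and \<delta> at 1 only
  strengthens the claims.\<close>

lemma prob_guarantees:
  fixes \<epsilon> \<delta> :: real
  assumes \<epsilon>: "\<epsilon> > 0" and \<delta>: "\<delta> > 0"
    and \<Lambda>: "real \<Lambda> \<ge> 64 * log 2 (2 + real d * log_aspect / (min 1 \<epsilon> * min 1 \<delta>))"
    and L: "L = nat \<lceil>log 2 (aspect_ratio d X)\<rceil> + \<Lambda>" and i: "i < length X"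
  shows "\<P>(\<sigma> in shift_distr d radius. \<forall>j<length X.
      (1 - \<epsilon>) * eucl_dist d (X ! i) (X ! j) \<le> eucl_dist d (decoded L \<Lambda> \<sigma> ! i) (decoded L \<Lambda> \<sigma> ! j) \<and>
      eucl_dist d (decoded L \<Lambda> \<sigma> ! i) (decoded L \<Lambda> \<sigma> ! j) \<le> (1 + \<epsilon>) * eucl_dist d (X ! i) (X ! j))
      \<ge> 1 - \<delta>"
    and "\<P>(\<sigma> in shift_distr d radius. \<forall>k<length X.
        k \<noteq> i \<and>
        (\<forall>j<length X. j \<noteq> i \<longrightarrow> eucl_dist d (decoded L \<Lambda> \<sigma> ! i) (decoded L \<Lambda> \<sigma> ! k)
            \<le> eucl_dist d (decoded L \<Lambda> \<sigma> ! i) (decoded L \<Lambda> \<sigma> ! j)) \<longrightarrow>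
        (\<forall>j<length X. j \<noteq> i \<longrightarrow> eucl_dist d (X ! i) (X ! k) \<le> (1 + \<epsilon>) * eucl_dist d (X ! i) (X ! j)))
      \<ge> 1 - \<delta>"
proof -
  have min: "min 1 \<epsilon> > 0" "min 1 \<epsilon> \<le> 1" "min 1 \<delta> > 0" "min 1 \<delta> \<le> 1" using \<epsilon> \<delta> by auto
  note prob = prob_decoded[OF min \<Lambda> L i]
  have le: "e * r \<le> \<epsilon> * r" if "e \<le> min 1 \<epsilon>" "r \<ge> 0" for e r
    using that by (intro mult_right_mono) auto
  have d0: "eucl_dist d x y \<ge> 0" for x y by (simp add: eucl_dist_def)
  have "1 - min 1 \<delta> \<le> \<P>(\<sigma> in shift_distr d radius. \<forall>j<length X.
      (1 - \<epsilon>) * eucl_dist d (X ! i) (X ! j) \<le> eucl_dist d (decoded L \<Lambda> \<sigma> ! i) (decoded L \<Lambda> \<sigma> ! j) \<and>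
      eucl_dist d (decoded L \<Lambda> \<sigma> ! i) (decoded L \<Lambda> \<sigma> ! j) \<le> (1 + \<epsilon>) * eucl_dist d (X ! i) (X ! j))"
  proof (rule prob, intro allI impI)
    fix X' j
    assume close: "\<And>j. j < length X \<Longrightarrow> \<bar>eucl_dist d (X ! i) (X ! j) - eucl_dist d (X' ! i) (X' ! j)\<bar>
       \<le> min 1 \<epsilon> / 4 * eucl_dist d (X ! i) (X ! j)" and j: "j < length X"
    have "min 1 \<epsilon> / 4 * eucl_dist d (X ! i) (X ! j) \<le> \<epsilon> * eucl_dist d (X ! i) (X ! j)"
      using min d0 by (intro le) auto
    then show "(1 - \<epsilon>) * eucl_dist d (X ! i) (X ! j) \<le> eucl_dist d (X' ! i) (X' ! j) \<and>
      eucl_dist d (X' ! i) (X' ! j) \<le> (1 + \<epsilon>) * eucl_dist d (X ! i) (X ! j)"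
      using close[OF j] unfolding left_diff_distrib distrib_right mult_1 by linarith
  qed
  then show "\<P>(\<sigma> in shift_distr d radius. \<forall>j<length X.
      (1 - \<epsilon>) * eucl_dist d (X ! i) (X ! j) \<le> eucl_dist d (decoded L \<Lambda> \<sigma> ! i) (decoded L \<Lambda> \<sigma> ! j) \<and>
      eucl_dist d (decoded L \<Lambda> \<sigma> ! i) (decoded L \<Lambda> \<sigma> ! j) \<le> (1 + \<epsilon>) * eucl_dist d (X ! i) (X ! j))
      \<ge> 1 - \<delta>" by linarith
  have "1 - min 1 \<delta> \<le> \<P>(\<sigma> in shift_distr d radius. \<forall>k<length X.
        k \<noteq> i \<and>
        (\<forall>j<length X. j \<noteq> i \<longrightarrow> eucl_dist d (decoded L \<Lambda> \<sigma> ! i) (decoded L \<Lambda> \<sigma> ! k)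
            \<le> eucl_dist d (decoded L \<Lambda> \<sigma> ! i) (decoded L \<Lambda> \<sigma> ! j)) \<longrightarrow>
        (\<forall>j<length X. j \<noteq> i \<longrightarrow> eucl_dist d (X ! i) (X ! k) \<le> (1 + \<epsilon>) * eucl_dist d (X ! i) (X ! j)))"
  proof (rule prob, intro allI impI)
    fix X' k j
    assume close: "\<And>j. j < length X \<Longrightarrow> \<bar>eucl_dist d (X ! i) (X ! j) - eucl_dist d (X' ! i) (X' ! j)\<bar>
       \<le> min 1 \<epsilon> / 4 * eucl_dist d (X ! i) (X ! j)" and j: "j < length X" "j \<noteq> i" and k: "k < length X"
      and nn: "k \<noteq> i \<and> (\<forall>j<length X. j \<noteq> i \<longrightarrow> eucl_dist d (X' ! i) (X' ! k) \<le> eucl_dist d (X' ! i) (X' ! j))"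
    have "eucl_dist d (X ! i) (X ! k) \<le> (1 + min 1 \<epsilon>) * eucl_dist d (X ! i) (X ! j)"
      by (rule nearest_neighbor_transfer[OF min(1,2) k j(1) close]) (use nn j in auto)
    also have "\<dots> \<le> (1 + \<epsilon>) * eucl_dist d (X ! i) (X ! j)"
      using d0 by (intro mult_right_mono) auto
    finally show "eucl_dist d (X ! i) (X ! k) \<le> (1 + \<epsilon>) * eucl_dist d (X ! i) (X ! j)" .
  qed
  then show "\<P>(\<sigma> in shift_distr d radius. \<forall>k<length X.
        k \<noteq> i \<and>
        (\<forall>j<length X. j \<noteq> i \<longrightarrow> eucl_dist d (decoded L \<Lambda> \<sigma> ! i) (decoded L \<Lambda> \<sigma> ! k)
            \<le> eucl_dist d (decoded L \<Lambda> \<sigma> ! i) (decoded L \<Lambda> \<sigma> ! j)) \<longrightarrow>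
        (\<forall>j<length X. j \<noteq> i \<longrightarrow> eucl_dist d (X ! i) (X ! k) \<le> (1 + \<epsilon>) * eucl_dist d (X ! i) (X ! j)))
      \<ge> 1 - \<delta>" by linarith
qed

end

subsection \<open>Size of the sketch\<close>

fun edge_size :: "nat \<Rightarrow> edge \<Rightarrow> nat" where
  "edge_size w (Short bs) = length bs + 1"
| "edge_size w (Long m) = w + 1"

fun code_size :: "nat \<Rightarrow> edge qtree \<Rightarrow> nat"
  and code_size_children :: "nat \<Rightarrow> (edge \<times> edge qtree) list \<Rightarrow> nat" where
  "code_size w (Leaf js) = 1"
| "code_size w (Node ts) = code_size_children w ts + 1"
| "code_size_children w [] = 0"
| "code_size_children w ((e, t) # ts) = edge_size w e + code_size w t + code_size_children w ts + 1"

lemma length_encode_edge: "length (encode_edge w e acc) = edge_size w e + length acc"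
  by (cases e) auto

lemma length_encode_tree:
  "length (encode_tree w t acc) = code_size w t + length acc"
  "length (encode_children w ts acc) = code_size_children w ts + length acc"
  by (induction w t acc and w ts acc rule: encode_tree_encode_children.induct)
     (auto simp: length_encode_edge)

lemma length_encode_indices: "length (encode_indices w ps) = length ps * w"
  by (induction w ps rule: encode_indices.induct) auto

text \<open>The two additional bits per edge are the \<open>True\<close> that opens it and the
  \<open>False\<close> that closes its upper node.\<close>

lemma code_size_hang: "code_size w (hang es t) = (\<Sum>e\<leftarrow>es. edge_size w e + 2) + code_size w t"
  by (induction es) auto

text \<open>Either at most \<open>\<Lambda> + 1\<close> short edges of \<open>d + 3\<close> bits
  each, or \<open>\<Lambda>\<close> short edges and one long edge of \<open>w + 3\<close>
  bits.\<close>

lemma code_size_path_edges: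
  assumes "\<forall>bs\<in>set ls. length bs = d"
  shows "(\<Sum>e\<leftarrow>path_edges \<Lambda> ls. edge_size w e + 2) \<le> (\<Lambda> + 1) * (d + 3) + w + 3"
proof -
  have *: "(\<Sum>e\<leftarrow>map Short ms. edge_size w e + 2) = length ms * (d + 3)" if "\<forall>bs\<in>set ms. length bs = d" for ms
    using that by (induction ms) auto
  show ?thesis
  proof (cases "length ls > \<Lambda> + 1")
    case True
    have "\<forall>bs\<in>set (take \<Lambda> ls). length bs = d" using assms by (auto dest: in_set_takeD)
    then show ?thesis using True *[of "take \<Lambda> ls"] unfolding path_edges_eq by simp
  next
    case False
    then have "length ls * (d + 3) \<le> (\<Lambda> + 1) * (d + 3)" by (intro mult_right_mono) auto
    then show ?thesis using False *[OF assms] unfolding path_edges_eq by simp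
  qed
qed

text \<open>A tree with \<open>r\<close> leaves in which every inner node branches has at most \<open>2 * r - 2\<close> edges, and
  pruning turns each of them into a path whose encoding has bounded length.\<close>

lemma code_size_prune:
  fixes w d \<Lambda>
  defines "A \<equiv> (\<Lambda> + 1) * (d + 3) + w + 4"
  shows "grid_tree d l t \<Longrightarrow> chain_labels t = [] \<Longrightarrow>
      code_size w (prune \<Lambda> t) + 2 * A \<le> 2 * A * length (leaves t) + 1"
    and "\<forall>(bs, t)\<in>set ts. length bs = d \<and> grid_tree d l t \<Longrightarrow>
      code_size_children w (prune_children \<Lambda> ts) + A * length ts \<le> 2 * A * length (child_leaves ts)"
  unfolding A_def
proof (induction \<Lambda> t and \<Lambda> ts arbitrary: l and l rule: pruned_leaves_pruned_child_leaves.induct)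
  case (2 \<Lambda> ts)
  obtain l' where l: "l = Suc l'" using 2(2) by (cases l) auto
  define A where "A = (\<Lambda> + 1) * (d + 3) + w + 4"
  \<comment> \<open>An empty chain excludes exactly one child and \<open>grid_tree\<close> excludes
    none, so there are two or more. Their surplus of \<open>A\<close> each pays for the
    \<open>2 * A\<close> claimed at this node.\<close>
  have "length ts \<noteq> 0" using 2(2) l by auto
  moreover have "length ts \<noteq> 1" using 2(3) by (auto simp: length_Suc_conv)
  ultimately have "length ts \<ge> 2" by linarith
  then have "A * 2 \<le> A * length ts" by (intro mult_left_mono) auto
  moreover have "code_size_children w (prune_children \<Lambda> ts) + A * length ts \<le> 2 * A * length (child_leaves ts)"
    unfolding A_def by (rule 2(1)[of l']) (use 2(2) l in auto)
  ultimately show ?case unfolding A_def[symmetric] prune.simps code_size.simps leaves.simps by linarith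
next
  case (4 \<Lambda> bs t ts)
  define A where "A = (\<Lambda> + 1) * (d + 3) + w + 4"
  define ls where "ls = bs # chain_labels t"
  define es where "es = path_edges \<Lambda> ls"
  have "es \<noteq> []" by (simp add: es_def ls_def path_edges_nonempty)
  then obtain e es' where es: "es = e # es'" by (cases es) auto
  have t: "grid_tree d l t" "length bs = d" using 4(3) by auto
  note ch = grid_tree_chain[OF t(1)]
  have "(\<Sum>e\<leftarrow>es. edge_size w e + 2) + 1 \<le> A"
    using code_size_path_edges[where ls = ls and d = d and \<Lambda> = \<Lambda> and w = w] ch t(2) unfolding es_def A_def by (simp add: ls_def)
  moreover have "code_size w (prune \<Lambda> (chain_end t)) + 2 * A \<le> 2 * A * length (leaves t) + 1"
    unfolding leaves_chain[of t] length_map A_def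
    by (rule 4(1)[of "l - length (chain_labels t)"]) (use ch chain_labels_chain_end in auto)
  moreover have "code_size_children w (prune_children \<Lambda> ts) + A * length ts \<le> 2 * A * length (child_leaves ts)"
    unfolding A_def by (rule 4(2)[of l]) (use 4(3) in auto)
  \<comment> \<open>The missing bit is the \<open>False\<close> of the upper node of the first edge;
    it is counted once at that node, not per child.\<close>
  moreover have "code_size_children w (prune_children \<Lambda> ((bs, t) # ts)) + 1 =
      (\<Sum>e\<leftarrow>es. edge_size w e + 2) + code_size w (prune \<Lambda> (chain_end t)) + code_size_children w (prune_children \<Lambda> ts)"
    unfolding prune_children.simps ls_def[symmetric] es_def[symmetric] unfolding es
    by (simp add: code_size_hang)
  ultimately show ?case unfolding A_def[symmetric] by (simp add: distrib_left)
qed auto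

lemma code_size_prune_root:
  assumes t: "grid_tree d l t" and r: "length (chain_labels t) \<le> r"
  shows "code_size w (prune_root \<Lambda> t) \<le> r * (d + 3) + 2 * ((\<Lambda> + 1) * (d + 3) + w + 4) * length (leaves t)"
proof -
  note ch = grid_tree_chain[OF t]
  define A where "A = (\<Lambda> + 1) * (d + 3) + w + 4"
  have "(\<Sum>e\<leftarrow>map Short ms. edge_size w e + 2) = length ms * (d + 3)" if "\<forall>bs\<in>set ms. length bs = d" for ms
    using that by (induction ms) auto
  then have "(\<Sum>e\<leftarrow>map Short (chain_labels t). edge_size w e + 2) = length (chain_labels t) * (d + 3)"
    using ch by blast
  also have "\<dots> \<le> r * (d + 3)" using r by (intro mult_right_mono) auto
  finally have "(\<Sum>e\<leftarrow>map Short (chain_labels t). edge_size w e + 2) \<le> r * (d + 3)" .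
  moreover have "code_size w (prune \<Lambda> (chain_end t)) + 2 * A \<le> 2 * A * length (leaves t) + 1"
    unfolding leaves_chain[of t] length_map A_def using ch chain_labels_chain_end code_size_prune(1) by blast
  moreover have "A \<ge> 1" by (simp add: A_def)
  ultimately show ?thesis
    unfolding A_def[symmetric] prune_root.simps short_edges_eq code_size_hang by linarith
qed

lemma take_cell_path: "r \<le> l \<Longrightarrow> take r (cell_path l s cs x) = cell_path r s cs x"
proof (induction l arbitrary: r s cs)
  case (Suc l)
  then show ?case by (cases r) auto
qed auto

text \<open>All points share the cell at the end of the initial chain. If that cell were too small,
  the point of \<open>far_point\<close> could not lie in it together with the first point.\<close>

lemma (in pointset) root_chain_bound:
  assumes \<sigma>: "\<And>k. k < d \<Longrightarrow> \<sigma> k \<in> {-radius..radius}"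
  shows "2 ^ length (chain_labels (full_tree L \<sigma>)) < 8 * real d"
proof -
  define r where "r = length (chain_labels (full_tree L \<sigma>))"
  note lv = leaves_full_tree[where L = L and \<sigma> = \<sigma>]
  have rL: "r \<le> L" using grid_tree_chain[OF lv(4)] by (simp add: r_def)
  have path: "cell_path r (4 * radius) (corner \<sigma>) (X ! i) = chain_labels (full_tree L \<sigma>)" if i: "i < length X" for i
  proof -
    have "(i, X ! i) \<in> set (number 0 X)" using i by (auto simp: number_eq in_set_enumerate_eq)
    then have "cell_path L (4 * radius) (corner \<sigma>) (X ! i) \<in> fst ` set (leaves (full_tree L \<sigma>))"
      unfolding lv(3) by force
    then obtain P where "cell_path L (4 * radius) (corner \<sigma>) (X ! i) = chain_labels (full_tree L \<sigma>) @ P"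
      unfolding leaves_chain[of "full_tree L \<sigma>"] by auto
    then show ?thesis using take_cell_path[OF rL, of "4 * radius" "corner \<sigma>" "X ! i"] by (simp add: r_def)
  qed
  obtain i where i: "i < length X" "i \<noteq> 0" "radius < 2 * eucl_dist d (X ! 0) (X ! i)" using far_point by blast
  have "\<bar>X ! 0 ! k - X ! i ! k\<bar> \<le> 4 * radius / 2 ^ r" if k: "k < d" for k
  proof -
    have "corner \<sigma> ! k + path_value (4 * radius) (chain_labels (full_tree L \<sigma>)) k \<le> X ! j ! k \<and>
      X ! j ! k \<le> corner \<sigma> ! k + path_value (4 * radius) (chain_labels (full_tree L \<sigma>)) k + 4 * radius / 2 ^ r"
      if j: "j < length X" for j
      using cell_path_bounds[of "X ! j" "corner \<sigma>" k "4 * radius" r] in_root_cell[OF j k] \<sigma>[OF k] k j unfolding path[OF j] by simp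
    from this[of 0] this[of i] show ?thesis using i(1) by force
  qed
  then have "eucl_dist d (X ! 0) (X ! i) \<le> real d * (4 * radius / 2 ^ r)" by (rule eucl_dist_le_sum)
  then have "radius < 2 * (real d * (4 * radius / 2 ^ r))" using i(3) by linarith
  then have "radius * 2 ^ r < radius * (8 * real d)" by (simp add: field_simps)
  then show ?thesis using radius_pos unfolding r_def by simp
qed

subsection \<open>Running time\<close>

fun num_edges :: "'e qtree \<Rightarrow> nat"
  and num_edges_children :: "('e \<times> 'e qtree) list \<Rightarrow> nat" where
  "num_edges (Leaf js) = 0"
| "num_edges (Node ts) = num_edges_children ts"
| "num_edges_children [] = 0"
| "num_edges_children ((e, t) # ts) = num_edges t + num_edges_children ts + 1"

lemma num_edges_hang: "num_edges (hang es t) = length es + num_edges t"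
  by (induction es) auto

lemma num_edges_chain: "num_edges t = length (chain_labels t) + num_edges (chain_end t)"
  by (induction t rule: chain_labels.induct) auto

lemma length_path_edges_le: "length (path_edges \<Lambda> ls) \<le> length ls"
  by (auto simp: path_edges_eq)

lemma num_edges_prune:
  "num_edges (prune \<Lambda> t) \<le> num_edges t"
  "num_edges_children (prune_children \<Lambda> ts) \<le> num_edges_children ts"
proof (induction \<Lambda> t and \<Lambda> ts rule: pruned_leaves_pruned_child_leaves.induct)
  case (4 \<Lambda> bs t ts)
  define es where "es = path_edges \<Lambda> (bs # chain_labels t)"
  have "es \<noteq> []" by (simp add: es_def path_edges_nonempty)
  then obtain e es' where es: "es = e # es'" by (cases es) auto
  have "length es \<le> length (chain_labels t) + 1"
    unfolding es_def using length_path_edges_le[of \<Lambda> "bs # chain_labels t"] by simp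
  then show ?case using 4 num_edges_chain[of t]
    unfolding prune_children.simps es_def[symmetric] es by (simp add: num_edges_hang)
qed auto

lemma num_edges_prune_root: "num_edges (prune_root \<Lambda> t) \<le> num_edges t"
  using num_edges_prune(1)[of \<Lambda> "chain_end t"] num_edges_chain[of t]
  by (simp add: num_edges_hang short_edges_eq)

lemma T_chain_labels_eq: "T_chain_labels t = length (chain_labels t) + 1"
  by (induction t rule: chain_labels.induct) auto

lemma T_chain_end_eq: "T_chain_end t = length (chain_labels t) + 1"
  by (induction t rule: chain_labels.induct) auto

lemma T_short_edges_eq: "T_short_edges ls = length ls + 1"
  by (induction ls) auto

lemma T_hang_eq: "T_hang es t = length es + 1"
  by (induction es) auto

lemma T_path_edges_le: "T_path_edges \<Lambda> ls \<le> 4 * length ls + 5"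
  by (auto simp: Let_def T_length T_take T_append T_short_edges_eq short_edges_eq)

lemma T_add_branch_le: "T_add_branch es t ts \<le> length es + 1"
  by (cases es) (auto simp: T_hang_eq)

text \<open>Each chain is traversed a constant number of times and the recursion continues at its
  end, so the work is charged to the edges of the unpruned tree.\<close>

lemma T_prune_le:
  "T_prune \<Lambda> t \<le> 20 * num_edges t + 2"
  "T_prune_children \<Lambda> ts \<le> 20 * num_edges_children ts + 1"
proof (induction \<Lambda> t and \<Lambda> ts rule: pruned_leaves_pruned_child_leaves.induct)
  case (4 \<Lambda> bs t ts)
  define ls where "ls = bs # chain_labels t"
  have "T_prune_children \<Lambda> ((bs, t) # ts) \<le> length ls + (4 * length ls + 5) + length ls +
     T_prune \<Lambda> (chain_end t) + T_prune_children \<Lambda> ts + (length ls + 1) + 1"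
    using T_path_edges_le[of \<Lambda> ls]
      order_trans[OF T_add_branch_le[of "path_edges \<Lambda> ls" "prune \<Lambda> (chain_end t)" "prune_children \<Lambda> ts"],
        of "length ls + 1"] length_path_edges_le[of \<Lambda> ls]
    unfolding T_prune_children.simps ls_def[symmetric] T_chain_labels_eq T_chain_end_eq
    by (simp add: ls_def)
  then show ?case using 4 num_edges_chain[of t] by (simp add: ls_def)
qed auto

lemma T_prune_root_le: "T_prune_root \<Lambda> t \<le> 20 * num_edges t + 7"
  using T_prune_le(1)[of \<Lambda> "chain_end t"] num_edges_chain[of t]
  by (simp add: T_chain_labels_eq T_chain_end_eq T_short_edges_eq short_edges_eq T_hang_eq)

lemma T_leaf_sets_le:
  "T_leaf_sets t acc \<le> 3 * num_edges t + 2"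
  "T_leaf_sets_children ts acc \<le> 3 * num_edges_children ts + 1"
proof (induction t acc and ts acc rule: T_leaf_sets_T_leaf_sets_children.induct)
  case (4 e t ts acc)
  then show ?case by simp
qed auto

lemma T_with_leaf_eq: "T_with_leaf v js acc = length js + 1"
  by (induction v js acc rule: T_with_leaf.induct) auto

lemma T_leaf_indices_eq: "T_leaf_indices v jss = length (concat jss) + 2 * length jss + 1"
  by (induction v jss rule: T_leaf_indices.induct) (auto simp: T_with_leaf_eq)

lemma T_merge_le: "T_merge ps qs \<le> length ps + length qs + 1"
  by (induction ps qs rule: T_merge.induct) auto

lemma length_msort: "length (msort ps) = length ps"
  by (metis mset_msort size_mset)

text \<open>Induction on the recursion depth \<open>j\<close>. The additive terms of a split are
  absorbed by \<open>9 * length ps\<close> because a list that is split has at least two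
  elements.\<close>

lemma T_msort_le: "length ps \<le> 2 ^ j \<Longrightarrow> T_msort ps \<le> 9 * length ps * j + 3"
proof (induction j arbitrary: ps)
  case 0
  then show ?case by (subst T_msort.simps) (auto simp: T_length)
next
  case (Suc j)
  define k where "k = length ps div 2"
  show ?case
  proof (cases "length ps \<le> 1")
    case True
    then show ?thesis by (subst T_msort.simps) (auto simp: T_length)
  next
    case False
    define k' where "k' = length ps - k"
    have k: "2 * k \<le> length ps" "length ps \<le> 2 * k + 1" "k + k' = length ps" by (auto simp: k_def k'_def)
    have 1: "T_msort (take k ps) \<le> 9 * (k * j) + 3"
      using Suc.IH[of "take k ps"] Suc.prems k by simp
    have 2: "T_msort (drop k ps) \<le> 9 * (k' * j) + 3"
      using Suc.IH[of "drop k ps"] Suc.prems k by (simp add: k'_def mult.assoc)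
    have 3: "T_merge (msort (take k ps)) (msort (drop k ps)) \<le> length ps + 1"
      using T_merge_le[of "msort (take k ps)" "msort (drop k ps)"] k by (simp add: length_msort)
    have "k * j + k' * j = length ps * j"
      using k(3) by (metis distrib_right)
    moreover have "T_msort ps = (length ps + 1) + (2 * (k + 1) + T_msort (take k ps) + T_msort (drop k ps) +
        T_merge (msort (take k ps)) (msort (drop k ps))) + 1"
      using False k by (subst T_msort.simps) (simp add: T_length T_take T_drop Let_def k_def[symmetric])
    ultimately show ?thesis using 1 2 3 k False unfolding mult_Suc_right mult.assoc distrib_left by linarith
  qed
qed

lemma T_to_bits_eq: "T_to_bits w m = w + 1"
  by (induction w m rule: T_to_bits.induct) auto

lemma T_encode_indices_eq: "T_encode_indices w ps = length ps * (2 * w + 3) + 1"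
  by (induction w ps rule: T_encode_indices.induct) (auto simp: T_to_bits_eq T_append)

text \<open>Thanks to the accumulator each append copies only one edge label, never the code of a
  subtree.\<close>

lemma T_encode_tree_le:
  "full (edge_fits d w) t \<Longrightarrow> T_encode_tree w t acc \<le> num_edges t * (d + 2 * w + 6) + 2"
  "full_children (edge_fits d w) ts \<Longrightarrow>
    T_encode_children w ts acc \<le> num_edges_children ts * (d + 2 * w + 6) + 1"
proof (induction w t acc and w ts acc rule: T_encode_tree_T_encode_children.induct)
  case (4 w e t ts acc)
  have "T_encode_edge w e bs \<le> d + 2 * w + 3" for bs
    using 4(3) by (cases e) (auto simp: T_append T_to_bits_eq)
  from this[of "encode_tree w t (encode_children w ts acc)"] show ?case
    using 4 by (simp add: distrib_right)
qed simp_all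

lemma T_width_eq: "T_width m = width m + 1"
  by (induction m rule: width.induct) (subst T_width.simps, subst width.simps, auto)

lemma T_firsts_eq: "T_firsts ps = length ps + 1"
  by (induction ps rule: T_firsts.induct) auto

lemma T_prefix_bit_eq: "T_prefix_bit b gs = length gs + 1"
  by (induction b gs rule: T_prefix_bit.induct) auto

lemma T_lower_half_le: "T_lower_half m rs \<le> length rs + 1"
  by (induction m rs rule: T_lower_half.induct) auto

lemma T_upper_half_le: "T_upper_half m rs \<le> length rs + 1"
  by (induction m rs rule: T_upper_half.induct) auto

lemma length_halves:
  "\<forall>r\<in>set rs. snd r \<noteq> [] \<Longrightarrow> length (lower_half m rs) + length (upper_half m rs) = length rs"
  by (induction m rs rule: lower_half.induct) auto

text \<open>Empty halves are abandoned at once, so there are never more groups than points although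
  a cell has exponentially many subcells; each coordinate costs time linear in the number of
  points.\<close>

lemma split_cell_size:
  "\<forall>r\<in>set rs. length (snd r) = length cs \<Longrightarrow>
    (\<Sum>g\<leftarrow>split_cell h cs rs. length (snd g)) = length rs \<and>
    (\<forall>g\<in>set (split_cell h cs rs). snd g \<noteq> []) \<and>
    T_split_cell h cs rs \<le> 1 + length rs * (13 * length cs + 3)"
proof (induction h cs rs rule: split_cell.induct)
  case (2 h p ps)
  then show ?case by (auto simp: firsts_eq T_firsts_eq)
next
  case (3 h c cs p ps)
  define rs where "rs = p # ps"
  have ne: "\<forall>r\<in>set rs. snd r \<noteq> []" using 3(3) by (auto simp: rs_def)
  define lo where "lo = lower_half (c + h) rs"
  define up where "up = upper_half (c + h) rs"
  have len: "\<forall>r\<in>set lo. length (snd r) = length cs" "\<forall>r\<in>set up. length (snd r) = length cs"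
    using 3(3) by (auto simp: lo_def up_def set_lower_half[OF ne] set_upper_half[OF ne] simp flip: rs_def)
  note IH1 = 3(1)[folded rs_def, folded lo_def, OF len(1)]
  note IH2 = 3(2)[folded rs_def, folded up_def, OF len(2)]
  have lu: "length lo + length up = length rs" unfolding lo_def up_def by (rule length_halves[OF ne])
  have count: "length gs \<le> (\<Sum>g\<leftarrow>gs. length (snd g))" if "\<forall>g\<in>set gs. snd g \<noteq> []" for gs :: "(bool list \<times> 'a list) list"
    using that by (induction gs) (auto simp: Suc_le_eq add_strict_increasing)
  have g: "length (split_cell h cs lo) \<le> length lo" "length (split_cell h cs up) \<le> length up"
    using count[of "split_cell h cs lo"] count[of "split_cell h cs up"] IH1 IH2 by auto
  have "T_split_cell h (c # cs) rs = T_lower_half (c + h) rs + T_split_cell h cs lo +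
      (length (split_cell h cs lo) + 1) + T_upper_half (c + h) rs + T_split_cell h cs up +
      (length (split_cell h cs up) + 1) + (length (split_cell h cs lo) + 1) + 1"
    by (simp add: rs_def lo_def up_def T_prefix_bit_eq T_append prefix_bit_eq)
  also have "\<dots> \<le> 4 * length rs + 8 + length lo * (13 * length cs + 3) + length up * (13 * length cs + 3) + length rs"
    using T_lower_half_le[of "c + h" rs] T_upper_half_le[of "c + h" rs] g lu
      IH1[THEN conjunct2, THEN conjunct2] IH2[THEN conjunct2, THEN conjunct2] by linarith
  also have "\<dots> = 5 * length rs + 8 + length rs * (13 * length cs + 3)"
    unfolding lu[symmetric] by (simp add: algebra_simps)
  \<comment> \<open>As \<open>rs\<close> is nonempty, \<open>5 * length rs + 8\<close> is at most
    \<open>13 * length rs\<close>, the share of one coordinate.\<close>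
  also have "\<dots> \<le> 1 + length rs * (13 * length (c # cs) + 3)"
    by (simp add: rs_def algebra_simps)
  finally have T: "T_split_cell h (c # cs) rs \<le> 1 + length rs * (13 * length (c # cs) + 3)" .
  have eq: "split_cell h (c # cs) rs =
      map (apfst (Cons False)) (split_cell h cs lo) @ map (apfst (Cons True)) (split_cell h cs up)"
    by (simp add: rs_def lo_def up_def prefix_bit_eq)
  have "(\<Sum>g\<leftarrow>split_cell h (c # cs) rs. length (snd g)) = length rs"
    "\<forall>g\<in>set (split_cell h (c # cs) rs). snd g \<noteq> []"
    unfolding eq using IH1 IH2 lu by (auto simp: o_def)
  then show ?case using T unfolding rs_def by blast
qed auto

lemma T_attach_coords_eq: "T_attach_coords ps = length ps + 1"
  by (induction ps rule: T_attach_coords.induct) auto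

lemma T_child_corner_le: "T_child_corner h cs bs \<le> length cs + 1"
  by (induction h cs bs rule: T_child_corner.induct) auto

text \<open>At each level every point lies in exactly one cell, so a level has at most
  \<open>length ps\<close> edges and its splitting costs are linear in
  \<open>length cs * length ps\<close>.\<close>

lemma build_size:
  assumes "\<forall>q\<in>set ps. length (snd q) = length cs" "length cs \<ge> 1" "ps \<noteq> []"
  shows "num_edges (build l s cs ps) \<le> l * length ps \<and>
    T_build l s cs ps \<le> 40 * length cs * length ps * l + length ps + 2"
  using assms
proof (induction l arbitrary: s cs ps)
  case 0
  then show ?case by (simp add: T_firsts_eq)
next
  case (Suc l)
  define h where "h = s / 2"
  define d where "d = length cs"
  define gs where "gs = split_cell h cs (attach_coords ps)"
  have at: "\<forall>r\<in>set (attach_coords ps). length (snd r) = length cs"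
    using Suc.prems(1) by (auto simp: attach_coords_eq)
  have la: "length (attach_coords ps) = length ps" by (simp add: attach_coords_eq)
  note sz = split_cell_size[OF at, of h, folded gs_def]
  have total: "(\<Sum>g\<leftarrow>gs. length (snd g)) = length ps" using sz by (simp add: attach_coords_eq)
  have g: "\<forall>(bs, qs)\<in>set gs. qs \<noteq> [] \<and> length bs = length cs \<and> (\<forall>q\<in>set qs. length (snd q) = length cs)"
  proof clarify
    fix bs qs assume bq: "(bs, qs) \<in> set gs"
    have "bs \<in> (\<lambda>q. cell_bits h cs (snd q)) ` set ps"
      using bq split_cell_attach(3)[OF Suc.prems(1), where h = h] unfolding gs_def by (metis fst_conv image_eqI)
    then have "length bs = length cs" using Suc.prems(1) by (auto simp: length_cell_bits)
    moreover have "qs = filter (\<lambda>q. cell_bits h cs (snd q) = bs) ps"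
      using bq split_cell_attach(1)[OF Suc.prems(1)] unfolding gs_def by blast
    ultimately show "qs \<noteq> [] \<and> length bs = length cs \<and> (\<forall>q\<in>set qs. length (snd q) = length cs)"
      using sz bq Suc.prems(1) by auto
  qed
  have rec: "num_edges_children (build_children l h cs fs) \<le> (l + 1) * (\<Sum>g\<leftarrow>fs. length (snd g)) \<and>
     T_build_children l h cs fs \<le> (40 * d * l + d + 5) * (\<Sum>g\<leftarrow>fs. length (snd g)) + 1"
    if "set fs \<subseteq> set gs" for fs
    using that
  proof (induction fs)
    case (Cons f fs)
    obtain bs qs where f: "f = (bs, qs)" by (cases f)
    have q: "qs \<noteq> []" "length bs = length cs" "\<forall>q\<in>set qs. length (snd q) = length cs"
      using Cons.prems g f by auto
    have q1: "length qs \<ge> 1" using q(1) by (cases qs) auto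
    have lc: "length (child_corner h cs bs) = length cs" using q(2) by (rule length_child_corner)
    have b: "num_edges (build l h (child_corner h cs bs) qs) \<le> l * length qs"
      "T_build l h (child_corner h cs bs) qs \<le> 40 * d * length qs * l + length qs + 2"
      using Suc.IH[of qs "child_corner h cs bs" h] q lc Suc.prems(2) by (auto simp: d_def)
    \<comment> \<open>The fixed cost of a child is charged to the points in it, of which there is at
      least one.\<close>
    have "d + 4 \<le> (d + 4) * length qs" using q1 by simp
    then show ?case using Cons b q1 T_child_corner_le[of h cs bs]
      by (simp add: f d_def[symmetric] algebra_simps)
  qed simp
  have p1: "length ps \<ge> 1" using Suc.prems(3) by (cases ps) auto
  have d1: "d \<ge> 1" using Suc.prems(2) by (simp add: d_def)
  have dp: "length ps \<le> d * length ps" "1 \<le> d * length ps" using p1 d1 by auto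
  have "num_edges (build (Suc l) s cs ps) \<le> Suc l * length ps"
    using rec[of gs] total by (simp add: h_def[symmetric] gs_def[symmetric])
  moreover have "T_build (Suc l) s cs ps \<le> (length ps + 1) + (1 + length ps * (13 * d + 3)) +
     ((40 * d * l + d + 5) * length ps + 1) + 1"
    using sz rec[of gs] total
    by (simp add: h_def[symmetric] gs_def[symmetric] T_attach_coords_eq la d_def)
  moreover have "(length ps + 1) + (1 + length ps * (13 * d + 3)) + ((40 * d * l + d + 5) * length ps + 1) + 1 =
     9 * length ps + 14 * (d * length ps) + 40 * (d * length ps * l) + 4"
    by (simp add: algebra_simps)
  moreover have "40 * d * length ps * Suc l = 40 * (d * length ps) + 40 * (d * length ps * l)"
    by (simp add: algebra_simps)
  ultimately show ?case using dp unfolding d_def[symmetric] by linarith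
qed

section \<open>Size and time bounds for the whole sketch\<close>

context pointset
begin

lemma num_leaves_le: "length (leaves (full_tree L \<sigma>)) \<le> length X"
proof -
  \<comment> \<open>Nonempty leaves are available for pruned trees only; pruning with any parameter
    keeps the point lists, so 0 serves.\<close>
  have "full (edge_fits d (width L)) (prune_root 0 (full_tree L \<sigma>))"
    using full_prune_root leaves_full_tree(4) less_two_power_width by blast
  then have "\<forall>js\<in>set (map snd (leaves (prune_root 0 (full_tree L \<sigma>)))). js \<noteq> []"
    using full_leaves_nonempty(1) by auto
  then have "\<forall>js\<in>set (map snd (leaves (full_tree L \<sigma>))). js \<noteq> []"
    unfolding snd_leaves_prune_root .
  then have "length (map snd (leaves (full_tree L \<sigma>))) \<le> length (concat (map snd (leaves (full_tree L \<sigma>))))"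
    by (rule length_le_length_concat)
  also have "\<dots> = length X" using distinct_card[OF leaf_numbers(1)] leaf_numbers(2) by simp
  finally show ?thesis by simp
qed

lemma length_leaf_indices:
  "length (leaf_indices 0 (leaf_sets (prune_root \<Lambda> (full_tree L \<sigma>)) [])) = length X"
proof -
  have "length (leaf_indices 0 (leaf_sets (prune_root \<Lambda> (full_tree L \<sigma>)) [])) =
      length (concat (map snd (leaves (full_tree L \<sigma>))))"
    by (metis append_Nil2 leaf_sets_eq(1) length_map map_fst_leaf_indices snd_leaves_prune_root)
  also have "\<dots> = length X" using distinct_card[OF leaf_numbers(1)] leaf_numbers(2) by simp
  finally show ?thesis .
qed

lemma width_le_log: "m \<ge> 1 \<Longrightarrow> real (width m) \<le> 1 + log 2 (real m)"
proof -
  assume m: "m \<ge> 1"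
  have "real (2 ^ width m) \<le> real (2 * m)" using two_power_width_le[of m] m by (simp only: of_nat_le_iff)
  then have le: "2 ^ width m \<le> 2 * real m" by simp
  have "real (width m) = log 2 (2 ^ width m)" by simp
  also have "\<dots> \<le> log 2 (2 * real m)"
    by (subst log_le_cancel_iff) (use le m in auto)
  also have "\<dots> = 1 + log 2 (real m)" using m by (simp add: log_mult)
  finally show ?thesis .
qed

text \<open>The two exponential conditions bound the initial chain and \<open>width L\<close> by
  \<Lambda>. The constant 30 is 4 for the initial chain plus 26 for the branches; it also covers the
  leaf numbers, as \<open>log 2 n\<close> is at least 1.\<close>

lemma sketch_length_le:
  assumes \<sigma>: "\<And>k. k < d \<Longrightarrow> \<sigma> k \<in> {-radius..radius}"
    and \<Lambda>: "\<Lambda> \<ge> 1" "8 * real d \<le> 2 ^ \<Lambda>" "2 * real L \<le> 2 ^ \<Lambda>" "L \<ge> 1"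
  shows "real (length (quadsketch L \<Lambda> (shift_list d \<sigma>) X)) \<le>
     30 * (real (length X * d * \<Lambda>) + real (length X) * log 2 (real (length X)))"
proof -
  define n where "n = length X"
  define t where "t = full_tree L \<sigma>"
  define r where "r = length (chain_labels t)"
  have n: "n \<ge> 2" using two_points by (simp add: n_def)
  have "2 ^ r < 8 * real d"
    unfolding r_def t_def by (rule root_chain_bound) (rule \<sigma>)
  then have "(2::real) ^ r < 2 ^ \<Lambda>" using \<Lambda>(2) by linarith
  then have r: "r \<le> \<Lambda>" by simp
  have "real (2 ^ width L) \<le> real (2 * L)"
    using two_power_width_le[of L] \<Lambda>(4) by (simp only: of_nat_le_iff)
  then have "(2::real) ^ width L \<le> 2 * real L" by simp
  then have "(2::real) ^ width L \<le> 2 ^ \<Lambda>" using \<Lambda>(3) by (rule order_trans)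
  then have w: "width L \<le> \<Lambda>" by simp
  have "length (quadsketch L \<Lambda> (shift_list d \<sigma>) X) = code_size (width L) (prune_root \<Lambda> t) + n * width n"
    using length_leaf_indices[of \<Lambda> L \<sigma>]
    by (simp add: sketch_tree_eq length_encode_tree length_encode_indices length_msort t_def n_def Let_def
        del: prune_root.simps)
  also have "code_size (width L) (prune_root \<Lambda> t) \<le>
      \<Lambda> * (d + 3) + 2 * ((\<Lambda> + 1) * (d + 3) + width L + 4) * length (leaves t)"
    unfolding t_def by (rule code_size_prune_root[OF leaves_full_tree(4)]) (use r in \<open>simp add: r_def t_def\<close>)
  also have "\<dots> \<le> \<Lambda> * (4 * d) + 2 * (2 * \<Lambda> * (4 * d) + 5 * (\<Lambda> * d)) * n"
  proof (rule add_mono)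
    show "\<Lambda> * (d + 3) \<le> \<Lambda> * (4 * d)" using d_pos by simp
    have "\<Lambda> \<le> \<Lambda> * d" "1 \<le> \<Lambda> * d" using d_pos \<Lambda>(1) by auto
    then have "width L + 4 \<le> 5 * (\<Lambda> * d)" using w by linarith
    moreover have "(\<Lambda> + 1) * (d + 3) \<le> 2 * \<Lambda> * (4 * d)"
      using d_pos \<Lambda>(1) by (intro mult_mono) auto
    ultimately have "(\<Lambda> + 1) * (d + 3) + width L + 4 \<le> 2 * \<Lambda> * (4 * d) + 5 * (\<Lambda> * d)" by linarith
    moreover have "length (leaves t) \<le> n" unfolding t_def n_def by (rule num_leaves_le)
    ultimately show "2 * ((\<Lambda> + 1) * (d + 3) + width L + 4) * length (leaves t) \<le>
        2 * (2 * \<Lambda> * (4 * d) + 5 * (\<Lambda> * d)) * n"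
      by (intro mult_le_mono le_refl)
  qed
  also have "\<dots> = 4 * (\<Lambda> * d) + 26 * (n * d * \<Lambda>)" by (simp add: algebra_simps)
  also have "\<dots> \<le> 30 * (n * d * \<Lambda>)"
    using n mult_right_mono[of 1 n "d * \<Lambda>"] by (simp add: mult.assoc mult.commute[of \<Lambda> d])
  finally have "length (quadsketch L \<Lambda> (shift_list d \<sigma>) X) \<le> 30 * (n * d * \<Lambda>) + n * width n" by simp
  then have "real (length (quadsketch L \<Lambda> (shift_list d \<sigma>) X)) \<le> real (30 * (n * d * \<Lambda>) + n * width n)"
    by (simp only: of_nat_le_iff)
  also have "\<dots> = 30 * real (n * d * \<Lambda>) + real n * real (width n)" by simp
  also have "\<dots> \<le> 30 * real (n * d * \<Lambda>) + real n * (30 * log 2 (real n))"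
  proof (intro add_left_mono mult_left_mono)
    have "log 2 (real n) \<ge> 1" using n by (simp add: le_log_iff)
    moreover have "real (width n) \<le> 1 + log 2 (real n)" using n by (intro width_le_log) simp
    ultimately show "real (width n) \<le> 30 * log 2 (real n)" by linarith
  qed simp
  finally show ?thesis by (simp add: n_def algebra_simps)
qed

lemma full_tree_size:
  "num_edges (full_tree L \<sigma>) \<le> L * length X"
  "T_build L (4 * radius) (corner \<sigma>) (number 0 X) \<le> 40 * d * length X * L + length X + 2"
proof -
  have *: "\<forall>q\<in>set (number 0 X). length (snd q) = length (corner \<sigma>)"
    using dim by (auto simp: number_eq in_set_enumerate_eq)
  have ne: "number 0 X \<noteq> []" by (subst X_eq) simp
  have len: "length (number 0 X) = length X" by (simp add: number_eq)
  have d: "length (corner \<sigma>) \<ge> 1" using d_pos by simp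
  show "num_edges (full_tree L \<sigma>) \<le> L * length X"
    "T_build L (4 * radius) (corner \<sigma>) (number 0 X) \<le> 40 * d * length X * L + length X + 2"
    using build_size[OF * d ne, of L "4 * radius"] unfolding full_tree_def len length_corner by blast+
qed

lemma T_max_dist_le:
  "length x = d \<Longrightarrow> T_max_dist x ys \<le> length ys * (d + 2) + 1"
proof (induction ys)
  case (Cons y ys)
  have "T_sq_dist x y \<le> length x + 1" by (induction x y rule: T_sq_dist.induct) auto
  then show ?case using Cons by simp
qed simp

lemma T_sketch_tree_le:
  assumes "L \<ge> 1"
  shows "T_sketch_tree L \<Lambda> (shift_list d \<sigma>) X \<le> 100 * (length X * d * L)"
proof -
  define n where "n = length X"
  define N where "N = n * d * L"
  have n: "n \<ge> 2" using two_points by (simp add: n_def)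
  have corner: "cube_corner radius (X ! 0) (shift_list d \<sigma>) = corner \<sigma>"
    unfolding corner_def by (intro cube_corner_shift_list) auto
  have T_number: "T_number i xs = length xs + 1" for i xs
    by (induction i xs rule: T_number.induct) auto
  have T_cube: "T_cube_corner D x ss \<le> length x + 1" for D x ss
    by (induction D x ss rule: T_cube_corner.induct) auto
  have "T_sketch_tree L \<Lambda> (shift_list d \<sigma>) X = T_log_radius X + (T_cube_corner radius (X ! 0) (shift_list d \<sigma>) +
      T_number 0 X + T_build L (4 * radius) (corner \<sigma>) (number 0 X) + T_prune_root \<Lambda> (full_tree L \<sigma>)) + 1"
    using T_sketch_tree.simps(2)[of L \<Lambda> "shift_list d \<sigma>" "X ! 0" "tl X"]
    unfolding X_eq[symmetric] radius_def[symmetric] Let_def full_tree_def corner by simp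
  moreover have "T_log_radius X \<le> (n - 1) * (d + 2) + 2"
    using T_max_dist_le[of "X ! 0" "tl X"] T_log_radius.simps(2)[of "X ! 0" "tl X"]
    unfolding X_eq[symmetric] by (simp add: n_def)
  moreover have "T_cube_corner radius (X ! 0) (shift_list d \<sigma>) \<le> d + 1"
    using T_cube[of radius "X ! 0"] by simp
  moreover have "num_edges (full_tree L \<sigma>) \<le> L * n \<and>
      T_build L (4 * radius) (corner \<sigma>) (number 0 X) \<le> 40 * d * n * L + n + 2"
    using full_tree_size[of L \<sigma>] unfolding n_def by blast
  moreover have "T_prune_root \<Lambda> (full_tree L \<sigma>) \<le> 20 * num_edges (full_tree L \<sigma>) + 7" by (rule T_prune_root_le)
  ultimately have "T_sketch_tree L \<Lambda> (shift_list d \<sigma>) X \<le>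
      (n * (d + 2) + 2) + ((d + 1) + (n + 1) + (40 * d * n * L + n + 2) + (20 * (L * n) + 7)) + 1"
    using T_number[of 0 X] mult_right_mono[of "n - 1" n "d + 2"] unfolding n_def[symmetric] by linarith
  also have "\<dots> = n * d + 4 * n + 14 + d + 40 * N + 20 * (L * n)" by (simp add: N_def algebra_simps)
  also have "\<dots> \<le> N + 4 * N + 14 * N + N + 40 * N + 20 * N"
  proof (intro add_mono mult_left_mono)
    show "n * d \<le> N" "n \<le> N" "d \<le> N" "L * n \<le> N" "14 \<le> 14 * N"
      using n d_pos assms by (auto simp: N_def)
  qed auto
  also have "\<dots> \<le> 100 * N" by simp
  finally show ?thesis unfolding N_def n_def .
qed

text \<open>The summand \<open>real d\<close> leaves room for drawing the shift, which the program
  receives as an argument. The single logarithmic factor comes from the bit widths of leaf numbers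
  and long edges and from sorting.\<close>

lemma T_quadsketch_le:
  assumes L: "L \<ge> 1"
  shows "real d + real (T_quadsketch L \<Lambda> (shift_list d \<sigma>) X)
    \<le> 200 * real (length X * d * L) * (1 + log 2 (real (length X * d * L)))"
proof -
  define n where "n = length X"
  define N where "N = n * d * L"
  define W where "W = 1 + log 2 (real N)"
  define E where "E = num_edges (prune_root \<Lambda> (full_tree L \<sigma>))"
  define t where "t = prune_root \<Lambda> (full_tree L \<sigma>)"
  define w where "w = width L"
  define v where "v = width n"
  have n: "n \<ge> 2" using two_points by (simp add: n_def)
  have le: "n \<le> N" "d \<le> N" "L \<le> N" "n * L \<le> N" "1 \<le> N" using n d_pos L by (auto simp: N_def)
  have full: "full (edge_fits d w) t"
    using full_prune_root leaves_full_tree(4) less_two_power_width unfolding w_def t_def by blast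
  have jss: "leaf_sets t [] = map snd (leaves (full_tree L \<sigma>))"
    by (simp only: leaf_sets_eq snd_leaves_prune_root t_def append_Nil2)
  have E: "E \<le> n * L"
    using order_trans[OF num_edges_prune_root full_tree_size(1)] unfolding E_def n_def by (metis mult.commute)
  define ps where "ps = leaf_indices 0 (leaf_sets t [])"
  have ps: "length ps = n" unfolding ps_def t_def n_def by (rule length_leaf_indices)
  have "T_quadsketch L \<Lambda> (shift_list d \<sigma>) X = T_sketch_tree L \<Lambda> (shift_list d \<sigma>) X +
     (T_width L + T_length X + T_width n + T_leaf_sets t [] + T_leaf_indices 0 (leaf_sets t []) + T_msort ps +
      T_encode_indices v (msort ps) + T_encode_tree w t (encode_indices v (msort ps))) + 1"
    by (simp add: sketch_tree_eq Let_def t_def n_def v_def w_def ps_def del: prune_root.simps)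
  moreover have "T_sketch_tree L \<Lambda> (shift_list d \<sigma>) X \<le> 100 * N"
    using T_sketch_tree_le[OF L] by (simp add: N_def n_def)
  moreover have "T_leaf_sets t [] \<le> 3 * E + 2" unfolding E_def t_def by (rule T_leaf_sets_le)
  moreover have "T_leaf_indices 0 (leaf_sets t []) \<le> 3 * n + 1"
    using num_leaves_le[of L \<sigma>] distinct_card[OF leaf_numbers(1)[of L \<sigma>]] leaf_numbers(2)[of L \<sigma>]
    unfolding jss T_leaf_indices_eq n_def by simp
  moreover have "T_msort ps \<le> 9 * n * v + 3"
    using T_msort_le[of ps v] less_two_power_width[of n] unfolding ps v_def by simp
  moreover have "T_encode_indices v (msort ps) \<le> n * (2 * v + 3) + 1"
    by (simp add: T_encode_indices_eq length_msort ps)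
  moreover have "T_encode_tree w t (encode_indices v (msort ps)) \<le> n * L * (d + 2 * w + 6) + 2"
    using T_encode_tree_le(1)[OF full, of "encode_indices v (msort ps)"] mult_right_mono[OF E, of "d + 2 * w + 6"]
    unfolding E_def t_def by linarith
  ultimately have "T_quadsketch L \<Lambda> (shift_list d \<sigma>) X \<le> 100 * N + ((w + 1) + (n + 1) + (v + 1) + (3 * (n * L) + 2) +
     (3 * n + 1) + (9 * n * v + 3) + (n * (2 * v + 3) + 1) + (n * L * (d + 2 * w + 6) + 2)) + 1"
    using E unfolding T_width_eq T_length w_def v_def n_def by linarith
  also have "\<dots> = 100 * N + w + 7 * n + v + 9 * (n * L) + 13 + 11 * (n * v) + N + 2 * (n * L * w)"
    by (simp add: N_def algebra_simps)
  finally have T: "d + T_quadsketch L \<Lambda> (shift_list d \<sigma>) X \<le>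
     d + (100 * N + w + 7 * n + v + 9 * (n * L) + 13 + 11 * (n * v) + N + 2 * (n * L * w))" by simp
  have W1: "W \<ge> 1" using le(5) by (simp add: W_def)
  have logs: "real w \<le> W" "real v \<le> W"
  proof -
    have "log 2 (real L) \<le> log 2 (real N)" "log 2 (real n) \<le> log 2 (real N)"
      using le L n by simp_all
    then show "real w \<le> W" "real v \<le> W"
      using width_le_log[of L] width_le_log[of n] L n unfolding W_def w_def v_def by auto
  qed
  define Z where "Z = real N * W"
  have r1: "real N \<le> Z" "W \<le> Z" "1 \<le> Z"
  proof -
    have "real N * 1 \<le> Z" "1 * W \<le> Z" "1 * 1 \<le> Z"
      unfolding Z_def using le(5) W1 by (intro mult_mono; simp)+
    then show "real N \<le> Z" "W \<le> Z" "1 \<le> Z" by auto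
  qed
  have r2: "real n * real v \<le> Z" "real n * real L * real w \<le> Z"
  proof -
    show "real n * real v \<le> Z" unfolding Z_def using le logs by (intro mult_mono) auto
    have "real (n * L) * real w \<le> Z" unfolding Z_def using le logs by (intro mult_mono; simp only: of_nat_le_iff of_nat_0_le_iff)
    then show "real n * real L * real w \<le> Z" by simp
  qed
  have r3: "real n \<le> Z" "real d \<le> Z" "real n * real L \<le> Z"
    using le(1,2,4) r1(1) by (simp_all flip: of_nat_mult)
  have "real (d + T_quadsketch L \<Lambda> (shift_list d \<sigma>) X) \<le>
     real (d + (100 * N + w + 7 * n + v + 9 * (n * L) + 13 + 11 * (n * v) + N + 2 * (n * L * w)))"
    using T by (simp only: of_nat_le_iff)
  also have "\<dots> = real d + (100 * real N + real w + 7 * real n + real v + 9 * (real n * real L) + 13 +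
     11 * (real n * real v) + real N + 2 * (real n * real L * real w))" by simp
  also have "\<dots> \<le> 200 * Z" using r1 r2 r3 logs by linarith
  finally show ?thesis by (simp add: Z_def W_def N_def n_def)
qed

end

theorem theorem1:
  shows "\<exists>(C::real) (K::real) (c::nat). C > 0 \<and>
    (\<forall>(d::nat) (X::real list list) (\<epsilon>::real) (\<delta>::real) (\<Lambda>::nat).
      length X \<ge> 2 \<longrightarrow> distinct X \<longrightarrow> (\<forall>x\<in>set X. length x = d) \<longrightarrow> \<epsilon> > 0 \<longrightarrow> \<delta> > 0 \<longrightarrow>
      real \<Lambda> \<ge> C * log 2 (2 + real d * max 1 (log 2 (aspect_ratio d X)) / (min 1 \<epsilon> * min 1 \<delta>)) \<longrightarrow>
      (let n = length X;
           L = nat \<lceil>log 2 (aspect_ratio d X)\<rceil> + \<Lambda>;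
           \<Delta> = pow2 (log_radius X);
           M = shift_distr d \<Delta>;
           sketch = (\<lambda>\<sigma>. quadsketch L \<Lambda> (shift_list d \<sigma>) X);
           X' = (\<lambda>\<sigma>. decompress n d L (log_radius X + 2) (sketch \<sigma>))
       in (\<forall>\<sigma>. (\<forall>k<d. \<sigma> k \<in> {-\<Delta>..\<Delta>}) \<longrightarrow>
             real d + real (T_quadsketch L \<Lambda> (shift_list d \<sigma>) X)
               \<le> K * real (n * d * L) * (1 + log 2 (real (n * d * L))) ^ c \<and>
             real (length (sketch \<sigma>)) \<le> K * (real (n * d * \<Lambda>) + real n * log 2 (real n))) \<and>
          (\<forall>i<n.
             \<P>(\<sigma> in M. \<forall>j<n.
                 (1 - \<epsilon>) * eucl_dist d (X ! i) (X ! j) \<le> eucl_dist d (X' \<sigma> ! i) (X' \<sigma> ! j) \<and>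
                 eucl_dist d (X' \<sigma> ! i) (X' \<sigma> ! j) \<le> (1 + \<epsilon>) * eucl_dist d (X ! i) (X ! j))
               \<ge> 1 - \<delta> \<and>
             \<P>(\<sigma> in M. \<forall>k<n.
                 k \<noteq> i \<and>
                 (\<forall>j<n. j \<noteq> i \<longrightarrow> eucl_dist d (X' \<sigma> ! i) (X' \<sigma> ! k) \<le> eucl_dist d (X' \<sigma> ! i) (X' \<sigma> ! j)) \<longrightarrow>
                 (\<forall>j<n. j \<noteq> i \<longrightarrow> eucl_dist d (X ! i) (X ! k) \<le> (1 + \<epsilon>) * eucl_dist d (X ! i) (X ! j)))
               \<ge> 1 - \<delta>)))"
\<comment> \<open>64 is the factor required by \<open>parameter_bounds\<close>, 200 comes from the
  running time and exceeds the 30 of the size bound, and one logarithmic factor suffices.\<close>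
proof (rule exI[of _ 64], rule exI[of _ 200], rule exI[of _ 1], intro conjI allI impI, goal_cases)
  case 1
  show ?case by simp
next
  case (2 d X \<epsilon> \<delta> \<Lambda>)
  interpret pointset d X by unfold_locales (use 2 in auto)
  define L where "L = nat \<lceil>log 2 (aspect_ratio d X)\<rceil> + \<Lambda>"
  have \<Lambda>: "real \<Lambda> \<ge> 64 * log 2 (2 + real d * log_aspect / (min 1 \<epsilon> * min 1 \<delta>))"
    using 2(6) by (simp add: log_aspect_def)
  define ed where "ed = min 1 \<epsilon> * min 1 \<delta>"
  have min: "min 1 \<epsilon> > 0" "min 1 \<epsilon> \<le> 1" "min 1 \<delta> > 0" "min 1 \<delta> \<le> 1" using 2(4,5) by auto
  then have ed: "0 < ed" "ed \<le> 1" unfolding ed_def by (auto simp: mult_le_one)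
  note bounds = parameter_bounds[OF min \<Lambda> L_def, folded ed_def]
  have m: "log_aspect \<ge> 1" by (simp add: log_aspect_def)
  have d: "real d \<ge> 1" using d_pos by simp
  have "real d * log_aspect \<le> real d * log_aspect / ed"
    using ed d m by (simp add: le_divide_eq mult_left_le)
  also have "1 * (real d * log_aspect / ed) \<le> real d * (real d * log_aspect / ed)"
    using d m ed by (intro mult_right_mono) auto
  finally have dm: "real d * log_aspect \<le> real d * (real d * log_aspect / ed)" by simp
  \<comment> \<open>The inequality behind the failure probability, weakened by dropping a factor
    \<open>real d\<close> and the division by \<open>ed\<close>, also yields both exponential
    conditions of \<open>sketch_length_le\<close>.\<close>
  have "720 * real \<Lambda> * (real d * log_aspect) \<le> 720 * real \<Lambda> * (real d * (real d * log_aspect / ed))"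
    by (intro mult_left_mono dm) auto
  also have "\<dots> \<le> 2 ^ \<Lambda>" by (rule bounds(3))
  finally have big: "720 * real \<Lambda> * (real d * log_aspect) \<le> 2 ^ \<Lambda>" .
  have "8 * 1 * (real d * 1) \<le> 720 * real \<Lambda> * (real d * log_aspect)"
    using bounds(1) m d by (intro mult_mono) auto
  then have 1: "8 * real d \<le> 2 ^ \<Lambda>" using big by linarith
  have "6 * real \<Lambda> * (1 * log_aspect) \<le> 720 * real \<Lambda> * (real d * log_aspect)"
    using m d by (intro mult_mono) auto
  then have "2 * real L \<le> 2 ^ \<Lambda>" using big bounds(2) by (simp add: algebra_simps)
  note size = sketch_length_le[OF _ _ 1 this]
  have L1: "L \<ge> 1" using bounds(1) by (simp add: L_def)
  have nonneg: "0 \<le> real (length X * d * \<Lambda>) + real (length X) * log 2 (real (length X))"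
    using two_points by auto
  have length: "real (length (quadsketch L \<Lambda> (shift_list d \<sigma>) X)) \<le>
     200 * (real (length X * d * \<Lambda>) + real (length X) * log 2 (real (length X)))"
    if "\<forall>k<d. \<sigma> k \<in> {-radius..radius}" for \<sigma>
    using size[of \<sigma>] that bounds(1) L1 nonneg by auto
  show ?case
    unfolding Let_def L_def[symmetric] radius_def[symmetric] decoded_def[symmetric] power_one_right
    by (intro conjI allI impI; (rule T_quadsketch_le[OF L1] | rule length, assumption |
        rule prob_guarantees(1)[OF 2(4,5) \<Lambda> L_def], assumption |
        rule prob_guarantees(2)[OF 2(4,5) \<Lambda> L_def], assumption))
qed

end
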